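(* There exist a smooth ($C^\infty$) compact two-dimensional manifold $M$ without boundary, a measure $\sigma$ on $M$ having a $C^\infty$, nowhere vanishing density with respect to Lebesgue measure in any local coordinate system, and a second-order linear partial differential operator $L$ on $M$ with $C^\infty$ coefficients and nonnegative principal symbol, selfadjoint on $L^2(M,\sigma)$, such that: (1) $L$ is elliptic at every point of an open dense subset of $M$; (2) there exists $C<\infty$ such that $\|u\|_{L^2(M,\sigma)}\le C\|Lu\|_{L^2(M,\sigma)}$ for all $u\in C^2(M)$; (3) for any points $p,q\in M$ there exists a subunit path (for $L$) joining $p$ to $q$; and yet $L$ is not globally regular in $C^\infty$.
   Context: $L$ is globally regular in $C^\infty$ if for every distribution $u\in\mathcal{D}'(M)$ with $Lu\in C^\infty(M)$ one has $u\in C^\infty(M)$. Nonnegative principal symbol means that in local coordinates $L=-\sum a_{ij}\partial^2_{x_ix_j}$ plus lower-order terms, with $(a_{ij})$ symmetric and nonnegative definite. Selfadjoint on $L^2(M,\sigma)$ means that $L$ equals its formal adjoint with respect to $\sigma$. A subunit path for $L$ is a Lipschitz continuous function $\gamma:[0,R]\to M$, for some $R<\infty$, such that for almost every $t$, in local coordinates with $L=-\sum a_{ij}\partial^2_{x_ix_j}$ plus lower-order terms and $(a_{ij})$ symmetric, $\big(\sum_j\dot\gamma_j(t)\xi_j\big)^2\le\sum_{i,j}a_{ij}(\gamma(t))\xi_i\xi_j$ for all $\xi\in\mathbb{R}^n$ (here $n=2$). It joins $p$ to $q$ if $\gamma(0)=p$ and $\gamma(R)=q$. *)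

theory Defs
  imports "HOL-Analysis.Analysis"
begin

section \<open>Smooth functions on open subsets of normed spaces\<close>

text \<open>Only meant for open \<open>S\<close>; on finite-dimensional spaces this is the usual class \<open>C\<^sup>k\<close>.\<close>

fun Ck_on :: "nat \<Rightarrow> 'a::real_normed_vector set \<Rightarrow> ('a \<Rightarrow> 'b::real_normed_vector) \<Rightarrow> bool" where
  "Ck_on 0 S f \<longleftrightarrow> continuous_on S f"
| "Ck_on (Suc k) S f \<longleftrightarrow>
     (\<forall>x\<in>S. f differentiable (at x)) \<and> (\<forall>v. Ck_on k S (\<lambda>x. frechet_derivative f (at x) v))"

definition smooth_on :: "'a::real_normed_vector set \<Rightarrow> ('a \<Rightarrow> 'b::real_normed_vector) \<Rightarrow> bool" where
  "smooth_on S f \<longleftrightarrow> (\<forall>k. Ck_on k S f)"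

definition pd :: "'n \<Rightarrow> (real^'n \<Rightarrow> complex) \<Rightarrow> real^'n \<Rightarrow> complex" where
  "pd i f x = frechet_derivative f (at x) (axis i 1)"


section \<open>Smooth manifolds\<close>

text \<open>A chart is a pair of a coordinate domain \<open>U\<close> and a coordinate map; the values of the
  coordinate map outside \<open>U\<close> are irrelevant.\<close>

type_synonym ('a, 'n) chart = "'a set \<times> ('a \<Rightarrow> real^'n)"

abbreviation cdom :: "('a, 'n::finite) chart \<Rightarrow> 'a set" where
  "cdom C \<equiv> fst C"

abbreviation coord :: "('a, 'n::finite) chart \<Rightarrow> 'a \<Rightarrow> real^'n" where
  "coord C \<equiv> snd C"

definition cimg :: "('a, 'n::finite) chart \<Rightarrow> (real^'n) set" where
  "cimg C = coord C ` cdom C"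

definition param :: "('a, 'n::finite) chart \<Rightarrow> real^'n \<Rightarrow> 'a" where
  "param C = inv_into (cdom C) (coord C)"

definition is_chart :: "'a topology \<Rightarrow> ('a, 'n::finite) chart \<Rightarrow> bool" where
  "is_chart X C \<longleftrightarrow> openin X (cdom C) \<and> open (cimg C) \<and>
     homeomorphic_map (subtopology X (cdom C)) (top_of_set (cimg C)) (coord C)"

definition compatible :: "('a, 'n::finite) chart \<Rightarrow> ('a, 'n) chart \<Rightarrow> bool" where
  "compatible C D \<longleftrightarrow>
     smooth_on (coord C ` (cdom C \<inter> cdom D)) (coord D \<circ> param C) \<and>
     smooth_on (coord D ` (cdom C \<inter> cdom D)) (coord C \<circ> param D)"

text \<open>The smooth structure \<open>A\<close> is a maximal atlas, so that quantifying over \<open>C \<in> A\<close> means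
  quantifying over all local coordinate systems of the manifold.  There is no boundary, since
  charts have open images in \<open>real^'n\<close>.\<close>

definition smooth_manifold :: "'a topology \<Rightarrow> ('a, 'n::finite) chart set \<Rightarrow> bool" where
  "smooth_manifold X A \<longleftrightarrow>
     Hausdorff_space X \<and> second_countable X \<and>
     (\<forall>C\<in>A. is_chart X C) \<and> (\<forall>C\<in>A. \<forall>D\<in>A. compatible C D) \<and>
     \<Union> (cdom ` A) = topspace X \<and>
     (\<forall>C. is_chart X C \<and> (\<forall>D\<in>A. compatible C D) \<longrightarrow> C \<in> A)"

text \<open>The spaces \<open>C\<^sup>k(M)\<close> and \<open>C\<^sup>\<infinity>(M)\<close>; values of functions outside \<open>topspace X\<close> play no role.\<close>

definition Ck_fun :: "('a, 'n::finite) chart set \<Rightarrow> nat \<Rightarrow> ('a \<Rightarrow> complex) \<Rightarrow> bool" where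
  "Ck_fun A k u \<longleftrightarrow> (\<forall>C\<in>A. Ck_on k (cimg C) (u \<circ> param C))"

definition smooth_fun :: "('a, 'n::finite) chart set \<Rightarrow> ('a \<Rightarrow> complex) \<Rightarrow> bool" where
  "smooth_fun A u \<longleftrightarrow> (\<forall>C\<in>A. smooth_on (cimg C) (u \<circ> param C))"

text \<open>As \<open>\<sigma>\<close> is a (positive) measure, a nowhere vanishing density is a positive one.\<close>

definition smooth_measure ::
    "'a topology \<Rightarrow> ('a, 'n::finite) chart set \<Rightarrow> 'a measure \<Rightarrow> bool" where
  "smooth_measure X A \<sigma> \<longleftrightarrow>
     sets \<sigma> = sigma_sets (topspace X) {U. openin X U} \<and>
     (\<forall>C\<in>A. \<exists>\<rho> :: real^'n \<Rightarrow> real.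
        smooth_on (cimg C) \<rho> \<and> (\<forall>x\<in>cimg C. 0 < \<rho> x) \<and>
        (\<forall>B \<in> sets borel. B \<subseteq> cimg C \<longrightarrow>
           emeasure \<sigma> {p \<in> cdom C. coord C p \<in> B} = (\<integral>\<^sup>+x\<in>B. ennreal (\<rho> x) \<partial>lborel)))"

definition L2norm :: "'a measure \<Rightarrow> ('a \<Rightarrow> complex) \<Rightarrow> real" where
  "L2norm \<sigma> u = sqrt (\<integral>p. (cmod (u p))\<^sup>2 \<partial>\<sigma>)"


section \<open>Second-order differential operators\<close>

text \<open>\<open>L\<close> acts on \<open>u \<in> C\<^sup>2(M)\<close>.  In the chart \<open>C\<close> it has the form
  \<open>- \<Sum> a\<^sub>i\<^sub>j \<partial>\<^sub>i \<partial>\<^sub>j + \<Sum> b\<^sub>i \<partial>\<^sub>i + c\<close> with smooth, in general complex, coefficients and \<open>a\<close> symmetric.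
  The coefficients are uniquely determined on \<open>cimg C\<close> by \<open>L\<close>.\<close>

definition local_form ::
    "('a, 'n::finite) chart set \<Rightarrow> (('a \<Rightarrow> complex) \<Rightarrow> 'a \<Rightarrow> complex) \<Rightarrow> ('a, 'n) chart \<Rightarrow>
     (real^'n \<Rightarrow> complex^'n^'n) \<Rightarrow> (real^'n \<Rightarrow> complex^'n) \<Rightarrow> (real^'n \<Rightarrow> complex) \<Rightarrow> bool" where
  "local_form A L C a b c \<longleftrightarrow>
     smooth_on (cimg C) a \<and> smooth_on (cimg C) b \<and> smooth_on (cimg C) c \<and>
     (\<forall>x\<in>cimg C. transpose (a x) = a x) \<and>
     (\<forall>u. Ck_fun A 2 u \<longrightarrow> (\<forall>x\<in>cimg C.
        L u (param C x) =
          - (\<Sum>i\<in>UNIV. \<Sum>j\<in>UNIV. a x $ i $ j * pd i (pd j (u \<circ> param C)) x)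
          + (\<Sum>i\<in>UNIV. b x $ i * pd i (u \<circ> param C) x)
          + c x * u (param C x)))"

definition second_order_operator ::
    "('a, 'n::finite) chart set \<Rightarrow> (('a \<Rightarrow> complex) \<Rightarrow> 'a \<Rightarrow> complex) \<Rightarrow> bool" where
  "second_order_operator A L \<longleftrightarrow> (\<forall>C\<in>A. \<exists>a b c. local_form A L C a b c)"

definition real_principal_part ::
    "('a, 'n::finite) chart set \<Rightarrow> (('a \<Rightarrow> complex) \<Rightarrow> 'a \<Rightarrow> complex) \<Rightarrow> ('a, 'n) chart \<Rightarrow>
     (real^'n \<Rightarrow> real^'n^'n) \<Rightarrow> bool" where
  "real_principal_part A L C a \<longleftrightarrow>
     (\<exists>b c. local_form A L C (\<lambda>x. \<chi> i j. complex_of_real (a x $ i $ j)) b c)"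

definition nonneg_principal_symbol ::
    "('a, 'n::finite) chart set \<Rightarrow> (('a \<Rightarrow> complex) \<Rightarrow> 'a \<Rightarrow> complex) \<Rightarrow> bool" where
  "nonneg_principal_symbol A L \<longleftrightarrow>
     (\<forall>C\<in>A. \<exists>a. real_principal_part A L C a \<and> (\<forall>x\<in>cimg C. \<forall>\<xi>. 0 \<le> \<xi> \<bullet> (a x *v \<xi>)))"

definition elliptic_at ::
    "('a, 'n::finite) chart set \<Rightarrow> (('a \<Rightarrow> complex) \<Rightarrow> 'a \<Rightarrow> complex) \<Rightarrow> 'a \<Rightarrow> bool" where
  "elliptic_at A L p \<longleftrightarrow>
     (\<forall>C\<in>A. p \<in> cdom C \<longrightarrow> (\<exists>a b c. local_form A L C a b c \<and>
        (\<forall>\<xi>. \<xi> \<noteq> 0 \<longrightarrow>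
           (\<Sum>i\<in>UNIV. \<Sum>j\<in>UNIV. a (coord C p) $ i $ j * complex_of_real (\<xi> $ i * \<xi> $ j)) \<noteq> 0)))"

text \<open>\<open>L'\<close> is the formal adjoint of \<open>L\<close> on a compact manifold, where all of \<open>C\<^sup>\<infinity>(M)\<close> serves as
  the space of test functions.\<close>

definition formal_adjoint ::
    "('a, 'n::finite) chart set \<Rightarrow> 'a measure \<Rightarrow> (('a \<Rightarrow> complex) \<Rightarrow> 'a \<Rightarrow> complex) \<Rightarrow>
     (('a \<Rightarrow> complex) \<Rightarrow> 'a \<Rightarrow> complex) \<Rightarrow> bool" where
  "formal_adjoint A \<sigma> L L' \<longleftrightarrow>
     second_order_operator A L \<and> second_order_operator A L' \<and>
     (\<forall>u v. smooth_fun A u \<and> smooth_fun A v \<longrightarrow>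
        (\<integral>p. L u p * cnj (v p) \<partial>\<sigma>) = (\<integral>p. u p * cnj (L' v p) \<partial>\<sigma>))"

definition formally_selfadjoint ::
    "('a, 'n::finite) chart set \<Rightarrow> 'a measure \<Rightarrow> (('a \<Rightarrow> complex) \<Rightarrow> 'a \<Rightarrow> complex) \<Rightarrow> bool" where
  "formally_selfadjoint A \<sigma> L \<longleftrightarrow> formal_adjoint A \<sigma> L L"


section \<open>Subunit paths\<close>

text \<open>Lipschitz continuity is expressed in local coordinates; on the compact interval
  \<open>{0..R}\<close> this is Lipschitz continuity for any Riemannian distance.\<close>

definition lipschitz_path ::
    "'a topology \<Rightarrow> ('a, 'n::finite) chart set \<Rightarrow> real \<Rightarrow> (real \<Rightarrow> 'a) \<Rightarrow> bool" where
  "lipschitz_path X A R \<gamma> \<longleftrightarrow>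
     continuous_map (top_of_set {0..R}) X \<gamma> \<and>
     (\<forall>C\<in>A. \<forall>s t. 0 \<le> s \<and> s \<le> t \<and> t \<le> R \<and> \<gamma> ` {s..t} \<subseteq> cdom C \<longrightarrow>
        (\<exists>K. K-lipschitz_on {s..t} (coord C \<circ> \<gamma>)))"

definition subunit_path ::
    "'a topology \<Rightarrow> ('a, 'n::finite) chart set \<Rightarrow> (('a \<Rightarrow> complex) \<Rightarrow> 'a \<Rightarrow> complex) \<Rightarrow>
     real \<Rightarrow> (real \<Rightarrow> 'a) \<Rightarrow> bool" where
  "subunit_path X A L R \<gamma> \<longleftrightarrow>
     0 \<le> R \<and> lipschitz_path X A R \<gamma> \<and>
     (AE t in lebesgue. t \<in> {0..R} \<longrightarrow>
        (\<forall>C\<in>A. \<gamma> t \<in> cdom C \<longrightarrow>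
           (\<exists>a v. real_principal_part A L C a \<and>
              ((coord C \<circ> \<gamma>) has_vector_derivative v) (at t within {0..R}) \<and>
              (\<forall>\<xi>. (v \<bullet> \<xi>)\<^sup>2 \<le> \<xi> \<bullet> (a (coord C (\<gamma> t)) *v \<xi>)))))"


section \<open>Distributions and global regularity\<close>

text \<open>Convergence to zero in the Frechet space \<open>C\<^sup>\<infinity>(M)\<close>: all iterated partial derivatives
  tend to zero uniformly on compact subsets of coordinate patches.\<close>

definition smooth_null_seq ::
    "('a, 'n::finite) chart set \<Rightarrow> (nat \<Rightarrow> 'a \<Rightarrow> complex) \<Rightarrow> bool" where
  "smooth_null_seq A f \<longleftrightarrow>
     (\<forall>n. smooth_fun A (f n)) \<and>
     (\<forall>C\<in>A. \<forall>K is. compact K \<and> K \<subseteq> cimg C \<longrightarrow>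
        uniform_limit K (\<lambda>n. fold pd is (f n \<circ> param C)) (\<lambda>_. 0) sequentially)"

text \<open>For compact \<open>M\<close>: continuous linear functionals on \<open>C\<^sup>\<infinity>(M)\<close> (sequential continuity is
  continuity, \<open>C\<^sup>\<infinity>(M)\<close> being metrizable).  A function \<open>f\<close> is identified with the functional
  \<open>\<phi> \<mapsto> \<integral> f \<phi> d\<sigma>\<close>.  The continuity condition implies that \<open>T \<phi>\<close> depends only on the restriction
  of \<open>\<phi>\<close> to the manifold.\<close>

definition distribution ::
    "('a, 'n::finite) chart set \<Rightarrow> (('a \<Rightarrow> complex) \<Rightarrow> complex) \<Rightarrow> bool" where
  "distribution A T \<longleftrightarrow>
     (\<forall>f g. smooth_fun A f \<and> smooth_fun A g \<longrightarrow> T (\<lambda>p. f p + g p) = T f + T g) \<and>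
     (\<forall>z f. smooth_fun A f \<longrightarrow> T (\<lambda>p. z * f p) = z * T f) \<and>
     (\<forall>f. smooth_null_seq A f \<longrightarrow> (\<lambda>n. T (f n)) \<longlonglongrightarrow> 0)"

definition smooth_distribution ::
    "('a, 'n::finite) chart set \<Rightarrow> 'a measure \<Rightarrow> (('a \<Rightarrow> complex) \<Rightarrow> complex) \<Rightarrow> bool" where
  "smooth_distribution A \<sigma> T \<longleftrightarrow>
     (\<exists>f. smooth_fun A f \<and> (\<forall>\<phi>. smooth_fun A \<phi> \<longrightarrow> T \<phi> = (\<integral>p. f p * \<phi> p \<partial>\<sigma>)))"

text \<open>If \<open>L'\<close> is the formal adjoint of \<open>L\<close>, then \<open>\<phi> \<mapsto> cnj (L' (cnj \<phi>))\<close> is the formal transpose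
  with respect to the bilinear pairing \<open>\<integral> f \<phi> d\<sigma>\<close>, and the distribution \<open>L T\<close> is
  \<open>apply_adjoint L' T\<close>.\<close>

definition apply_adjoint ::
    "(('a \<Rightarrow> complex) \<Rightarrow> 'a \<Rightarrow> complex) \<Rightarrow> (('a \<Rightarrow> complex) \<Rightarrow> complex) \<Rightarrow>
     ('a \<Rightarrow> complex) \<Rightarrow> complex" where
  "apply_adjoint L' T \<phi> = T (\<lambda>p. cnj (L' (\<lambda>q. cnj (\<phi> q)) p))"

text \<open>Every second-order operator has a formal adjoint, unique as an operator on \<open>C\<^sup>\<infinity>(M)\<close>, so
  the quantifier over \<open>L'\<close> just names it.\<close>

definition globally_regular ::
    "('a, 'n::finite) chart set \<Rightarrow> 'a measure \<Rightarrow> (('a \<Rightarrow> complex) \<Rightarrow> 'a \<Rightarrow> complex) \<Rightarrow> bool" where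
  "globally_regular A \<sigma> L \<longleftrightarrow>
     (\<forall>L' T. formal_adjoint A \<sigma> L L' \<and> distribution A T \<and>
        smooth_distribution A \<sigma> (apply_adjoint L' T) \<longrightarrow> smooth_distribution A \<sigma> T)"

end

theory Submission
  imports Defs
begin

text \<open>
  The manifold is the torus with coordinates \<open>(x, t)\<close> modulo \<open>2 pi\<close>, the measure is \<open>dx dt\<close>, and the operator is
  \<open>L = - \<partial>\<^sub>x\<^sup>2 - \<partial>\<^sub>t (b \<partial>\<^sub>t) + 1\<close> with \<open>b = 4 sin\<^sup>2 t + \<phi>(x)\<close>, where \<open>\<phi>\<close> is smooth, vanishes for \<open>|x| \<le> pi / 2\<close>
  and is positive for the other \<open>x\<close>. It is in divergence form, hence selfadjoint, and its energy dominates the square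
  of the \<open>L\<^sup>2\<close> norm, which gives the a priori estimate. The operator degenerates only on the two segments \<open>t = 0\<close> and
  \<open>t = pi\<close>, \<open>|x| \<le> pi / 2\<close>. As the coefficient of \<open>\<partial>\<^sub>x\<^sup>2\<close> is \<open>1\<close>, subunit paths leave the segments in the \<open>x\<close> direction;
  they can change \<open>t\<close> over \<open>x = pi\<close>, where \<open>b\<close> is bounded below.

  Global regularity fails for the following reason. Near the segments \<open>b\<close> is approximately \<open>4 t\<^sup>2\<close>, so that
  \<open>t\<^sup>z cos x\<close> is approximately a solution of the homogeneous equation when \<open>4 z (z + 1) = 2\<close>, and the positive root of
  this equation is smaller than \<open>1\<close>. A positive solution which vanishes for \<open>t = 0\<close> should therefore be at least of this
  size, and so not be differentiable in \<open>t\<close>. To make this rigorous, take the source \<open>sin t\<close>.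

  A weak solution exists, because the energy functional has a minimising sequence which is Cauchy in \<open>L\<^sup>2\<close>
  (\<open>minimizing_sequence\<close>, \<open>weak_limit_distribution\<close>, \<open>weak_solution\<close>). If \<open>L\<close> were globally regular, this distribution
  would be a smooth function \<open>w\<close> satisfying the equation pointwise (\<open>globally_regular_imp_smooth_solution\<close>). The odd part
  \<open>D(x, t) = Re w(x, t) - Re w(x, -t)\<close> solves \<open>L D = 2 sin t\<close> and vanishes at \<open>t = 0\<close> and \<open>t = pi\<close>; by the minimum
  principle it is nonnegative for \<open>0 \<le> t \<le> pi\<close> (\<open>odd_part_nonneg\<close>). On the rectangle \<open>|x| \<le> pi / 2\<close>, \<open>0 \<le> t \<le> pi\<close> it
  is then compared with an explicit subsolution with exponent \<open>1 / 2\<close>, which is larger than the root above and so leaves room for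
  the error terms: the result is \<open>D \<ge> 2 / 5 sqrt (sin t) cos x\<close> (\<open>odd_part_lower_bound\<close>). This contradicts the
  differentiability of \<open>D(0, t)\<close> at \<open>t = 0\<close> (\<open>no_smooth_solution\<close>).

  The analysis takes place on the plane, where functions on the torus become doubly periodic functions via the covering map
  \<open>wrap\<close>. The statements about arbitrary charts of the maximal atlas follow from the fact that \<open>wrap\<close> is a local
  diffeomorphism in every chart (\<open>smooth_on_coord_wrap\<close>, \<open>smooth_local_lift\<close>).
\<close>


section \<open>Calculus of \<open>C\<^sup>k\<close> functions\<close>

lemma has_derivative_cong_open:
  assumes "open S" "x \<in> S" "\<And>y. y \<in> S \<Longrightarrow> f y = g y"
  shows "(f has_derivative D) (at x) \<longleftrightarrow> (g has_derivative D) (at x)"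
  using has_derivative_transform_within_open[of f D x UNIV S g]
    has_derivative_transform_within_open[of g D x UNIV S f] assms by auto

lemma frechet_derivative_cong_open:
  assumes "open S" "x \<in> S" "\<And>y. y \<in> S \<Longrightarrow> f y = g y"
  shows "frechet_derivative f (at x) = frechet_derivative g (at x)"
  unfolding frechet_derivative_def by (simp add: has_derivative_cong_open[OF assms])

lemma differentiable_cong_open:
  assumes "open S" "x \<in> S" "\<And>y. y \<in> S \<Longrightarrow> f y = g y"
  shows "f differentiable (at x) \<longleftrightarrow> g differentiable (at x)"
  unfolding differentiable_def by (simp add: has_derivative_cong_open[OF assms])

lemma frechet_derivativeI: "(f has_derivative D) (at x) \<Longrightarrow> frechet_derivative f (at x) = D"
  by (rule frechet_derivative_at[symmetric])

lemma frechet_derivative_has_derivative: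
  "f differentiable (at x) \<Longrightarrow> (f has_derivative frechet_derivative f (at x)) (at x)"
  by (simp add: frechet_derivative_works)

lemma Ck_on_cong:
  assumes "open S" "\<And>y. y \<in> S \<Longrightarrow> f y = g y"
  shows "Ck_on k S f \<longleftrightarrow> Ck_on k S g"
  using assms(2)
proof (induction k arbitrary: f g)
  case 0
  then show ?case using continuous_on_cong[of S S f g] by simp
next
  case (Suc k)
  have "Ck_on k S (\<lambda>x. frechet_derivative f (at x) v) = Ck_on k S (\<lambda>x. frechet_derivative g (at x) v)" for v
    by (rule Suc.IH) (simp add: frechet_derivative_cong_open[OF assms(1) _ Suc.prems])
  then show ?case
    by (simp add: differentiable_cong_open[OF assms(1) _ Suc.prems])
qed

lemma Ck_on_SucI:
  assumes "\<And>x. x \<in> S \<Longrightarrow> (f has_derivative D x) (at x)" "open S"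
    "\<And>v. Ck_on k S (\<lambda>x. D x v)"
  shows "Ck_on (Suc k) S f"
proof -
  have "Ck_on k S (\<lambda>x. frechet_derivative f (at x) v)" for v
    by (rule Ck_on_cong[THEN iffD2, OF assms(2) _ assms(3)]) (simp add: frechet_derivativeI[OF assms(1)])
  then show ?thesis using assms(1) by (auto simp: differentiable_def)
qed

lemma Ck_on_imp_continuous_on: "Ck_on k S f \<Longrightarrow> continuous_on S f"
  by (cases k) (auto intro!: continuous_at_imp_continuous_on differentiable_imp_continuous_within)

lemma Ck_on_lower: "Ck_on (Suc k) S f \<Longrightarrow> Ck_on k S f"
proof (induction k arbitrary: f)
  case 0
  then show ?case using Ck_on_imp_continuous_on[OF 0] by simp
next
  case (Suc k)
  then show ?case by simp
qed

lemma Ck_on_subset: "Ck_on k S f \<Longrightarrow> S' \<subseteq> S \<Longrightarrow> Ck_on k S' f"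
proof (induction k arbitrary: f)
  case 0
  then show ?case using continuous_on_subset by auto
next
  case (Suc k)
  then show ?case by auto
qed

lemma Ck_on_local:
  assumes "\<And>x. x \<in> S \<Longrightarrow> \<exists>N. open N \<and> x \<in> N \<and> Ck_on k N f"
  shows "Ck_on k S f"
  using assms
proof (induction k arbitrary: f)
  case 0
  show ?case
  proof (simp, rule continuous_at_imp_continuous_on, rule ballI)
    fix x assume "x \<in> S"
    with 0 obtain N where "open N" "x \<in> N" "continuous_on N f" by auto
    then show "isCont f x" using continuous_on_eq_continuous_at by blast
  qed
next
  case (Suc k)
  have "f differentiable (at x)" if "x \<in> S" for x
    using Suc.prems[OF that] by auto
  moreover have "Ck_on k S (\<lambda>x. frechet_derivative f (at x) v)" for v
    by (rule Suc.IH) (use Suc.prems in force)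
  ultimately show ?case by simp
qed

lemma Ck_on_const: "Ck_on k S (\<lambda>x. c)"
  by (induction k arbitrary: c) auto

lemma Ck_on_bounded_linear_id:
  assumes "bounded_linear h"
  shows "Ck_on k S h"
proof (cases k)
  case 0
  then show ?thesis by (simp add: assms linear_continuous_on)
next
  case (Suc m)
  have "(h has_derivative h) (at x)" for x
    using assms by (rule bounded_linear_imp_has_derivative)
  moreover from this have "(\<lambda>x. frechet_derivative h (at x) v) = (\<lambda>x. h v)" for v
    using frechet_derivativeI by metis
  ultimately show ?thesis using Suc by (auto simp: differentiable_def Ck_on_const)
qed

lemma Ck_on_bounded_linear:
  assumes "bounded_linear h" "Ck_on k S f" "open S"
  shows "Ck_on k S (\<lambda>x. h (f x))"
  using assms(2)
proof (induction k arbitrary: f)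
  case 0
  then show ?case by (simp add: bounded_linear.continuous_on[OF assms(1)])
next
  case (Suc k)
  show ?case
  proof (rule Ck_on_SucI[OF _ assms(3)])
    fix x assume "x \<in> S"
    then have "f differentiable (at x)" using Suc.prems by auto
    then show "((\<lambda>x. h (f x)) has_derivative (\<lambda>v. h (frechet_derivative f (at x) v))) (at x)"
      by (intro bounded_linear.has_derivative[OF assms(1)] frechet_derivative_has_derivative)
  next
    fix v show "Ck_on k S (\<lambda>x. h (frechet_derivative f (at x) v))"
      by (rule Suc.IH) (use Suc.prems in auto)
  qed
qed

lemma Ck_on_add:
  assumes "open S" "Ck_on k S f" "Ck_on k S g"
  shows "Ck_on k S (\<lambda>x. f x + g x)"
  using assms(2,3)
proof (induction k arbitrary: f g)
  case 0
  then show ?case by (simp add: continuous_on_add)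
next
  case (Suc k)
  show ?case
  proof (rule Ck_on_SucI[OF _ assms(1)])
    fix x assume "x \<in> S"
    then have "f differentiable (at x)" "g differentiable (at x)" using Suc.prems by auto
    then show "((\<lambda>x. f x + g x) has_derivative
        (\<lambda>v. frechet_derivative f (at x) v + frechet_derivative g (at x) v)) (at x)"
      by (intro has_derivative_add frechet_derivative_has_derivative)
  next
    fix v show "Ck_on k S (\<lambda>x. frechet_derivative f (at x) v + frechet_derivative g (at x) v)"
      by (rule Suc.IH) (use Suc.prems in auto)
  qed
qed

lemma Ck_on_sum:
  assumes "open S" "\<And>i. i \<in> I \<Longrightarrow> Ck_on k S (f i)"
  shows "Ck_on k S (\<lambda>x. \<Sum>i\<in>I. f i x)"
  using assms(2)
proof (induction I rule: infinite_finite_induct)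
  case (insert i I)
  then have "Ck_on k S (\<lambda>x. f i x + (\<Sum>i\<in>I. f i x))"
    by (intro Ck_on_add assms(1)) auto
  with insert show ?case by simp
qed (simp_all add: Ck_on_const)

lemma Ck_on_bilinear:
  assumes h: "bounded_bilinear h" and S: "open S" and "Ck_on k S f" "Ck_on k S g"
  shows "Ck_on k S (\<lambda>x. h (f x) (g x))"
  using assms(3,4)
proof (induction k arbitrary: f g)
  case 0
  then show ?case by (simp add: bounded_bilinear.continuous_on[OF h])
next
  case (Suc k)
  show ?case
  proof (rule Ck_on_SucI[OF _ S])
    fix x assume "x \<in> S"
    then have "f differentiable (at x)" "g differentiable (at x)" using Suc.prems by auto
    then show "((\<lambda>x. h (f x) (g x)) has_derivative
        (\<lambda>v. h (f x) (frechet_derivative g (at x) v) + h (frechet_derivative f (at x) v) (g x))) (at x)"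
      by (intro bounded_bilinear.FDERIV[OF h] frechet_derivative_has_derivative)
  next
    fix v
    have f: "Ck_on k S f" "Ck_on k S g" using Suc.prems Ck_on_lower by blast+
    have "Ck_on k S (\<lambda>x. frechet_derivative f (at x) v)" "Ck_on k S (\<lambda>x. frechet_derivative g (at x) v)"
      using Suc.prems by auto
    with f show "Ck_on k S (\<lambda>x. h (f x) (frechet_derivative g (at x) v) + h (frechet_derivative f (at x) v) (g x))"
      by (intro Ck_on_add S Suc.IH)
  qed
qed

text \<open>The domain of the outer function is finite-dimensional, so that its derivative in a variable
  direction is a finite combination of derivatives in fixed directions.\<close>

lemma Ck_on_compose:
  fixes f :: "'b::euclidean_space \<Rightarrow> 'c::real_normed_vector"
  assumes S: "open S" and T: "open T" and "Ck_on k S g" "Ck_on k T f" "g ` S \<subseteq> T"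
  shows "Ck_on k S (\<lambda>x. f (g x))"
  using assms(3,4)
proof (induction k arbitrary: f)
  case 0
  then show ?case using assms(5) by (simp add: continuous_on_compose2)
next
  case (Suc k)
  define D where "D x v = (\<Sum>b\<in>Basis. (frechet_derivative g (at x) v \<bullet> b) *\<^sub>R frechet_derivative f (at (g x)) b)" for x v
  show ?case
  proof (rule Ck_on_SucI[OF _ S])
    fix x assume x: "x \<in> S"
    then have "g differentiable (at x)" using Suc.prems by auto
    then have g: "(g has_derivative frechet_derivative g (at x)) (at x)"
      by (rule frechet_derivative_has_derivative)
    have "f differentiable (at (g x))" using x Suc.prems assms(5) by auto
    then have f: "(f has_derivative frechet_derivative f (at (g x))) (at (g x))"
      by (rule frechet_derivative_has_derivative)
    have lin: "linear (frechet_derivative f (at (g x)))"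
      using f has_derivative_linear by blast
    have "frechet_derivative f (at (g x)) (\<Sum>b\<in>Basis. (w \<bullet> b) *\<^sub>R b)
        = (\<Sum>b\<in>Basis. (w \<bullet> b) *\<^sub>R frechet_derivative f (at (g x)) b)" for w
      by (simp only: linear_sum[OF lin] linear_scale[OF lin])
    then have "frechet_derivative f (at (g x)) (frechet_derivative g (at x) v) = D x v" for v
      unfolding D_def euclidean_representation by blast
    then have "(\<lambda>v. frechet_derivative f (at (g x)) (frechet_derivative g (at x) v)) = D x" ..
    then show "((\<lambda>x. f (g x)) has_derivative D x) (at x)"
      using has_derivative_compose[OF g f] by simp
  next
    fix v
    have "Ck_on k S (\<lambda>x. frechet_derivative f (at (g x)) b)" for b
      by (rule Suc.IH) (use Suc.prems Ck_on_lower in auto)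
    moreover have "Ck_on k S (\<lambda>x. frechet_derivative g (at x) v \<bullet> b)" for b
      by (rule Ck_on_bounded_linear[OF bounded_linear_inner_left]) (use Suc.prems S in auto)
    ultimately show "Ck_on k S (\<lambda>x. D x v)"
      unfolding D_def by (intro Ck_on_sum S Ck_on_bilinear[OF bounded_bilinear_scaleR])
  qed
qed

lemma smooth_on_imp_Ck: "smooth_on S f \<Longrightarrow> Ck_on k S f"
  by (simp add: smooth_on_def)

lemma smooth_on_cong:
  "open S \<Longrightarrow> (\<And>y. y \<in> S \<Longrightarrow> f y = g y) \<Longrightarrow> smooth_on S f \<longleftrightarrow> smooth_on S g"
  unfolding smooth_on_def using Ck_on_cong[of S f g] by auto

lemma smooth_on_imp_continuous_on: "smooth_on S f \<Longrightarrow> continuous_on S f"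
  using Ck_on_imp_continuous_on smooth_on_def by blast

lemma smooth_on_imp_differentiable: "smooth_on S f \<Longrightarrow> x \<in> S \<Longrightarrow> f differentiable (at x)"
  unfolding smooth_on_def using Ck_on.simps(2)[of 0] by blast

lemma smooth_on_subset: "smooth_on S f \<Longrightarrow> S' \<subseteq> S \<Longrightarrow> smooth_on S' f"
  unfolding smooth_on_def by (blast intro: Ck_on_subset)

lemma smooth_on_local:
  "(\<And>x. x \<in> S \<Longrightarrow> \<exists>N. open N \<and> x \<in> N \<and> smooth_on N f) \<Longrightarrow> smooth_on S f"
  unfolding smooth_on_def by (intro allI Ck_on_local) blast

lemma smooth_on_const: "smooth_on S (\<lambda>x. c)"
  by (simp add: smooth_on_def Ck_on_const)

lemma smooth_on_bounded_linear_id: "bounded_linear h \<Longrightarrow> smooth_on S h"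
  by (simp add: smooth_on_def Ck_on_bounded_linear_id)

lemma smooth_on_bounded_linear:
  "bounded_linear h \<Longrightarrow> smooth_on S f \<Longrightarrow> open S \<Longrightarrow> smooth_on S (\<lambda>x. h (f x))"
  by (simp add: smooth_on_def Ck_on_bounded_linear)

lemma smooth_on_add:
  "open S \<Longrightarrow> smooth_on S f \<Longrightarrow> smooth_on S g \<Longrightarrow> smooth_on S (\<lambda>x. f x + g x)"
  by (simp add: smooth_on_def Ck_on_add)

lemma smooth_on_sum:
  "open S \<Longrightarrow> (\<And>i. i \<in> I \<Longrightarrow> smooth_on S (f i)) \<Longrightarrow> smooth_on S (\<lambda>x. \<Sum>i\<in>I. f i x)"
  by (simp add: smooth_on_def Ck_on_sum)

lemma smooth_on_bilinear:
  "bounded_bilinear h \<Longrightarrow> open S \<Longrightarrow> smooth_on S f \<Longrightarrow> smooth_on S g \<Longrightarrow> smooth_on S (\<lambda>x. h (f x) (g x))"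
  by (simp add: smooth_on_def Ck_on_bilinear)

lemma Ck_on_mult:
  fixes f g :: "'a::real_normed_vector \<Rightarrow> 'b::real_normed_algebra"
  shows "open S \<Longrightarrow> Ck_on k S f \<Longrightarrow> Ck_on k S g \<Longrightarrow> Ck_on k S (\<lambda>x. f x * g x)"
  by (rule Ck_on_bilinear[OF bounded_bilinear_mult])

lemma smooth_on_mult:
  fixes f g :: "'a::real_normed_vector \<Rightarrow> 'b::real_normed_algebra"
  shows "open S \<Longrightarrow> smooth_on S f \<Longrightarrow> smooth_on S g \<Longrightarrow> smooth_on S (\<lambda>x. f x * g x)"
  by (rule smooth_on_bilinear[OF bounded_bilinear_mult])

lemma smooth_on_uminus: "open S \<Longrightarrow> smooth_on S f \<Longrightarrow> smooth_on S (\<lambda>x. - f x)"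
  by (rule smooth_on_bounded_linear[OF bounded_linear_minus[OF bounded_linear_ident]])

lemma smooth_on_diff:
  "open S \<Longrightarrow> smooth_on S f \<Longrightarrow> smooth_on S g \<Longrightarrow> smooth_on S (\<lambda>x. f x - g x)"
  using smooth_on_add[of S f "\<lambda>x. - g x"] smooth_on_uminus by auto

lemma smooth_on_compose:
  fixes f :: "'b::euclidean_space \<Rightarrow> 'c::real_normed_vector"
  shows "open S \<Longrightarrow> open T \<Longrightarrow> smooth_on S g \<Longrightarrow> smooth_on T f \<Longrightarrow> g ` S \<subseteq> T
    \<Longrightarrow> smooth_on S (\<lambda>x. f (g x))"
  unfolding smooth_on_def by (intro allI) (rule Ck_on_compose, auto)

lemma smooth_on_frechet_derivative:
  "smooth_on S f \<Longrightarrow> smooth_on S (\<lambda>x. frechet_derivative f (at x) v)"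
  unfolding smooth_on_def by (metis Ck_on.simps(2))

lemma smooth_on_vec_lambda:
  fixes f :: "'i::finite \<Rightarrow> 'a::real_normed_vector \<Rightarrow> 'b::real_normed_vector"
  assumes "open S" "\<And>i. smooth_on S (f i)"
  shows "smooth_on S (\<lambda>x. \<chi> i. f i x)"
proof -
  have eq: "(\<chi> i. f i x) = (\<Sum>i\<in>UNIV. axis i (f i x))" for x
    by (simp add: vec_eq_iff axis_def)
  have "bounded_linear (\<lambda>z::'b. axis i z :: 'b^'i)" for i
    by (rule bounded_linear_intro[where K = 1])
      (auto simp: axis_def vec_eq_iff norm_vec_def L2_set_def if_distrib if_distribR cong: if_cong)
  from smooth_on_bounded_linear[OF this assms(2,1)]
  have "smooth_on S (\<lambda>x. axis i (f i x) :: 'b^'i)" for i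
    by blast
  then have "smooth_on S (\<lambda>x. \<Sum>i\<in>UNIV. axis i (f i x))"
    by (rule smooth_on_sum[OF assms(1)])
  then show ?thesis by (simp add: eq)
qed

lemma smooth_on_vec_nth: "open S \<Longrightarrow> smooth_on S f \<Longrightarrow> smooth_on S (\<lambda>x. f x $ i)"
  by (rule smooth_on_bounded_linear[OF bounded_linear_vec_nth])


section \<open>Smooth functions of one real variable\<close>

lemma Ck_on_Suc_real:
  fixes f :: "real \<Rightarrow> real"
  assumes "open S" "\<And>x. x \<in> S \<Longrightarrow> (f has_real_derivative f' x) (at x)" "Ck_on k S f'"
  shows "Ck_on (Suc k) S f"
proof (rule Ck_on_SucI[OF _ assms(1)])
  show "(f has_derivative (\<lambda>v. f' x * v)) (at x)" if "x \<in> S" for x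
    using assms(2)[OF that] by (simp add: has_field_derivative_def)
  show "Ck_on k S (\<lambda>x. f' x * v)" for v
    by (intro Ck_on_mult assms Ck_on_const)
qed

lemma smooth_on_sin_cos: "smooth_on UNIV (sin :: real \<Rightarrow> real)" "smooth_on UNIV (cos :: real \<Rightarrow> real)"
proof -
  have "Ck_on k UNIV (sin :: real \<Rightarrow> real) \<and> Ck_on k UNIV (cos :: real \<Rightarrow> real)" for k
  proof (induction k)
    case 0
    then show ?case by (simp add: continuous_intros)
  next
    case (Suc k)
    have "Ck_on k UNIV (\<lambda>x::real. (-1) * sin x)"
      using Suc by (intro Ck_on_mult Ck_on_const) auto
    then have "Ck_on k UNIV (\<lambda>x::real. - sin x)" by simp
    then have "Ck_on (Suc k) UNIV (cos :: real \<Rightarrow> real)"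
      by (rule Ck_on_Suc_real[OF open_UNIV DERIV_cos])
    moreover have "Ck_on (Suc k) UNIV (sin :: real \<Rightarrow> real)"
      by (rule Ck_on_Suc_real[OF open_UNIV DERIV_sin]) (use Suc in auto)
    ultimately show ?case by blast
  qed
  then show "smooth_on UNIV (sin :: real \<Rightarrow> real)" "smooth_on UNIV (cos :: real \<Rightarrow> real)"
    by (auto simp: smooth_on_def)
qed

lemma smooth_on_inverse: "smooth_on (- {0}) (inverse :: real \<Rightarrow> real)"
proof -
  have "Ck_on k (- {0}) (inverse :: real \<Rightarrow> real)" for k
  proof (induction k)
    case 0
    then show ?case by (auto intro!: continuous_intros)
  next
    case (Suc k)
    have "Ck_on k (- {0}) (\<lambda>x::real. (-1) * (inverse x * inverse x))"
      using Suc by (intro Ck_on_mult Ck_on_const) auto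
    then have "Ck_on k (- {0}) (\<lambda>x::real. - (inverse x * inverse x))" by simp
    then show ?case
      by (rule Ck_on_Suc_real[rotated -1]) (auto intro!: derivative_eq_intros)
  qed
  then show ?thesis by (simp add: smooth_on_def)
qed

lemma smooth_on_abs: "smooth_on (- {0}) (abs :: real \<Rightarrow> real)"
proof (rule smooth_on_local)
  fix x :: real assume x: "x \<in> - {0}"
  show "\<exists>N. open N \<and> x \<in> N \<and> smooth_on N abs"
  proof (cases "x > 0")
    case True
    have "smooth_on {0<..} (abs :: real \<Rightarrow> real)"
      by (subst smooth_on_cong[where g = "\<lambda>x. x"]) (auto intro!: smooth_on_bounded_linear_id[OF bounded_linear_ident])
    with True show ?thesis by (intro exI[of _ "{0<..}"]) auto
  next
    case False
    have "smooth_on {..<0} (abs :: real \<Rightarrow> real)"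
      by (subst smooth_on_cong[where g = "\<lambda>x. - x"])
        (auto intro!: smooth_on_bounded_linear_id[OF bounded_linear_minus[OF bounded_linear_ident]])
    with False x show ?thesis by (intro exI[of _ "{..<0}"]) auto
  qed
qed

text \<open>\<open>flat 0\<close> is the standard flat function; the powers of \<open>1/x\<close> close the family under differentiation, so
  that a single induction makes all its members smooth.\<close>

definition flat :: "nat \<Rightarrow> real \<Rightarrow> real" where
  "flat n x = (if x > 0 then exp (- inverse x) * inverse x ^ n else 0)"

lemma flat_at_0: "(flat n \<longlongrightarrow> 0) (at 0)"
proof -
  have "((\<lambda>x::real. x ^ n / exp x) \<longlongrightarrow> 0) at_top" by (rule tendsto_power_div_exp_0)
  then have "((\<lambda>x::real. inverse x ^ n / exp (inverse x)) \<longlongrightarrow> 0) (at_right 0)"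
    by (rule filterlim_compose) (rule filterlim_inverse_at_top_right)
  moreover have "\<forall>\<^sub>F x::real in at_right 0. inverse x ^ n / exp (inverse x) = flat n x"
    unfolding flat_def by (auto simp: eventually_at_filter exp_minus divide_simps)
  ultimately have "(flat n \<longlongrightarrow> 0) (at_right 0)"
    by (rule Lim_transform_eventually)
  moreover have "(flat n \<longlongrightarrow> 0) (at_left 0)"
    by (rule Lim_transform_eventually[OF tendsto_const]) (auto simp: flat_def eventually_at_filter)
  ultimately show ?thesis by (simp add: filterlim_split_at)
qed

lemma DERIV_flat: "(flat n has_real_derivative (flat (n + 2) x - real n * flat (n + 1) x)) (at x)"
proof -
  consider "x > 0" | "x < 0" | "x = 0" by linarith
  then show ?thesis
  proof cases
    assume "x > 0"
    then have "x \<noteq> 0" by simp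
    note inv = DERIV_inverse[OF this]
    have 1: "((\<lambda>x. exp (- inverse x)) has_real_derivative exp (- inverse x) * inverse x ^ 2) (at x)"
      using DERIV_chain2[OF DERIV_exp DERIV_minus[OF inv]] by (simp add: numeral_2_eq_2)
    have "real n * (- (inverse x ^ Suc (Suc 0)) * inverse x ^ (n - Suc 0)) = - (real n * inverse x ^ (n + 1))"
      by (cases n) simp_all
    then have 2: "((\<lambda>x. inverse x ^ n) has_real_derivative - (real n * inverse x ^ (n + 1))) (at x)"
      by (rule DERIV_cong[OF DERIV_power[OF inv, of n]])
    have "((\<lambda>x. exp (- inverse x) * inverse x ^ n) has_real_derivative
        (flat (n + 2) x - real n * flat (n + 1) x)) (at x)"
      using DERIV_mult[OF 1 2] \<open>x > 0\<close> by (simp add: flat_def power_add algebra_simps power2_eq_square)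
    then show ?thesis
      by (rule has_field_derivative_transform_within_open[of _ _ _ "{0<..}"]) (use \<open>x > 0\<close> in \<open>auto simp: flat_def\<close>)
  next
    case 2
    have "((\<lambda>x. 0) has_real_derivative 0) (at x)" by simp
    then have "(flat n has_real_derivative 0) (at x)"
      by (rule has_field_derivative_transform_within_open[of _ _ _ "{..<0}"]) (use 2 in \<open>auto simp: flat_def\<close>)
    then show ?thesis using 2 by (simp add: flat_def)
  next
    case 3
    have "\<forall>\<^sub>F y in at 0. flat (n + 1) y = (flat n y - flat n 0) / (y - 0)"
      by (auto simp: flat_def eventually_at_filter divide_simps)
    then have "((\<lambda>y. (flat n y - flat n 0) / (y - 0)) \<longlongrightarrow> 0) (at 0)"
      by (rule Lim_transform_eventually[OF flat_at_0])
    then have "(flat n has_real_derivative 0) (at 0)"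
      by (simp add: has_field_derivative_iff)
    then show ?thesis using 3 by (simp add: flat_def)
  qed
qed

lemma smooth_on_flat: "smooth_on UNIV (flat n)"
proof -
  have "Ck_on k UNIV (flat n)" for k
  proof (induction k arbitrary: n)
    case 0
    show ?case using DERIV_isCont[OF DERIV_flat] by (simp add: continuous_at_imp_continuous_on)
  next
    case (Suc k)
    have "Ck_on k UNIV (\<lambda>x. flat (n + 2) x + (- real n) * flat (n + 1) x)"
      by (intro Ck_on_add Ck_on_mult Ck_on_const Suc.IH) auto
    then show ?case
      by (intro Ck_on_Suc_real[OF _ DERIV_flat]) auto
  qed
  then show ?thesis by (simp add: smooth_on_def)
qed


section \<open>Charts\<close>

lemma chart_inj: "is_chart X C \<Longrightarrow> inj_on (coord C) (cdom C)"
  unfolding is_chart_def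
  by (metis homeomorphic_imp_injective_map openin_subset topspace_subtopology_subset)

lemma param_coord: "is_chart X C \<Longrightarrow> p \<in> cdom C \<Longrightarrow> param C (coord C p) = p"
  by (simp add: param_def chart_inj inv_into_f_f)

lemma coord_param: "x \<in> cimg C \<Longrightarrow> coord C (param C x) = x"
  by (simp add: param_def cimg_def f_inv_into_f)

lemma param_in_cdom: "x \<in> cimg C \<Longrightarrow> param C x \<in> cdom C"
  by (simp add: param_def cimg_def inv_into_into)

lemma open_cimg: "is_chart X C \<Longrightarrow> open (cimg C)"
  by (simp add: is_chart_def)

lemma open_coord_image:
  assumes C: "is_chart X C" and V: "openin X V"
  shows "open (coord C ` (cdom C \<inter> V))"
proof -
  have "openin (subtopology X (cdom C)) (cdom C \<inter> V)"
    using V by (auto simp: openin_subtopology_Int2)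
  then have "openin (top_of_set (cimg C)) (coord C ` (cdom C \<inter> V))"
    using C homeomorphic_map_openness_eq[of "subtopology X (cdom C)" "top_of_set (cimg C)" "coord C" "cdom C \<inter> V"]
    by (auto simp: is_chart_def)
  then show ?thesis using open_cimg[OF C] openin_open_trans by blast
qed


section \<open>The torus\<close>

definition torus :: "(complex \<times> complex) set" where
  "torus = sphere 0 1 \<times> sphere 0 1"

abbreviation torus_top :: "(complex \<times> complex) topology" where
  "torus_top \<equiv> top_of_set torus"

definition wrap :: "real^2 \<Rightarrow> complex \<times> complex" where
  "wrap y = (cis (y $ 1), cis (y $ 2))"

definition component :: "2 \<Rightarrow> complex \<times> complex \<Rightarrow> complex" where
  "component i p = (if i = 1 then fst p else snd p)"

text \<open>The largest square about \<open>y\<close> on which the angles relative to \<open>y\<close> are unambiguous.\<close>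

definition window :: "real^2 \<Rightarrow> (real^2) set" where
  "window y = {x. \<forall>i. \<bar>x $ i - y $ i\<bar> < pi}"

text \<open>The angles of \<open>p\<close>, measured relative to the point \<open>y\<close>: this puts the cut of \<open>Arg\<close> opposite to \<open>y\<close>.
  For every \<open>y\<close> it is a right inverse of \<open>wrap\<close> on the torus, and on \<open>wrap ` window y\<close> it is a smooth chart.\<close>

definition unwrap :: "real^2 \<Rightarrow> complex \<times> complex \<Rightarrow> real^2" where
  "unwrap y p = (\<chi> i. y $ i + Arg (component i p * cis (- (y $ i))))"

lemma component_wrap: "component i (wrap y) = cis (y $ i)"
  using exhaust_2[of i] by (auto simp: component_def wrap_def)

lemma wrap_in_torus [simp]: "wrap y \<in> torus"
  by (simp add: wrap_def torus_def)

lemma continuous_on_wrap: "continuous_on S wrap"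
  unfolding wrap_def cis_conv_exp by (intro continuous_intros)

lemma continuous_component: "continuous_on S (component i)"
  unfolding component_def by (cases "i = 1") (simp_all add: continuous_intros)

lemma norm_component: "p \<in> torus \<Longrightarrow> norm (component i p) = 1"
  by (auto simp: component_def torus_def)

lemma component_eqI: "(\<And>i. component i p = component i q) \<Longrightarrow> p = q"
  by (metis component_def prod_eq_iff zero_neq_one)

lemma wrap_unwrap: assumes "p \<in> torus" shows "wrap (unwrap y p) = p"
proof (rule component_eqI)
  fix i
  let ?z = "component i p * cis (- (y $ i))"
  have "norm ?z = 1" using norm_component[OF assms] by (simp add: norm_mult)
  then have "cis (Arg ?z) = ?z"
    by (metis cis_Arg div_by_1 norm_zero of_real_1 sgn_eq zero_neq_one)
  then have "cis (unwrap y p $ i) = cis (y $ i) * ?z"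
    by (simp add: unwrap_def cis_mult[symmetric])
  also have "\<dots> = component i p"
    using cis_mult[of "y $ i" "- (y $ i)"] by (simp add: mult.left_commute)
  finally show "component i (wrap (unwrap y p)) = component i p"
    by (simp add: component_wrap)
qed

lemma window_bounds:
  "x \<in> window y \<Longrightarrow> - pi < x $ i - y $ i" "x \<in> window y \<Longrightarrow> x $ i - y $ i < pi"
  unfolding window_def mem_Collect_eq abs_less_iff by (drule spec[of _ i], simp)+

lemma component_wrap_shift: "component i (wrap x) * cis (- (y $ i)) = cis (x $ i - y $ i)"
  by (simp add: component_wrap cis_mult)

lemma unwrap_wrap:
  assumes "x \<in> window y" shows "unwrap y (wrap x) = x"
proof -
  have "Arg (cis (x $ i - y $ i)) = x $ i - y $ i" for i
    by (rule Arg_cis) (use window_bounds[OF assms, of i] in auto)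
  then show ?thesis unfolding unwrap_def component_wrap_shift by (simp add: vec_eq_iff)
qed

lemma open_window: "open (window y)"
  unfolding window_def forall_2 by (intro open_Collect_conj open_Collect_less continuous_intros)

lemma window_center [simp]: "y \<in> window y"
  by (simp add: window_def)

text \<open>Two preimages of a point differ by a period of \<open>wrap\<close>. Stated in this way, the lattice of periods never
  has to be named.\<close>

lemma wrap_translate:
  assumes "wrap y = wrap y'" shows "wrap (x + (y' - y)) = wrap x"
  using assms by (auto simp: wrap_def cis_mult[symmetric] cis_divide[symmetric])

lemma wrap_window:
  "wrap ` window y = {p \<in> torus. \<forall>i. component i p * cis (- (y $ i)) \<notin> \<real>\<^sub>\<le>\<^sub>0}"
proof (intro equalityI subsetI)
  fix p assume "p \<in> wrap ` window y"
  then obtain x where x: "x \<in> window y" "p = wrap x" by auto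
  have "cis (x $ i - y $ i) \<notin> \<real>\<^sub>\<le>\<^sub>0" for i
  proof
    assume a: "cis (x $ i - y $ i) \<in> \<real>\<^sub>\<le>\<^sub>0"
    have "Arg (cis (x $ i - y $ i)) = x $ i - y $ i"
      by (rule Arg_cis) (use window_bounds[OF x(1), of i] in auto)
    moreover have "Arg (cis (x $ i - y $ i)) = pi"
      using a Arg_eq_pi[of "cis (x $ i - y $ i)"] sin_cos_squared_add[of "x $ i - y $ i"]
      by (auto simp: complex_nonpos_Reals_iff order_le_less)
    ultimately show False using window_bounds[OF x(1), of i] by auto
  qed
  with x show "p \<in> {p \<in> torus. \<forall>i. component i p * cis (- (y $ i)) \<notin> \<real>\<^sub>\<le>\<^sub>0}"
    by (simp add: component_wrap_shift)
next
  fix p assume p: "p \<in> {p \<in> torus. \<forall>i. component i p * cis (- (y $ i)) \<notin> \<real>\<^sub>\<le>\<^sub>0}"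
  have "\<bar>unwrap y p $ i - y $ i\<bar> < pi" for i
  proof -
    let ?z = "component i p * cis (- (y $ i))"
    have "?z \<notin> \<real>\<^sub>\<le>\<^sub>0" using p by auto
    then have "Arg ?z \<noteq> pi" using Arg_eq_pi[of ?z] by (auto simp: complex_nonpos_Reals_iff)
    then show ?thesis using mpi_less_Arg[of ?z] Arg_le_pi[of ?z] by (simp add: unwrap_def abs_less_iff)
  qed
  then have "unwrap y p \<in> window y" by (simp add: window_def)
  then show "p \<in> wrap ` window y" using wrap_unwrap[of p y] p by (metis (lifting) image_eqI mem_Collect_eq)
qed

lemma openin_wrap_window: "openin torus_top (wrap ` window y)"
proof -
  have "open {p. component i p * cis (- (y $ i)) \<in> - \<real>\<^sub>\<le>\<^sub>0}" for i
  proof -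
    have "continuous_on UNIV (\<lambda>p. component i p * cis (- (y $ i)))"
      by (intro continuous_intros continuous_component)
    moreover have "open (- \<real>\<^sub>\<le>\<^sub>0 :: complex set)"
      using closed_nonpos_Reals_complex by auto
    ultimately show ?thesis
      using open_vimage[of "- \<real>\<^sub>\<le>\<^sub>0" "\<lambda>p. component i p * cis (- (y $ i))"] by (simp add: vimage_def)
  qed
  then have "open {p. \<forall>i. component i p * cis (- (y $ i)) \<in> - \<real>\<^sub>\<le>\<^sub>0}"
    unfolding forall_2 by (intro open_Collect_conj)
  moreover have "wrap ` window y = torus \<inter> {p. \<forall>i. component i p * cis (- (y $ i)) \<in> - \<real>\<^sub>\<le>\<^sub>0}"
    unfolding wrap_window by auto
  ultimately show ?thesis by (auto simp: openin_open)
qed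

lemma continuous_on_unwrap: "continuous_on (wrap ` window y) (unwrap y)"
  unfolding wrap_window unwrap_def
  by (intro continuous_intros continuous_component continuous_on_Arg') auto

definition window_chart :: "real^2 \<Rightarrow> (complex \<times> complex, 2) chart" where
  "window_chart y = (wrap ` window y, unwrap y)"

lemma window_chart_simps [simp]:
  "cdom (window_chart y) = wrap ` window y" "coord (window_chart y) = unwrap y"
  by (simp_all add: window_chart_def)

lemma cimg_window_chart [simp]: "cimg (window_chart y) = window y"
  by (auto simp: cimg_def unwrap_wrap image_iff)

lemma is_chart_window: "is_chart torus_top (window_chart y)"
proof -
  have "homeomorphic_maps (top_of_set (wrap ` window y)) (top_of_set (window y)) (unwrap y) wrap"
    unfolding homeomorphic_maps_def
    by (auto simp: continuous_on_unwrap continuous_on_wrap unwrap_wrap)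
  moreover have "subtopology torus_top (wrap ` window y) = top_of_set (wrap ` window y)"
    by (simp add: subtopology_subtopology Int_absorb1 image_subset_iff)
  ultimately show ?thesis
    unfolding is_chart_def cimg_window_chart window_chart_simps
    using openin_wrap_window open_window homeomorphic_map_maps by metis
qed

lemma param_window_chart: "x \<in> window y \<Longrightarrow> param (window_chart y) x = wrap x"
  using param_coord[OF is_chart_window, of "wrap x" y] by (simp add: unwrap_wrap)

text \<open>Compatibility with the window charts alone makes the maximality of the atlas immediate; that its members
  are compatible with each other is left to \<open>compatible_torus_atlas\<close>.\<close>

definition torus_atlas :: "(complex \<times> complex, 2) chart set" where
  "torus_atlas = {C. is_chart torus_top C \<and> (\<forall>y. compatible C (window_chart y))}"

lemma torus_atlas_chart: "C \<in> torus_atlas \<Longrightarrow> is_chart torus_top C"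
  by (simp add: torus_atlas_def)

lemma torus_atlas_cdom: "C \<in> torus_atlas \<Longrightarrow> cdom C \<subseteq> torus"
  using torus_atlas_chart[of C] openin_imp_subset by (auto simp: is_chart_def)

lemma open_wrap_vimage: assumes "openin torus_top U" shows "open (wrap -` U)"
proof -
  from assms obtain O' where "open O'" "U = torus \<inter> O'" by (auto simp: openin_open)
  then have "wrap -` U = wrap -` O'" using wrap_in_torus by blast
  then show ?thesis using \<open>open O'\<close> open_vimage continuous_on_wrap by metis
qed

lemma open_wrap_cdom: "C \<in> torus_atlas \<Longrightarrow> open (wrap -` cdom C)"
  using open_wrap_vimage torus_atlas_chart is_chart_def by blast

text \<open>On the window about \<open>y\<close>, \<open>wrap\<close> is the inverse of a window chart, so this is compatibility of \<open>C\<close> with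
  that chart. Together with the next lemma it says that \<open>wrap\<close> is a local diffeomorphism in every chart, which is
  how all regularity questions are moved to the plane.\<close>

lemma smooth_on_coord_wrap:
  assumes C: "C \<in> torus_atlas"
  shows "smooth_on (wrap -` cdom C) (\<lambda>y. coord C (wrap y))"
proof (rule smooth_on_local)
  fix y assume y: "y \<in> wrap -` cdom C"
  let ?N = "window y \<inter> wrap -` cdom C"
  have "smooth_on (unwrap y ` (cdom C \<inter> wrap ` window y)) (coord C \<circ> param (window_chart y))"
    using C by (simp add: torus_atlas_def compatible_def)
  moreover have "unwrap y ` (cdom C \<inter> wrap ` window y) = ?N"
  proof (intro equalityI subsetI)
    fix x assume "x \<in> ?N"
    then show "x \<in> unwrap y ` (cdom C \<inter> wrap ` window y)"
      by (intro image_eqI[of _ _ "wrap x"]) (auto simp: unwrap_wrap)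
  qed (auto simp: unwrap_wrap)
  ultimately have "smooth_on ?N (coord C \<circ> param (window_chart y))" by simp
  then have "smooth_on ?N (\<lambda>y. coord C (wrap y))"
    by (subst (asm) smooth_on_cong[where g = "\<lambda>y. coord C (wrap y)"])
      (auto simp: open_window open_wrap_cdom[OF C] param_window_chart)
  then show "\<exists>N. open N \<and> y \<in> N \<and> smooth_on N (\<lambda>y. coord C (wrap y))"
    using y open_window open_wrap_cdom[OF C] by (intro exI[of _ ?N]) auto
qed

text \<open>Such lifts replace the global right inverse \<open>unwrap 0\<close>, which jumps.\<close>

lemma smooth_local_lift:
  assumes C: "C \<in> torus_atlas" and x: "x \<in> cimg C" and y: "wrap y = param C x"
  obtains N s where "open N" "x \<in> N" "N \<subseteq> cimg C" "smooth_on N s" "s x = y"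
    "\<And>x'. x' \<in> N \<Longrightarrow> wrap (s x') = param C x'"
proof -
  let ?N = "coord C ` (cdom C \<inter> wrap ` window y)"
  let ?s = "unwrap y \<circ> param C"
  have ch: "is_chart torus_top C" using C by (rule torus_atlas_chart)
  have "smooth_on ?N ?s"
    using C by (simp add: torus_atlas_def compatible_def)
  moreover have "open ?N" by (rule open_coord_image[OF ch openin_wrap_window])
  moreover have "x \<in> ?N"
    using coord_param[OF x] param_in_cdom[OF x] y by (metis IntI image_eqI window_center)
  moreover have "?N \<subseteq> cimg C" by (auto simp: cimg_def)
  moreover have "?s x = y" using y[symmetric] by (simp add: unwrap_wrap)
  moreover have "wrap (?s x') = param C x'" if "x' \<in> ?N" for x'
    using that torus_atlas_cdom[OF C] by (auto simp: param_coord[OF ch] intro!: wrap_unwrap)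
  ultimately show ?thesis using that by blast
qed

text \<open>The coordinate change is factored through the plane: a local lift of \<open>param C\<close>, followed by
  \<open>coord D \<circ> wrap\<close>.\<close>

lemma compatible_torus_atlas:
  assumes C: "C \<in> torus_atlas" and D: "D \<in> torus_atlas"
  shows "smooth_on (coord C ` (cdom C \<inter> cdom D)) (coord D \<circ> param C)"
proof (rule smooth_on_local)
  fix x assume x: "x \<in> coord C ` (cdom C \<inter> cdom D)"
  have ch: "is_chart torus_top C" "is_chart torus_top D" using C D by (auto intro: torus_atlas_chart)
  have xi: "x \<in> cimg C" using x by (auto simp: cimg_def)
  have pt: "param C x \<in> torus" using param_in_cdom[OF xi] torus_atlas_cdom[OF C] by auto
  obtain N s where N: "open N" "x \<in> N" "N \<subseteq> cimg C" "smooth_on N s"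
    "\<And>x'. x' \<in> N \<Longrightarrow> wrap (s x') = param C x'"
    using smooth_local_lift[OF C xi wrap_unwrap[OF pt]] by metis
  let ?N = "N \<inter> coord C ` (cdom C \<inter> cdom D)"
  have o: "open ?N" using N open_coord_image[OF ch(1)] ch(2) by (auto simp: is_chart_def)
  have "param C x' \<in> cdom D" if "x' \<in> ?N" for x'
    using that by (auto simp: param_coord[OF ch(1)])
  then have im: "s ` ?N \<subseteq> wrap -` cdom D" using N(5) by auto
  have "smooth_on ?N (\<lambda>x'. coord D (wrap (s x')))"
    by (rule smooth_on_compose[OF o open_wrap_cdom[OF D] smooth_on_subset[OF N(4)] smooth_on_coord_wrap[OF D] im]) auto
  then have "smooth_on ?N (coord D \<circ> param C)"
    by (subst (asm) smooth_on_cong[OF o, where g = "coord D \<circ> param C"]) (auto simp: N(5))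
  then show "\<exists>N. open N \<and> x \<in> N \<and> smooth_on N (coord D \<circ> param C)"
    using o N(2) x by blast
qed

lemma smooth_on_translation: "smooth_on S (\<lambda>x. x + a)" if "open S"
  by (intro smooth_on_add that smooth_on_const smooth_on_bounded_linear_id bounded_linear_ident)

lemma window_chart_in_atlas: "window_chart y \<in> torus_atlas"
proof -
  have "smooth_on (unwrap y ` (wrap ` window y \<inter> wrap ` window z)) (unwrap z \<circ> param (window_chart y))" for y z
  proof (rule smooth_on_local)
    fix x assume "x \<in> unwrap y ` (wrap ` window y \<inter> wrap ` window z)"
    then obtain x2 where x: "x \<in> window y" and x2: "x2 \<in> window z" "wrap x = wrap x2"
      by (auto simp: unwrap_wrap)
    let ?N = "window y \<inter> (\<lambda>v. v + (x2 - x)) -` window z"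
    have o: "open ?N"
      by (intro open_Int open_window open_vimage continuous_intros)
    have "(unwrap z \<circ> param (window_chart y)) v = v + (x2 - x)" if "v \<in> ?N" for v
      using that unwrap_wrap[of "v + (x2 - x)" z] wrap_translate[OF x2(2), of v]
      by (simp add: param_window_chart)
    then have "smooth_on ?N (unwrap z \<circ> param (window_chart y))"
      using smooth_on_cong[OF o, of "unwrap z \<circ> param (window_chart y)" "\<lambda>v. v + (x2 - x)"]
        smooth_on_translation[OF o] by blast
    then show "\<exists>N. open N \<and> x \<in> N \<and> smooth_on N (unwrap z \<circ> param (window_chart y))"
      using o x x2 by (intro exI[of _ ?N]) auto
  qed
  from this[of y] this[of _ y] show ?thesis
    by (auto simp: torus_atlas_def is_chart_window compatible_def Int_commute)
qed

lemma second_countable_euclidean: "second_countable (euclidean :: 'a::second_countable_topology topology)"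
proof -
  obtain B :: "'a set set" where B: "countable B" "topological_basis B"
    using ex_countable_basis by blast
  then show ?thesis
    unfolding second_countable_def by (metis open_openin topological_basis_def topological_basisE)
qed

lemma smooth_manifold_torus: "smooth_manifold torus_top torus_atlas"
  unfolding smooth_manifold_def
proof (intro conjI ballI allI impI)
  show "Hausdorff_space torus_top" by (simp add: Hausdorff_space_subtopology)
  show "second_countable torus_top"
    by (intro second_countable_subtopology second_countable_euclidean)
  show "is_chart torus_top C" if "C \<in> torus_atlas" for C using that by (rule torus_atlas_chart)
  show "compatible C D" if "C \<in> torus_atlas" "D \<in> torus_atlas" for C D
    using compatible_torus_atlas[OF that] compatible_torus_atlas[OF that(2,1)]
    by (simp add: compatible_def Int_commute)
  have "p \<in> \<Union> (cdom ` torus_atlas)" if "p \<in> torus" for p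
  proof -
    have "p \<in> cdom (window_chart (unwrap 0 p))"
      using wrap_unwrap[OF that, of 0] by (metis image_eqI window_center window_chart_simps(1))
    then show ?thesis using window_chart_in_atlas by blast
  qed
  then show "\<Union> (cdom ` torus_atlas) = topspace torus_top"
    using torus_atlas_cdom by fastforce
  show "C \<in> torus_atlas" if "is_chart torus_top C \<and> (\<forall>D\<in>torus_atlas. compatible C D)" for C
    using that window_chart_in_atlas unfolding torus_atlas_def by blast
qed

lemma compact_torus: "compact torus"
  unfolding torus_def by (intro compact_Times compact_sphere)

text \<open>Functions on the plane that factor through \<^term>\<open>wrap\<close> are the doubly periodic ones; in
  particular \<open>coord C \<circ> wrap\<close> is, whatever the values of \<open>coord C\<close> outside \<open>cdom C\<close>.\<close>

definition periodic :: "(real^2 \<Rightarrow> 'b) \<Rightarrow> bool" where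
  "periodic q \<longleftrightarrow> (\<forall>y y'. wrap y = wrap y' \<longrightarrow> q y = q y')"

lemma periodic_wrap [simp]: "periodic (\<lambda>y. g (wrap y))"
  by (simp add: periodic_def)

lemma periodic_comp: "periodic q \<Longrightarrow> periodic (\<lambda>y. g (q y))"
  unfolding periodic_def by metis

lemma periodic_comp2: "periodic q \<Longrightarrow> periodic r \<Longrightarrow> periodic (\<lambda>y. g (q y) (r y))"
  unfolding periodic_def by metis

lemma periodic_translate: "periodic q \<Longrightarrow> wrap y = wrap y' \<Longrightarrow> q (x + (y' - y)) = q x"
  unfolding periodic_def using wrap_translate[of y y' x] by blast

lemma periodic_unwrap: "periodic q \<Longrightarrow> q (unwrap z (wrap y)) = q y"
  unfolding periodic_def using wrap_unwrap[OF wrap_in_torus, of z y] by blast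

text \<open>Differentiation commutes with the translation by \<open>y' - y\<close>, which leaves \<open>q\<close> unchanged.\<close>

lemma periodic_frechet_derivative:
  assumes "periodic q"
  shows "periodic (\<lambda>y. frechet_derivative q (at y) v)"
proof -
  have *: "(q has_derivative D) (at y')" if w: "wrap y = wrap y'" and D: "(q has_derivative D) (at y)" for y y' D
  proof -
    have "((\<lambda>x. x + (y - y')) has_derivative (\<lambda>h. h)) (at y')"
      by (auto intro!: derivative_eq_intros)
    moreover have "(q has_derivative D) (at (y' + (y - y')))" using D by simp
    ultimately have "((\<lambda>x. q (x + (y - y'))) has_derivative (\<lambda>h. D h)) (at y')"
      by (rule has_derivative_compose)
    then show ?thesis by (simp add: periodic_translate[OF assms w[symmetric]])
  qed
  show ?thesis
    unfolding periodic_def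
  proof (intro allI impI)
    fix y y' :: "real^2" assume w: "wrap y = wrap y'"
    have "(\<lambda>D. (q has_derivative D) (at y)) = (\<lambda>D. (q has_derivative D) (at y'))"
      using *[OF w] *[OF w[symmetric]] by (intro ext iffI)
    then show "frechet_derivative q (at y) v = frechet_derivative q (at y') v"
      by (simp only: frechet_derivative_def)
  qed
qed

text \<open>A periodic function does not see the jumps of \<open>unwrap 0\<close>: it takes the same values along a smooth local lift.
  This gives smoothness of the coefficients of the operator and of the density of the measure in every chart.\<close>

lemma smooth_on_periodic_param:
  assumes C: "C \<in> torus_atlas" and q: "periodic q" "smooth_on (wrap -` cdom C) q"
  shows "smooth_on (cimg C) (\<lambda>x. q (unwrap 0 (param C x)))"
proof (rule smooth_on_local)
  fix x assume x: "x \<in> cimg C"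
  have tor: "param C x \<in> torus" if "x \<in> cimg C" for x
    using param_in_cdom[OF that] torus_atlas_cdom[OF C] by auto
  obtain N s where N: "open N" "x \<in> N" "N \<subseteq> cimg C" "smooth_on N s"
    "\<And>x'. x' \<in> N \<Longrightarrow> wrap (s x') = param C x'"
    using smooth_local_lift[OF C x wrap_unwrap[OF tor[OF x]]] by metis
  have im: "s ` N \<subseteq> wrap -` cdom C" using N param_in_cdom by fastforce
  have "smooth_on N (\<lambda>x. q (s x))"
    by (rule smooth_on_compose[OF N(1) open_wrap_cdom[OF C] N(4) q(2) im])
  moreover have "q (s x') = q (unwrap 0 (param C x'))" if "x' \<in> N" for x'
    using periodic_unwrap[OF q(1), of 0 "s x'"] N(5)[OF that] by simp
  ultimately have "smooth_on N (\<lambda>x. q (unwrap 0 (param C x)))"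
    using smooth_on_cong[OF N(1), of "\<lambda>x. q (s x)" "\<lambda>x. q (unwrap 0 (param C x))"] by blast
  then show "\<exists>N. open N \<and> x \<in> N \<and> smooth_on N (\<lambda>x. q (unwrap 0 (param C x)))"
    using N by blast
qed

lemma Ck_fun_torus: "Ck_fun torus_atlas k u \<longleftrightarrow> Ck_on k UNIV (\<lambda>y. u (wrap y))"
proof
  assume u: "Ck_fun torus_atlas k u"
  show "Ck_on k UNIV (\<lambda>y. u (wrap y))"
  proof (rule Ck_on_local)
    fix y
    have "Ck_on k (window y) (u \<circ> param (window_chart y))"
      using u window_chart_in_atlas[of y] unfolding Ck_fun_def by fastforce
    then have "Ck_on k (window y) (\<lambda>y. u (wrap y))"
      by (subst (asm) Ck_on_cong[OF open_window, where g = "\<lambda>y. u (wrap y)"]) (auto simp: param_window_chart)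
    then show "\<exists>N. open N \<and> y \<in> N \<and> Ck_on k N (\<lambda>y. u (wrap y))"
      using open_window window_center by blast
  qed
next
  assume u: "Ck_on k UNIV (\<lambda>y. u (wrap y))"
  show "Ck_fun torus_atlas k u"
    unfolding Ck_fun_def
  proof (intro ballI Ck_on_local)
    fix C x assume C: "C \<in> torus_atlas" and x: "x \<in> cimg C"
    have tor: "param C x \<in> torus"
      using param_in_cdom[OF x] torus_atlas_cdom[OF C] by auto
    obtain N s where N: "open N" "x \<in> N" "smooth_on N s" "\<And>x'. x' \<in> N \<Longrightarrow> wrap (s x') = param C x'"
      using smooth_local_lift[OF C x wrap_unwrap[OF tor]] by metis
    have "Ck_on k N (\<lambda>x. u (wrap (s x)))"
      by (rule Ck_on_compose[OF N(1) open_UNIV smooth_on_imp_Ck[OF N(3)] u]) auto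
    then have "Ck_on k N (u \<circ> param C)"
      by (subst (asm) Ck_on_cong[OF N(1), where g = "u \<circ> param C"]) (auto simp: N(4))
    then show "\<exists>N. open N \<and> x \<in> N \<and> Ck_on k N (u \<circ> param C)"
      using N by blast
  qed
qed

lemma smooth_fun_torus: "smooth_fun torus_atlas u \<longleftrightarrow> smooth_on UNIV (\<lambda>y. u (wrap y))"
  using Ck_fun_torus[of _ u] unfolding smooth_fun_def smooth_on_def Ck_fun_def by blast


section \<open>Partial derivatives\<close>

lemma pd_eq: "(f has_derivative D) (at x) \<Longrightarrow> pd i f x = D (axis i 1)"
  by (simp add: pd_def frechet_derivativeI)

lemma pd_cong_open:
  "open S \<Longrightarrow> x \<in> S \<Longrightarrow> (\<And>y. y \<in> S \<Longrightarrow> f y = g y) \<Longrightarrow> pd i f x = pd i g x"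
  by (simp add: pd_def frechet_derivative_cong_open[of S x f g])

lemma pd_add:
  "f differentiable (at x) \<Longrightarrow> g differentiable (at x) \<Longrightarrow> pd i (\<lambda>x. f x + g x) x = pd i f x + pd i g x"
  by (rule pd_eq[THEN trans, OF has_derivative_add[OF frechet_derivative_has_derivative frechet_derivative_has_derivative]])
    (auto simp: pd_def)

lemma pd_sum:
  "(\<And>k. k \<in> K \<Longrightarrow> f k differentiable (at x)) \<Longrightarrow> pd i (\<lambda>x. \<Sum>k\<in>K. f k x) x = (\<Sum>k\<in>K. pd i (f k) x)"
  by (rule pd_eq[THEN trans, OF has_derivative_sum[OF frechet_derivative_has_derivative]]) (auto simp: pd_def)

lemma pd_mult:
  "f differentiable (at x) \<Longrightarrow> g differentiable (at x) \<Longrightarrow>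
    pd i (\<lambda>x. f x * g x) x = f x * pd i g x + pd i f x * g x"
  by (rule pd_eq[THEN trans, OF has_derivative_mult[OF frechet_derivative_has_derivative frechet_derivative_has_derivative]])
    (auto simp: pd_def)

lemma pd_bounded_linear:
  "bounded_linear h \<Longrightarrow> f differentiable (at x) \<Longrightarrow> pd i (\<lambda>x. h (f x)) x = h (pd i f x)"
  by (rule pd_eq[THEN trans, OF bounded_linear.has_derivative[OF _ frechet_derivative_has_derivative]])
    (auto simp: pd_def)

lemma pd_cnj: "f differentiable (at x) \<Longrightarrow> pd i (\<lambda>x. cnj (f x)) x = cnj (pd i f x)"
  by (rule pd_bounded_linear[OF bounded_linear_cnj])

lemma pd_cmult: "f differentiable (at x) \<Longrightarrow> pd i (\<lambda>x. c * f x) x = c * pd i f x"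
  by (rule pd_bounded_linear[OF bounded_linear_mult_right])

lemma Ck_on_pd: "Ck_on (Suc k) S f \<Longrightarrow> Ck_on k S (pd i f)"
  unfolding pd_def by simp

lemma smooth_on_pd: "smooth_on S f \<Longrightarrow> smooth_on S (pd i f)"
  unfolding pd_def by (rule smooth_on_frechet_derivative)

lemma Ck_on_imp_differentiable: "Ck_on (Suc k) S f \<Longrightarrow> x \<in> S \<Longrightarrow> f differentiable (at x)"
  by simp

lemma periodic_pd: "periodic w \<Longrightarrow> periodic (pd i w)"
  unfolding pd_def by (rule periodic_frechet_derivative)

lemma pd_compose:
  fixes \<Phi> :: "real^'m \<Rightarrow> real^'n"
  assumes f: "f differentiable (at (\<Phi> y))" and \<Phi>: "\<Phi> differentiable (at y)"
  shows "pd i (\<lambda>y. f (\<Phi> y)) y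
    = (\<Sum>k\<in>UNIV. pd k f (\<Phi> y) * complex_of_real (frechet_derivative \<Phi> (at y) (axis i 1) $ k))"
proof -
  note f' = frechet_derivative_has_derivative[OF f]
  let ?v = "frechet_derivative \<Phi> (at y) (axis i 1)"
  have lin: "linear (frechet_derivative f (at (\<Phi> y)))"
    using f' has_derivative_linear by blast
  have "pd i (\<lambda>y. f (\<Phi> y)) y = frechet_derivative f (at (\<Phi> y)) ?v"
    by (rule pd_eq[OF has_derivative_compose[OF frechet_derivative_has_derivative[OF \<Phi>] f']])
  also have "\<dots> = frechet_derivative f (at (\<Phi> y)) (\<Sum>k\<in>UNIV. (?v $ k) *\<^sub>R axis k 1)"
    using basis_expansion[of ?v] by (simp add: scalar_mult_eq_scaleR)
  also have "\<dots> = (\<Sum>k\<in>UNIV. (?v $ k) *\<^sub>R frechet_derivative f (at (\<Phi> y)) (axis k 1))"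
    by (simp only: linear_sum[OF lin] linear_scale[OF lin])
  finally show ?thesis
    by (simp add: pd_def scaleR_conv_of_real mult.commute)
qed

lemma pd_pd_compose:
  fixes \<Phi> :: "real^'m \<Rightarrow> real^'n"
  assumes P: "open P" and \<Phi>: "smooth_on P \<Phi>" "\<Phi> ` P \<subseteq> S" and f: "Ck_on 2 S f" and y: "y \<in> P"
  defines "d \<equiv> \<lambda>i k y. complex_of_real (frechet_derivative \<Phi> (at y) (axis i 1) $ k)"
  shows "pd i (pd i (\<lambda>y. f (\<Phi> y))) y =
    (\<Sum>l\<in>UNIV. \<Sum>k\<in>UNIV. pd l (pd k f) (\<Phi> y) * d i l y * d i k y)
      + (\<Sum>k\<in>UNIV. pd k f (\<Phi> y) * pd i (d i k) y)"
proof -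
  have f1: "f differentiable (at (\<Phi> y))" "pd k f differentiable (at (\<Phi> y))" if "y \<in> P" for k y
    using f \<Phi>(2) that Ck_on_imp_differentiable[of 1 S f] Ck_on_imp_differentiable[of 0 S "pd k f"]
      Ck_on_pd[of 1 S f k] by (auto simp: numeral_2_eq_2)
  have \<Phi>1: "\<Phi> differentiable (at y)" if "y \<in> P" for y
    using \<Phi>(1) that by (rule smooth_on_imp_differentiable)
  have d1: "d i k differentiable (at y)" for k
  proof -
    have "smooth_on P (d i k)"
      unfolding d_def
      by (rule smooth_on_bounded_linear[OF bounded_linear_of_real
            smooth_on_vec_nth[OF P smooth_on_frechet_derivative[OF \<Phi>(1)]] P])
    then show ?thesis using y by (rule smooth_on_imp_differentiable)
  qed
  have c1: "(\<lambda>y. pd k f (\<Phi> y)) differentiable (at y)" for k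
    using f1(2)[OF y] \<Phi>1[OF y] by (auto simp: differentiable_def intro: has_derivative_compose)
  have "pd i (pd i (\<lambda>y. f (\<Phi> y))) y = pd i (\<lambda>y. \<Sum>k\<in>UNIV. pd k f (\<Phi> y) * d i k y) y"
    by (rule pd_cong_open[OF P y]) (simp add: pd_compose f1 \<Phi>1 d_def)
  also have "\<dots> = (\<Sum>k\<in>UNIV. pd i (\<lambda>y. pd k f (\<Phi> y) * d i k y) y)"
    by (rule pd_sum) (simp add: c1 d1)
  also have "\<dots> = (\<Sum>k\<in>UNIV. pd k f (\<Phi> y) * pd i (d i k) y + (\<Sum>l\<in>UNIV. pd l (pd k f) (\<Phi> y) * d i l y) * d i k y)"
  proof (intro sum.cong refl)
    fix k
    have "pd i (\<lambda>y. pd k f (\<Phi> y)) y = (\<Sum>l\<in>UNIV. pd l (pd k f) (\<Phi> y) * d i l y)"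
      using pd_compose[OF f1(2)[OF y] \<Phi>1[OF y]] by (simp add: d_def)
    then show "pd i (\<lambda>y. pd k f (\<Phi> y) * d i k y) y
      = pd k f (\<Phi> y) * pd i (d i k) y + (\<Sum>l\<in>UNIV. pd l (pd k f) (\<Phi> y) * d i l y) * d i k y"
      using pd_mult[OF c1 d1] by simp
  qed
  also have "\<dots> = (\<Sum>k\<in>UNIV. pd k f (\<Phi> y) * pd i (d i k) y)
      + (\<Sum>k\<in>UNIV. \<Sum>l\<in>UNIV. pd l (pd k f) (\<Phi> y) * d i l y * d i k y)"
    by (simp add: sum.distrib sum_distrib_right)
  finally show ?thesis
    by (subst sum.swap) (simp add: add.commute)
qed


section \<open>The operator\<close>

text \<open>The coefficient of the second derivative in the second variable. It vanishes exactly where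
  \<open>sin (y $ 2) = 0\<close> and \<open>cos (y $ 1) \<ge> 0\<close>, that is, on two segments of the torus. Across the segments it is
  \<open>4 sin\<^sup>2\<close>, which is invariant under dilations to leading order; this is what lets solutions behave like a
  noninteger power of the distance. The flat term is positive on the rest of the two circles, which makes them
  passable for subunit paths without any effect on the strip over the segments.\<close>

definition weight :: "real^2 \<Rightarrow> real" where
  "weight y = 4 * (sin (y $ 2))\<^sup>2 + flat 0 (- cos (y $ 1))"

definition plane_op :: "(real^2 \<Rightarrow> complex) \<Rightarrow> real^2 \<Rightarrow> complex" where
  "plane_op w y = - pd 1 (pd 1 w) y - pd 2 (\<lambda>z. complex_of_real (weight z) * pd 2 w z) y + w y"

text \<open>The preimage \<open>unwrap 0 p\<close> stands for any preimage of \<open>p\<close>, by \<open>torus_op_wrap\<close> below.\<close>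

definition torus_op :: "(complex \<times> complex \<Rightarrow> complex) \<Rightarrow> complex \<times> complex \<Rightarrow> complex" where
  "torus_op u p = plane_op (\<lambda>y. u (wrap y)) (unwrap 0 p)"

lemma weight_nonneg: "0 \<le> weight y"
  by (simp add: weight_def flat_def)

lemma smooth_on_weight: "smooth_on UNIV weight"
proof -
  have "smooth_on UNIV (\<lambda>y::real^2. y $ i)" for i
    by (rule smooth_on_bounded_linear_id[OF bounded_linear_vec_nth])
  from smooth_on_compose[OF open_UNIV open_UNIV this smooth_on_sin_cos(1)]
    smooth_on_compose[OF open_UNIV open_UNIV this smooth_on_sin_cos(2)]
  have sc: "smooth_on UNIV (\<lambda>y::real^2. sin (y $ i))" "smooth_on UNIV (\<lambda>y::real^2. cos (y $ i))" for i
    by auto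
  have "smooth_on UNIV (\<lambda>y::real^2. flat 0 (- cos (y $ 1)))"
    by (rule smooth_on_compose[OF open_UNIV open_UNIV smooth_on_uminus[OF open_UNIV sc(2)] smooth_on_flat]) auto
  then have "smooth_on UNIV (\<lambda>y::real^2. 4 * (sin (y $ 2) * sin (y $ 2)) + flat 0 (- cos (y $ 1)))"
    by (intro smooth_on_add smooth_on_mult smooth_on_const open_UNIV sc)
  then show ?thesis by (simp add: weight_def[abs_def] power2_eq_square)
qed

lemma periodic_weight: "periodic weight"
proof -
  have "weight y = 4 * (Im (snd (wrap y)))\<^sup>2 + flat 0 (- Re (fst (wrap y)))" for y
    by (simp add: weight_def wrap_def)
  then show ?thesis unfolding periodic_def by metis
qed

lemma smooth_on_cweight: "smooth_on UNIV (\<lambda>y. complex_of_real (weight y))"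
  by (rule smooth_on_bounded_linear[OF bounded_linear_of_real smooth_on_weight open_UNIV])

lemma plane_op_expand:
  assumes "Ck_on 2 UNIV w"
  shows "plane_op w y = - pd 1 (pd 1 w) y - complex_of_real (weight y) * pd 2 (pd 2 w) y
    - pd 2 (\<lambda>y. complex_of_real (weight y)) y * pd 2 w y + w y"
proof -
  have "pd 2 w differentiable (at y)"
    using Ck_on_pd[of 1 UNIV w 2] assms by (simp add: numeral_2_eq_2)
  moreover have "(\<lambda>y. complex_of_real (weight y)) differentiable (at y)"
    using smooth_on_imp_differentiable[OF smooth_on_cweight] by blast
  ultimately show ?thesis by (simp add: plane_op_def pd_mult)
qed

lemma continuous_on_plane_op:
  assumes w: "Ck_on 2 UNIV w" shows "continuous_on UNIV (plane_op w)"
proof -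
  have "Ck_on 2 UNIV (\<lambda>y. complex_of_real (weight y))"
    using smooth_on_cweight smooth_on_imp_Ck by blast
  then have "Ck_on 1 UNIV (pd 2 (\<lambda>y. complex_of_real (weight y)))" "Ck_on 2 UNIV (\<lambda>y. complex_of_real (weight y))"
    by (auto simp: numeral_2_eq_2 intro: Ck_on_pd simp del: Ck_on.simps)
  moreover have "Ck_on 1 UNIV (pd i w)" "Ck_on 0 UNIV (pd i (pd i w))" for i
    using w by (auto simp: numeral_2_eq_2 intro!: Ck_on_pd simp del: Ck_on.simps)
  ultimately have "continuous_on UNIV (pd i w)" "continuous_on UNIV (pd i (pd i w))" 
    "continuous_on UNIV (pd 2 (\<lambda>y. complex_of_real (weight y)))" for i
    by (blast intro: Ck_on_imp_continuous_on)+
  then show ?thesis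
    unfolding plane_op_expand[OF w, abs_def] by (intro continuous_intros Ck_on_imp_continuous_on[OF w] smooth_on_imp_continuous_on[OF smooth_on_weight])
qed

lemma smooth_on_plane_op:
  assumes "smooth_on UNIV w" shows "smooth_on UNIV (plane_op w)"
  unfolding plane_op_def[abs_def] diff_conv_add_uminus
  by (intro smooth_on_add smooth_on_uminus open_UNIV smooth_on_pd smooth_on_mult smooth_on_cweight assms)

lemma periodic_plane_op:
  assumes "periodic w" shows "periodic (plane_op w)"
  unfolding plane_op_def[abs_def]
  by (intro periodic_comp2[of _ _ "(+)"] periodic_comp2[of _ _ "(-)"] periodic_comp2[of _ _ "(*)"]
      periodic_comp[of _ uminus] periodic_comp[of _ complex_of_real] periodic_pd assms periodic_weight)

lemma torus_op_wrap: "torus_op u (wrap y) = plane_op (\<lambda>y. u (wrap y)) y"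
  unfolding torus_op_def by (rule periodic_unwrap[OF periodic_plane_op]) simp

lemma smooth_fun_torus_op: "smooth_fun torus_atlas u \<Longrightarrow> smooth_fun torus_atlas (torus_op u)"
  by (simp add: smooth_fun_torus torus_op_wrap smooth_on_plane_op)

text \<open>Column \<open>i\<close> of the Jacobian matrix of \<open>coord C \<circ> wrap\<close>.\<close>

definition jac :: "(complex \<times> complex, 2) chart \<Rightarrow> 2 \<Rightarrow> real^2 \<Rightarrow> real^2" where
  "jac C i y = frechet_derivative (\<lambda>y. coord C (wrap y)) (at y) (axis i 1)"

definition diag_weight :: "2 \<Rightarrow> real^2 \<Rightarrow> real" where
  "diag_weight i y = (if i = 1 then 1 else weight y)"

text \<open>The diagonal matrix with entries \<open>1\<close> and \<open>weight y\<close>, pushed forward to the chart.\<close>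

definition symb :: "(complex \<times> complex, 2) chart \<Rightarrow> real^2 \<Rightarrow> real^2^2" where
  "symb C y = (\<chi> l k. \<Sum>i\<in>UNIV. diag_weight i y * jac C i y $ l * jac C i y $ k)"

text \<open>The first-order terms produced by the chain rule, and by the derivative that falls on \<open>weight\<close>.\<close>

definition first_order :: "(complex \<times> complex, 2) chart \<Rightarrow> real^2 \<Rightarrow> complex^2" where
  "first_order C y = (\<chi> k. - (\<Sum>i\<in>UNIV. complex_of_real (diag_weight i y) * pd i (\<lambda>y. complex_of_real (jac C i y $ k)) y)
     - pd 2 (\<lambda>y. complex_of_real (weight y)) y * complex_of_real (jac C 2 y $ k))"

lemma smooth_on_jac: "C \<in> torus_atlas \<Longrightarrow> smooth_on (wrap -` cdom C) (jac C i)"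
  unfolding jac_def[abs_def] by (rule smooth_on_frechet_derivative[OF smooth_on_coord_wrap])

lemma periodic_jac: "periodic (jac C i)"
  unfolding jac_def[abs_def] by (rule periodic_frechet_derivative) simp

lemma smooth_on_diag_weight: "smooth_on S (diag_weight i)"
  unfolding diag_weight_def[abs_def]
  using smooth_on_subset[OF smooth_on_weight, of S] by (cases "i = 1") (simp_all add: smooth_on_const)

lemma periodic_diag_weight: "periodic (diag_weight i)"
  unfolding diag_weight_def[abs_def]
  by (cases "i = 1") (simp_all add: periodic_weight, simp add: periodic_def)

lemma smooth_on_symb:
  assumes "C \<in> torus_atlas"
  shows "smooth_on (wrap -` cdom C) (\<lambda>y. \<chi> l k. complex_of_real (symb C y $ l $ k))"
proof -
  note o = open_wrap_cdom[OF assms]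
  have "smooth_on (wrap -` cdom C) (\<lambda>y. symb C y $ l $ k)" for l k
    unfolding symb_def
    by (simp, intro smooth_on_sum smooth_on_mult smooth_on_vec_nth smooth_on_diag_weight o smooth_on_jac[OF assms])
  then show ?thesis
    by (intro smooth_on_vec_lambda o smooth_on_bounded_linear[OF bounded_linear_of_real])
qed

lemma periodicD: "periodic q \<Longrightarrow> wrap y = wrap y' \<Longrightarrow> q y = q y'"
  unfolding periodic_def by blast

lemma periodic_symb_real: "periodic (symb C)"
  unfolding periodic_def
proof (intro allI impI)
  fix y y' :: "real^2" assume w: "wrap y = wrap y'"
  have "jac C i y = jac C i y'" "diag_weight i y = diag_weight i y'" for i
    by (rule periodicD[OF _ w], rule periodic_jac periodic_diag_weight)+
  then show "symb C y = symb C y'" by (simp only: symb_def)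
qed

lemma periodic_symb: "periodic (\<lambda>y. \<chi> l k. complex_of_real (symb C y $ l $ k))"
  by (rule periodic_comp[OF periodic_symb_real, where g = "\<lambda>M. \<chi> l k. complex_of_real (M $ l $ k)"])

lemma smooth_on_first_order:
  assumes "C \<in> torus_atlas"
  shows "smooth_on (wrap -` cdom C) (first_order C)"
proof -
  note o = open_wrap_cdom[OF assms]
  have *: "smooth_on (wrap -` cdom C) (\<lambda>y. complex_of_real (jac C i y $ k))" for i k
    by (intro smooth_on_bounded_linear[OF bounded_linear_of_real] smooth_on_vec_nth o smooth_on_jac[OF assms])
  show ?thesis
    unfolding first_order_def[abs_def]
    by (intro smooth_on_vec_lambda o smooth_on_diff smooth_on_uminus smooth_on_sum smooth_on_mult smooth_on_pd *
        smooth_on_bounded_linear[OF bounded_linear_of_real smooth_on_diag_weight]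
        smooth_on_subset[OF smooth_on_cweight] subset_UNIV)
qed

lemma periodic_first_order: "periodic (first_order C)"
  unfolding periodic_def
proof (intro allI impI)
  fix y y' :: "real^2" assume w: "wrap y = wrap y'"
  have j: "periodic (\<lambda>y. complex_of_real (jac C i y $ k))" for i k
    by (rule periodic_comp[OF periodic_jac])
  have "jac C i y = jac C i y'" "diag_weight i y = diag_weight i y'"
    "pd i (\<lambda>y. complex_of_real (jac C i y $ k)) y = pd i (\<lambda>y. complex_of_real (jac C i y $ k)) y'" for i k
    by (rule periodicD[OF _ w], rule periodic_jac periodic_diag_weight periodic_pd[OF j])+
  moreover have "pd 2 (\<lambda>y. complex_of_real (weight y)) y = pd 2 (\<lambda>y. complex_of_real (weight y)) y'"
    by (rule periodicD[OF periodic_pd[OF periodic_comp[OF periodic_weight]] w])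
  ultimately show "first_order C y = first_order C y'"
    by (simp only: first_order_def)
qed

lemma plane_op_in_chart:
  assumes C: "C \<in> torus_atlas" and u: "Ck_fun torus_atlas 2 u" and y: "wrap y \<in> cdom C"
  defines "x \<equiv> coord C (wrap y)" and "v \<equiv> u \<circ> param C"
  shows "plane_op (\<lambda>y. u (wrap y)) y =
    - (\<Sum>l\<in>UNIV. \<Sum>k\<in>UNIV. complex_of_real (symb C y $ l $ k) * pd l (pd k v) x)
    + (\<Sum>k\<in>UNIV. first_order C y $ k * pd k v x) + u (wrap y)"
proof -
  let ?\<Phi> = "\<lambda>y. coord C (wrap y)" and ?P = "wrap -` cdom C" and ?w = "\<lambda>y. u (wrap y)"
  define d where "d i k y = complex_of_real (jac C i y $ k)" for i k y
  define \<beta> where "\<beta> y = complex_of_real (weight y)" for y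
  have P: "open ?P" by (rule open_wrap_cdom[OF C])
  have \<Phi>: "smooth_on ?P ?\<Phi>" "?\<Phi> ` ?P \<subseteq> cimg C"
    using smooth_on_coord_wrap[OF C] by (auto simp: cimg_def)
  have v: "Ck_on 2 (cimg C) v" using u C by (simp add: Ck_fun_def v_def)
  have w: "Ck_on 2 UNIV ?w" using u by (simp add: Ck_fun_torus)
  have wv: "?w y = v (?\<Phi> y)" if "y \<in> ?P" for y
    using that by (simp add: v_def param_coord[OF torus_atlas_chart[OF C]])
  have yP: "y \<in> ?P" using y by simp
  have pw: "pd i ?w z = pd i (\<lambda>y. v (?\<Phi> y)) z" if "z \<in> ?P" for i z
    by (rule pd_cong_open[OF P that wv])
  have w1: "pd i ?w y = (\<Sum>k\<in>UNIV. pd k v x * d i k y)" for i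
    unfolding pw[OF yP] d_def jac_def x_def
    by (rule pd_compose) (use v \<Phi> yP in \<open>auto simp: numeral_2_eq_2 intro: smooth_on_imp_differentiable\<close>)
  have w2: "pd i (pd i ?w) y = (\<Sum>l\<in>UNIV. \<Sum>k\<in>UNIV. pd l (pd k v) x * d i l y * d i k y)
      + (\<Sum>k\<in>UNIV. pd k v x * pd i (d i k) y)" for i
  proof -
    have "pd i (pd i ?w) y = pd i (pd i (\<lambda>y. v (?\<Phi> y))) y"
      by (rule pd_cong_open[OF P yP pw])
    then show ?thesis
      using pd_pd_compose[OF P \<Phi> v yP, of i] by (simp add: d_def[abs_def] jac_def x_def)
  qed
  have "plane_op ?w y = - (pd 1 (pd 1 ?w) y + \<beta> y * pd 2 (pd 2 ?w) y) - pd 2 \<beta> y * pd 2 ?w y + u (wrap y)"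
    by (simp add: plane_op_expand[OF w] \<beta>_def[abs_def])
  also have "\<dots> = - (\<Sum>i\<in>UNIV. complex_of_real (diag_weight i y) * pd i (pd i ?w) y)
      - pd 2 \<beta> y * pd 2 ?w y + u (wrap y)"
    by (simp add: sum_2 diag_weight_def \<beta>_def)
  also have "\<dots> = - (\<Sum>l\<in>UNIV. \<Sum>k\<in>UNIV. complex_of_real (symb C y $ l $ k) * pd l (pd k v) x)
    + (\<Sum>k\<in>UNIV. first_order C y $ k * pd k v x) + u (wrap y)"
    unfolding w1 w2 symb_def first_order_def
    by (simp add: sum_2 d_def \<beta>_def[abs_def] d_def[abs_def] algebra_simps)
  finally show ?thesis .
qed

lemma wrap_unwrap_param:
  assumes "C \<in> torus_atlas" "x \<in> cimg C"
  shows "wrap (unwrap 0 (param C x)) = param C x"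
  using param_in_cdom[OF assms(2)] torus_atlas_cdom[OF assms(1)] by (intro wrap_unwrap) auto

lemma local_form_torus_op:
  assumes C: "C \<in> torus_atlas"
  shows "local_form torus_atlas torus_op C
    (\<lambda>x. \<chi> l k. complex_of_real (symb C (unwrap 0 (param C x)) $ l $ k))
    (\<lambda>x. first_order C (unwrap 0 (param C x))) (\<lambda>x. 1)"
  unfolding local_form_def
proof (intro conjI ballI allI impI)
  show "smooth_on (cimg C) (\<lambda>x. \<chi> l k. complex_of_real (symb C (unwrap 0 (param C x)) $ l $ k))"
    by (rule smooth_on_periodic_param[OF C periodic_symb smooth_on_symb[OF C]])
  show "smooth_on (cimg C) (\<lambda>x. first_order C (unwrap 0 (param C x)))"
    by (rule smooth_on_periodic_param[OF C periodic_first_order smooth_on_first_order[OF C]])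
  show "smooth_on (cimg C) (\<lambda>x. 1 :: complex)" by (rule smooth_on_const)
  show "transpose (\<chi> l k. complex_of_real (symb C (unwrap 0 (param C x)) $ l $ k))
    = (\<chi> l k. complex_of_real (symb C (unwrap 0 (param C x)) $ l $ k))" for x
    by (simp add: transpose_def symb_def vec_eq_iff mult_ac)
next
  fix u x assume u: "Ck_fun torus_atlas 2 u" and x: "x \<in> cimg C"
  note w = wrap_unwrap_param[OF C x]
  have "wrap (unwrap 0 (param C x)) \<in> cdom C" using param_in_cdom[OF x] w by simp
  from plane_op_in_chart[OF C u this]
  show "torus_op u (param C x) =
          - (\<Sum>i\<in>UNIV. \<Sum>j\<in>UNIV. (\<chi> l k. complex_of_real (symb C (unwrap 0 (param C x)) $ l $ k)) $ i $ j
               * pd i (pd j (u \<circ> param C)) x)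
          + (\<Sum>i\<in>UNIV. first_order C (unwrap 0 (param C x)) $ i * pd i (u \<circ> param C) x)
          + 1 * u (param C x)"
    unfolding torus_op_def w coord_param[OF x] by simp
qed

lemma real_principal_part_torus_op:
  "C \<in> torus_atlas \<Longrightarrow> real_principal_part torus_atlas torus_op C (\<lambda>x. symb C (unwrap 0 (param C x)))"
  unfolding real_principal_part_def using local_form_torus_op by blast

lemma second_order_operator_torus_op: "second_order_operator torus_atlas torus_op"
  unfolding second_order_operator_def using local_form_torus_op by blast

text \<open>The symbol is a weighted sum of squares in every chart. Nonnegativity, ellipticity and the subunit
  condition are all read off from this formula.\<close>

lemma symb_quadratic: "\<xi> \<bullet> (symb C y *v \<xi>) = (\<Sum>i\<in>UNIV. diag_weight i y * (jac C i y \<bullet> \<xi>)\<^sup>2)"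
  by (simp add: symb_def inner_vec_def matrix_vector_mult_def sum_2 power2_eq_square algebra_simps)

lemma diag_weight_nonneg: "0 \<le> diag_weight i y"
  by (simp add: diag_weight_def weight_nonneg)

lemma nonneg_principal_symbol_torus_op: "nonneg_principal_symbol torus_atlas torus_op"
  unfolding nonneg_principal_symbol_def
proof (intro ballI exI conjI allI)
  fix C x \<xi> assume "C \<in> torus_atlas"
  then show "real_principal_part torus_atlas torus_op C (\<lambda>x. symb C (unwrap 0 (param C x)))"
    by (rule real_principal_part_torus_op)
  show "0 \<le> \<xi> \<bullet> (symb C (unwrap 0 (param C x)) *v \<xi>)"
    unfolding symb_quadratic by (intro sum_nonneg mult_nonneg_nonneg diag_weight_nonneg) simp
qed

lemma jac_derivative:
  assumes C: "C \<in> torus_atlas" and y: "wrap y \<in> cdom C"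
  shows "((\<lambda>y. coord C (wrap y)) has_derivative (\<lambda>v. \<Sum>i\<in>UNIV. v $ i *\<^sub>R jac C i y)) (at y)"
proof -
  have D: "((\<lambda>y. coord C (wrap y)) has_derivative frechet_derivative (\<lambda>y. coord C (wrap y)) (at y)) (at y)"
    by (intro frechet_derivative_has_derivative smooth_on_imp_differentiable[OF smooth_on_coord_wrap[OF C]])
      (use y in simp)
  then have lin: "linear (frechet_derivative (\<lambda>y. coord C (wrap y)) (at y))"
    using has_derivative_linear by blast
  have "frechet_derivative (\<lambda>y. coord C (wrap y)) (at y) v = (\<Sum>i\<in>UNIV. v $ i *\<^sub>R jac C i y)" for v
  proof -
    have "frechet_derivative (\<lambda>y. coord C (wrap y)) (at y) (\<Sum>i\<in>UNIV. v $ i *\<^sub>R axis i 1) = (\<Sum>i\<in>UNIV. v $ i *\<^sub>R jac C i y)"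
      unfolding jac_def by (simp only: linear_sum[OF lin] linear_scale[OF lin])
    then show ?thesis using basis_expansion[of v] by (simp add: scalar_mult_eq_scaleR)
  qed
  then have "frechet_derivative (\<lambda>y. coord C (wrap y)) (at y) = (\<lambda>v. \<Sum>i\<in>UNIV. v $ i *\<^sub>R jac C i y)" ..
  then show ?thesis using D by simp
qed

text \<open>Near \<open>y\<close>, \<open>unwrap y \<circ> param C\<close> is a differentiable left inverse of \<open>coord C \<circ> wrap\<close>.\<close>

lemma coord_wrap_derivative_inj:
  assumes C: "C \<in> torus_atlas" and y: "wrap y \<in> cdom C"
  shows "inj (\<lambda>v. \<Sum>i\<in>UNIV. v $ i *\<^sub>R jac C i y)"
proof -
  let ?\<Phi> = "\<lambda>y. coord C (wrap y)"
  have ch: "is_chart torus_top C" by (rule torus_atlas_chart[OF C])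
  have x: "?\<Phi> y \<in> cimg C" "wrap y = param C (?\<Phi> y)"
    using y by (auto simp: cimg_def param_coord[OF ch])
  have "smooth_on (unwrap y ` (cdom C \<inter> wrap ` window y)) (coord C \<circ> param (window_chart y))"
    and s: "smooth_on (coord C ` (cdom C \<inter> wrap ` window y)) (unwrap y \<circ> param C)"
    using C by (simp_all add: torus_atlas_def compatible_def)
  have "?\<Phi> y \<in> coord C ` (cdom C \<inter> wrap ` window y)" using y by auto
  from smooth_on_imp_differentiable[OF s this]
  obtain G where G: "((unwrap y \<circ> param C) has_derivative G) (at (?\<Phi> y))"
    by (auto simp: differentiable_def)
  have "((\<lambda>z. (unwrap y \<circ> param C) (?\<Phi> z)) has_derivative (\<lambda>v. G (\<Sum>i\<in>UNIV. v $ i *\<^sub>R jac C i y))) (at y)"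
    by (rule has_derivative_compose[OF jac_derivative[OF C y] G])
  moreover have eq: "(unwrap y \<circ> param C) (?\<Phi> z) = z" if "z \<in> window y \<inter> wrap -` cdom C" for z
    using that by (simp add: param_coord[OF ch] unwrap_wrap)
  ultimately have "((\<lambda>z. z) has_derivative (\<lambda>v. G (\<Sum>i\<in>UNIV. v $ i *\<^sub>R jac C i y))) (at y)"
    by (subst (asm) has_derivative_cong_open[OF open_Int[OF open_window open_wrap_cdom[OF C]] _ eq]) (use y in auto)
  then have "(\<lambda>v. G (\<Sum>i\<in>UNIV. v $ i *\<^sub>R jac C i y)) = (\<lambda>v. v)"
    by (rule has_derivative_unique[OF _ has_derivative_ident])
  then have "G (\<Sum>i\<in>UNIV. v $ i *\<^sub>R jac C i y) = v" for v by (rule fun_cong)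
  then show ?thesis by (rule inj_on_inverseI)
qed

lemma jac_orthogonal_zero:
  assumes C: "C \<in> torus_atlas" and y: "wrap y \<in> cdom C" and "\<And>i. jac C i y \<bullet> \<xi> = 0"
  shows "\<xi> = 0"
proof -
  have "linear (\<lambda>v. \<Sum>i\<in>UNIV. v $ i *\<^sub>R jac C i y)"
    using jac_derivative[OF C y] has_derivative_linear by blast
  from linear_injective_imp_surjective[OF this coord_wrap_derivative_inj[OF C y] refl]
  obtain v where "\<xi> = (\<Sum>i\<in>UNIV. v $ i *\<^sub>R jac C i y)" by (rule surjE)
  then have "\<xi> \<bullet> \<xi> = (\<Sum>i\<in>UNIV. v $ i *\<^sub>R jac C i y) \<bullet> \<xi>" by simp
  then have "\<xi> \<bullet> \<xi> = 0" by (simp add: inner_sum_left assms(3))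
  then show ?thesis by simp
qed

lemma elliptic_at_torus_op:
  assumes "0 < weight y"
  shows "elliptic_at torus_atlas torus_op (wrap y)"
  unfolding elliptic_at_def
proof (intro ballI impI exI conjI allI)
  fix C \<xi> assume C: "C \<in> torus_atlas" and y: "wrap y \<in> cdom C"
  show "local_form torus_atlas torus_op C
    (\<lambda>x. \<chi> l k. complex_of_real (symb C (unwrap 0 (param C x)) $ l $ k))
    (\<lambda>x. first_order C (unwrap 0 (param C x))) (\<lambda>x. 1)"
    by (rule local_form_torus_op[OF C])
  assume \<xi>: "\<xi> \<noteq> (0 :: real^2)"
  have p: "param C (coord C (wrap y)) = wrap y"
    using y by (simp add: param_coord[OF torus_atlas_chart[OF C]])
  have y': "(\<chi> l k. complex_of_real (symb C (unwrap 0 (wrap y)) $ l $ k))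
      = (\<chi> l k. complex_of_real (symb C y $ l $ k))"
    by (rule periodic_unwrap[OF periodic_symb])
  have pos: "0 < diag_weight i y" for i using assms by (simp add: diag_weight_def)
  obtain i where "jac C i y \<bullet> \<xi> \<noteq> 0" using jac_orthogonal_zero[OF C y] \<xi> by blast
  then have "0 < diag_weight i y * (jac C i y \<bullet> \<xi>)\<^sup>2" using pos by simp
  then have "0 < (\<Sum>i\<in>UNIV. diag_weight i y * (jac C i y \<bullet> \<xi>)\<^sup>2)"
    using pos by (intro sum_pos2[of _ i]) (auto simp: less_imp_le)
  then have "\<xi> \<bullet> (symb C y *v \<xi>) \<noteq> 0" by (simp add: symb_quadratic)
  moreover have "(\<Sum>i\<in>UNIV. \<Sum>j\<in>UNIV. complex_of_real (symb C y $ i $ j) * complex_of_real (\<xi> $ i * \<xi> $ j))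
      = complex_of_real (\<xi> \<bullet> (symb C y *v \<xi>))"
    by (simp add: inner_vec_def matrix_vector_mult_def sum_2 algebra_simps)
  ultimately show "(\<Sum>i\<in>UNIV. \<Sum>j\<in>UNIV. (\<chi> l k. complex_of_real (symb C (unwrap 0 (param C (coord C (wrap y)))) $ l $ k)) $ i $ j
      * complex_of_real (\<xi> $ i * \<xi> $ j)) \<noteq> 0"
    unfolding p y' by simp
qed


section \<open>The measure\<close>

text \<open>Half-open, so that \<open>wrap\<close> maps it bijectively onto the torus and the image measure counts no point twice.\<close>

definition cell :: "(real^2) set" where
  "cell = {y. \<forall>i. - pi < y $ i \<and> y $ i \<le> pi}"

definition torus_measure :: "(complex \<times> complex) measure" where
  "torus_measure = distr (restrict_space lborel cell) (restrict_space borel torus) wrap"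

definition cell_integral :: "(real^2 \<Rightarrow> 'b::{banach, second_countable_topology}) \<Rightarrow> 'b" where
  "cell_integral g = (LINT y:cell|lborel. g y)"

lemma cell_in_borel: "cell \<in> sets borel"
proof -
  have "cell = {y. - pi < y $ 1} \<inter> {y. y $ 1 \<le> pi} \<inter> {y. - pi < y $ 2} \<inter> {y. y $ 2 \<le> pi}"
    by (auto simp: cell_def forall_2)
  also have "\<dots> \<in> sets borel"
    by (intro sets.Int borel_open borel_closed open_Collect_less closed_Collect_le continuous_intros)
  finally show ?thesis .
qed

lemma cell_subset_cbox: "cell \<subseteq> cbox (\<chi> i. - pi) (\<chi> i. pi)"
  by (auto simp: cell_def mem_box_cart less_imp_le)

lemma box_subset_cell: "box (\<chi> i. - pi) (\<chi> i. pi) \<subseteq> cell"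
  by (auto simp: cell_def mem_box_cart less_imp_le)

lemma cell_iff_unwrap: "y \<in> cell \<longleftrightarrow> unwrap 0 (wrap y) = y"
proof
  assume "y \<in> cell"
  then have "Arg (cis (y $ i)) = y $ i" for i
    by (intro Arg_cis) (auto simp: cell_def)
  then show "unwrap 0 (wrap y) = y" by (simp add: unwrap_def component_wrap vec_eq_iff)
next
  assume a: "unwrap 0 (wrap y) = y"
  have eq: "y $ i = Arg (cis (y $ i))" for i
    using arg_cong[OF a, of "\<lambda>v. v $ i"] by (simp add: unwrap_def component_wrap)
  have "- pi < y $ i \<and> y $ i \<le> pi" for i
    using eq[of i] mpi_less_Arg[of "cis (y $ i)"] Arg_le_pi[of "cis (y $ i)"] by linarith
  then show "y \<in> cell" by (simp add: cell_def)
qed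

lemma unwrap_in_cell: "p \<in> torus \<Longrightarrow> unwrap 0 p \<in> cell"
  by (simp add: cell_iff_unwrap wrap_unwrap)

lemma inj_on_wrap_cell: "inj_on wrap cell"
  by (rule inj_on_inverseI[where g = "unwrap 0"]) (simp add: cell_iff_unwrap)

lemma sets_torus_measure: "sets torus_measure = sigma_sets torus {U. openin torus_top U}"
proof -
  have "{U. openin torus_top U} = (\<inter>) torus ` {S. open S}"
    by (auto simp: openin_open image_iff)
  moreover have "sets (restrict_space borel torus) = sigma_sets torus ((\<inter>) torus ` {S. open S})"
  proof -
    have "torus \<in> sets borel" using compact_torus by (simp add: borel_compact)
    then have "torus \<in> sigma_sets UNIV {S. open S}" by (simp add: borel_def)
    from sigma_sets_Int[OF this subset_UNIV] show ?thesis
      by (simp add: sets_restrict_space borel_def)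
  qed
  ultimately show ?thesis by (simp add: torus_measure_def)
qed

lemma wrap_measurable: "wrap \<in> measurable (restrict_space lborel cell) (restrict_space borel torus)"
proof -
  have "wrap \<in> borel_measurable borel"
    using continuous_on_wrap[of UNIV] by (rule borel_measurable_continuous_onI)
  then have "wrap \<in> borel_measurable (restrict_space lborel cell)"
    by (simp add: measurable_restrict_space1)
  then show ?thesis
    by (rule measurable_restrict_space2[rotated]) auto
qed

text \<open>\<open>wrap\<close> is a quotient map: preimages of closed sets under \<open>u\<close> are images of compact subsets of a square.\<close>

lemma continuous_on_torus:
  fixes u :: "complex \<times> complex \<Rightarrow> 'b::topological_space"
  assumes "continuous_on UNIV (\<lambda>y. u (wrap y))"
  shows "continuous_on torus u"
  unfolding continuous_on_closed_vimage[OF compact_imp_closed[OF compact_torus]]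
proof (intro allI impI)
  fix B :: "'b set" assume B: "closed B"
  let ?K = "cbox (\<chi> i. - pi) (\<chi> i. pi) :: (real^2) set"
  have "closed ((\<lambda>y. u (wrap y)) -` B)"
    using assms B by (simp add: closed_vimage)
  then have "compact (wrap ` (?K \<inter> (\<lambda>y. u (wrap y)) -` B))"
    by (intro compact_continuous_image continuous_on_wrap compact_Int_closed compact_cbox)
  moreover have "wrap ` (?K \<inter> (\<lambda>y. u (wrap y)) -` B) = u -` B \<inter> torus"
  proof (intro equalityI subsetI)
    fix p assume p: "p \<in> u -` B \<inter> torus"
    then have "unwrap 0 p \<in> ?K" "wrap (unwrap 0 p) = p"
      using subsetD[OF cell_subset_cbox unwrap_in_cell] wrap_unwrap by auto
    with p show "p \<in> wrap ` (?K \<inter> (\<lambda>y. u (wrap y)) -` B)"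
      by (intro image_eqI[of _ _ "unwrap 0 p"]) auto
  qed auto
  ultimately show "closed (u -` B \<inter> torus)" using compact_imp_closed by metis
qed

lemma measurable_torus:
  fixes u :: "complex \<times> complex \<Rightarrow> 'b::topological_space"
  assumes "continuous_on UNIV (\<lambda>y. u (wrap y))"
  shows "u \<in> borel_measurable (restrict_space borel torus)"
  by (rule borel_measurable_continuous_on_restrict[OF continuous_on_torus[OF assms]])

lemma integral_torus:
  fixes u :: "complex \<times> complex \<Rightarrow> 'b::{banach, second_countable_topology}"
  assumes "continuous_on UNIV (\<lambda>y. u (wrap y))"
  shows "(\<integral>p. u p \<partial>torus_measure) = cell_integral (\<lambda>y. u (wrap y))"
  unfolding torus_measure_def cell_integral_def set_lebesgue_integral_def
  by (subst integral_distr[OF wrap_measurable measurable_torus[OF assms]])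
    (simp add: integral_restrict_space cell_in_borel)

lemma integrable_cell:
  fixes g :: "real^2 \<Rightarrow> 'b::{banach, second_countable_topology}"
  assumes "continuous_on UNIV g"
  shows "set_integrable lborel cell g"
proof (rule set_integrable_subset)
  show "set_integrable lborel (cbox (\<chi> i. - pi) (\<chi> i. pi)) g"
    unfolding set_integrable_def
    by (rule borel_integrable_compact[OF compact_cbox continuous_on_subset[OF assms subset_UNIV]])
qed (use cell_subset_cbox cell_in_borel in auto)

lemma cell_integral_add:
  "continuous_on UNIV f \<Longrightarrow> continuous_on UNIV g \<Longrightarrow>
    cell_integral (\<lambda>y. f y + g y) = cell_integral f + cell_integral g"
  unfolding cell_integral_def by (intro set_integral_add integrable_cell)

lemma cell_integral_cmult: "cell_integral (\<lambda>y. c * f y) = c * cell_integral f" for c :: complex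
  by (simp add: cell_integral_def)

lemma cell_integral_cmult_real: "cell_integral (\<lambda>y. c * f y) = c * cell_integral f" for c :: real
  by (simp add: cell_integral_def)

lemma cell_integral_Re:
  "continuous_on UNIV f \<Longrightarrow> Re (cell_integral f) = cell_integral (\<lambda>y. Re (f y))"
  unfolding cell_integral_def set_lebesgue_integral_def
  using integral_Re[OF integrable_cell[unfolded set_integrable_def], of f] by simp

lemma cell_integral_of_real:
  "cell_integral (\<lambda>y. complex_of_real (f y)) = complex_of_real (cell_integral f)"
  unfolding cell_integral_def by (rule set_integral_complex_of_real)

lemma cell_integral_cnj: "cell_integral (\<lambda>y. cnj (f y)) = cnj (cell_integral f)"
  unfolding cell_integral_def set_lebesgue_integral_def
  using Bochner_Integration.integral_cnj[of lborel "\<lambda>y. indicator cell y *\<^sub>R f y"] by simp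

lemma cell_integral_mono:
  fixes f g :: "real^2 \<Rightarrow> real"
  assumes "continuous_on UNIV f" "continuous_on UNIV g" "\<And>y. f y \<le> g y"
  shows "cell_integral f \<le> cell_integral g"
  unfolding cell_integral_def by (intro set_integral_mono integrable_cell assms)

lemma cell_integral_nonneg:
  fixes f :: "real^2 \<Rightarrow> real"
  shows "(\<And>y. 0 \<le> f y) \<Longrightarrow> 0 \<le> cell_integral f"
  unfolding cell_integral_def set_lebesgue_integral_def by (intro Bochner_Integration.integral_nonneg) auto

lemma norm_cell_integral_le:
  fixes f :: "real^2 \<Rightarrow> 'b::{banach, second_countable_topology}"
  assumes "continuous_on UNIV f"
  shows "norm (cell_integral f) \<le> cell_integral (\<lambda>y. norm (f y))"
proof -
  have "norm (LINT y|lborel. indicator cell y *\<^sub>R f y) \<le> (LINT y|lborel. norm (indicator cell y *\<^sub>R f y))"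
    by (rule integral_norm_bound)
  then show ?thesis by (simp add: cell_integral_def set_lebesgue_integral_def)
qed

lemma cell_integral_zero_imp_zero:
  fixes f :: "real^2 \<Rightarrow> real"
  assumes f: "continuous_on UNIV f" "\<And>y. 0 \<le> f y" "periodic f" and 0: "cell_integral f = 0"
  shows "f y = 0"
proof -
  let ?a = "(\<chi> i. - pi) :: real^2" and ?b = "(\<chi> i. pi) :: real^2"
  have int: "set_integrable lborel (box ?a ?b) f"
    by (rule set_integrable_subset[OF integrable_cell[OF f(1)] _ box_subset_cell]) auto
  have "(LINT y:box ?a ?b|lborel. f y) \<le> cell_integral f"
    unfolding cell_integral_def set_lebesgue_integral_def
  proof (rule integral_mono)
    show "indicator (box ?a ?b) y *\<^sub>R f y \<le> indicator cell y *\<^sub>R f y" for y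
      using subsetD[OF box_subset_cell, of y] f(2) by (auto simp: indicator_def)
  qed (use int integrable_cell[OF f(1)] in \<open>auto simp: set_integrable_def\<close>)
  moreover have "0 \<le> (LINT y:box ?a ?b|lborel. f y)"
    unfolding set_lebesgue_integral_def by (intro Bochner_Integration.integral_nonneg) (auto simp: f)
  ultimately have "integral (box ?a ?b) f = 0"
    using 0 set_borel_integral_eq_integral(2)[OF int] by simp
  then have "integral (cbox ?a ?b) f = 0" by (simp add: integral_open_interval)
  moreover have c: "continuous_on (cbox ?a ?b) f" using f(1) continuous_on_subset by blast
  moreover have "f integrable_on cbox ?a ?b" by (rule integrable_continuous[OF c])
  ultimately have h: "(f has_integral 0) (cbox ?a ?b)" by (metis integrable_integral)
  have ne: "box ?a ?b \<noteq> {}"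
  proof -
    have "0 \<in> box ?a ?b" by (simp add: mem_box_cart)
    then show ?thesis by blast
  qed
  have "unwrap 0 (wrap y) \<in> cbox ?a ?b"
    by (rule subsetD[OF cell_subset_cbox unwrap_in_cell[OF wrap_in_torus]])
  from has_integral_0_cbox_imp_0[OF c f(2) h ne this] show ?thesis
    by (simp add: periodic_unwrap[OF f(3)])
qed

definition pt :: "real \<Rightarrow> real \<Rightarrow> real^2" where
  "pt x t = (\<chi> i. if i = 1 then x else t)"

lemma pt_nth [simp]: "pt x t $ 1 = x" "pt x t $ 2 = t"
  by (simp_all add: pt_def)

lemma pt_eta: "pt (y $ 1) (y $ 2) = y"
  by (simp add: vec_eq_iff forall_2)

lemma pt_measurable: "(\<lambda>(x, t). pt x t) \<in> borel_measurable (lborel \<Otimes>\<^sub>M lborel)"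
proof -
  have "continuous_on UNIV (\<lambda>z::real \<times> real. if i = (1::2) then fst z else snd z)" for i
    by (cases "i = 1") (simp_all add: continuous_intros)
  then have "continuous_on UNIV (\<lambda>z::real \<times> real. pt (fst z) (snd z))"
    unfolding pt_def by (rule continuous_on_vec_lambda)
  then have "(\<lambda>z::real \<times> real. pt (fst z) (snd z)) \<in> borel_measurable borel"
    by (rule borel_measurable_continuous_onI)
  then show ?thesis by (simp add: case_prod_beta' lborel_prod)
qed

text \<open>The passage from \<open>real^2\<close> to a binary product, on which Fubini's theorem is available.\<close>

lemma lborel_real2: "(lborel :: (real^2) measure) = distr (lborel \<Otimes>\<^sub>M lborel) borel (\<lambda>(x, t). pt x t)"
proof (rule lborel_eqI)
  let ?M = "distr (lborel \<Otimes>\<^sub>M lborel) borel (\<lambda>(x, t). pt x t)"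
  fix l u :: "real^2" assume le: "\<And>b. b \<in> Basis \<Longrightarrow> l \<bullet> b \<le> u \<bullet> b"
  have le': "l $ i \<le> u $ i" for i
    using le[of "axis i 1"] by (simp add: inner_axis axis_in_Basis_iff)
  have "(\<lambda>(x, t). pt x t) -` box l u = {l $ 1<..<u $ 1} \<times> {l $ 2<..<u $ 2}"
    by (auto simp: mem_box_cart forall_2 pt_def)
  then have "emeasure ?M (box l u)
      = emeasure (lborel \<Otimes>\<^sub>M lborel) ({l $ 1<..<u $ 1} \<times> {l $ 2<..<u $ 2})"
    by (subst emeasure_distr[OF pt_measurable]) (auto simp: space_pair_measure)
  also have "\<dots> = ennreal (u $ 1 - l $ 1) * ennreal (u $ 2 - l $ 2)"
    by (subst lborel.emeasure_pair_measure_Times) (auto simp: le')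
  also have "\<dots> = ennreal (\<Prod>b\<in>Basis. (u - l) \<bullet> b)"
  proof -
    have "(\<Prod>b\<in>Basis. (u - l) \<bullet> b) = (\<Prod>i\<in>UNIV. u $ i - l $ i)"
      by (simp add: Basis_vec_def UNION_singleton_eq_range prod.reindex inj_on_def axis_eq_axis inner_axis)
    then show ?thesis by (simp add: UNIV_2 ennreal_mult le')
  qed
  finally show "emeasure ?M (box l u)
      = ennreal (\<Prod>b\<in>Basis. (u - l) \<bullet> b)" .
qed simp


lemma cell_integral_iterated:
  fixes g :: "real^2 \<Rightarrow> complex"
  assumes g: "continuous_on UNIV g"
  shows "cell_integral g = (LINT x:{-pi<..pi}|lborel. LINT t:{-pi<..pi}|lborel. g (pt x t))"
    and "cell_integral g = (LINT t:{-pi<..pi}|lborel. LINT x:{-pi<..pi}|lborel. g (pt x t))"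
proof -
  define G where "G y = indicator cell y *\<^sub>R g y" for y
  define H where "H x t = indicator {-pi<..pi} x *\<^sub>R (indicator {-pi<..pi} t *\<^sub>R g (pt x t))" for x t
  have GH: "G (pt x t) = H x t" for x t
    by (auto simp: G_def H_def cell_def indicator_def forall_2)
  have "integrable lborel G"
    using integrable_cell[OF g] by (simp add: G_def[abs_def] set_integrable_def)
  then have int: "integrable (distr (lborel \<Otimes>\<^sub>M lborel) borel (\<lambda>(x, t). pt x t)) G"
    by (simp flip: lborel_real2)
  then have Gm: "G \<in> borel_measurable borel"
    using borel_measurable_integrable by fastforce
  have "integrable (lborel \<Otimes>\<^sub>M lborel) (\<lambda>z. G (case_prod pt z))"
    using integrable_distr[OF pt_measurable int] .
  then have int2: "integrable (lborel \<Otimes>\<^sub>M lborel) (case_prod H)"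
    by (simp add: GH case_prod_beta')
  have "cell_integral g = (\<integral>y. G y \<partial>lborel)"
    by (simp add: cell_integral_def set_lebesgue_integral_def G_def)
  also have "\<dots> = (\<integral>y. G y \<partial>distr (lborel \<Otimes>\<^sub>M lborel) borel (\<lambda>(x, t). pt x t))"
    by (simp flip: lborel_real2)
  also have "\<dots> = (\<integral>z. G (case_prod pt z) \<partial>(lborel \<Otimes>\<^sub>M lborel))"
    by (rule integral_distr[OF pt_measurable Gm])
  also have "\<dots> = (\<integral>z. case_prod H z \<partial>(lborel \<Otimes>\<^sub>M lborel))"
    by (simp add: GH case_prod_beta')
  finally have I: "cell_integral g = (\<integral>z. case_prod H z \<partial>(lborel \<Otimes>\<^sub>M lborel))" .
  from I show "cell_integral g = (LINT x:{-pi<..pi}|lborel. LINT t:{-pi<..pi}|lborel. g (pt x t))"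
    using lborel_pair.integral_fst'[OF int2] by (simp add: H_def set_lebesgue_integral_def del: scaleR_scaleR)
  have "H x t = indicator {-pi<..pi} t *\<^sub>R (indicator {-pi<..pi} x *\<^sub>R g (pt x t))" for x t
    by (simp add: H_def)
  with I show "cell_integral g = (LINT t:{-pi<..pi}|lborel. LINT x:{-pi<..pi}|lborel. g (pt x t))"
    using lborel_pair.integral_snd[OF int2] by (simp add: set_lebesgue_integral_def del: scaleR_scaleR)
qed

lemma integral_derivative_periodic:
  fixes h :: "real \<Rightarrow> complex"
  assumes h: "\<And>x. (h has_vector_derivative h' x) (at x)" "continuous_on UNIV h'" "h pi = h (- pi)"
  shows "(LINT x:{-pi<..pi}|lborel. h' x) = 0"
proof -
  have c: "continuous_on {-pi..pi} h'" using h(2) continuous_on_subset by blast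
  have "(\<integral>x. indicator {-pi..pi} x *\<^sub>R h' x \<partial>lborel) = h pi - h (- pi)"
    by (rule integral_FTC_Icc[OF _ has_vector_derivative_at_within[OF h(1)] c]) simp
  moreover have "(\<integral>x. indicator {-pi<..pi} x *\<^sub>R h' x \<partial>lborel) = (\<integral>x. indicator {-pi..pi} x *\<^sub>R h' x \<partial>lborel)"
  proof (rule integral_cong_AE)
    have "set_integrable lborel {-pi..pi} h'"
      unfolding set_integrable_def by (rule borel_integrable_compact[OF compact_Icc c])
    moreover from this have "set_integrable lborel {-pi<..pi} h'"
      by (rule set_integrable_subset) auto
    ultimately show "(\<lambda>x. indicator {-pi<..pi} x *\<^sub>R h' x) \<in> borel_measurable lborel"
      "(\<lambda>x. indicator {-pi..pi} x *\<^sub>R h' x) \<in> borel_measurable lborel"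
      unfolding set_integrable_def by (auto dest: borel_measurable_integrable)
    show "AE x in lborel. indicator {-pi<..pi} x *\<^sub>R h' x = indicator {-pi..pi} x *\<^sub>R h' x"
      using AE_lborel_singleton[of "- pi"] by eventually_elim (auto simp: indicator_def)
  qed
  ultimately show ?thesis using h(3) by (simp add: set_lebesgue_integral_def)
qed

lemma pd_line:
  assumes "g differentiable (at (y + s *\<^sub>R axis i 1))"
  shows "((\<lambda>s. g (y + s *\<^sub>R axis i 1)) has_vector_derivative pd i g (y + s *\<^sub>R axis i 1)) (at s)"
proof -
  note g = frechet_derivative_has_derivative[OF assms]
  have "((\<lambda>s. y + s *\<^sub>R axis i 1) has_derivative (\<lambda>h. h *\<^sub>R axis i 1)) (at s)"
    by (auto intro!: derivative_eq_intros)
  from has_derivative_compose[OF this g]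
  show ?thesis
    using has_derivative_linear[OF g] by (simp add: has_vector_derivative_def pd_def linear_scale)
qed

lemma pt_line: "pt x t = pt 0 t + x *\<^sub>R axis 1 1" "pt x t = pt x 0 + t *\<^sub>R axis 2 1"
  by (simp_all add: vec_eq_iff forall_2 axis_def)

lemma wrap_pt_pi: "wrap (pt pi t) = wrap (pt (- pi) t)" "wrap (pt x pi) = wrap (pt x (- pi))"
  by (simp_all add: wrap_def complex_eq_iff)

lemma continuous_on_pt: "continuous_on UNIV (\<lambda>x. pt x t)" "continuous_on UNIV (\<lambda>t. pt x t)"
proof -
  have "continuous_on UNIV (\<lambda>x. pt 0 t + x *\<^sub>R axis 1 1)" "continuous_on UNIV (\<lambda>t. pt x 0 + t *\<^sub>R axis 2 1)"
    by (intro continuous_intros)+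
  then show "continuous_on UNIV (\<lambda>x. pt x t)" "continuous_on UNIV (\<lambda>t. pt x t)"
    by (simp_all flip: pt_line)
qed

lemma pd_pt:
  assumes "g differentiable (at (pt x t))"
  shows "((\<lambda>x. g (pt x t)) has_vector_derivative pd 1 g (pt x t)) (at x)"
    "((\<lambda>t. g (pt x t)) has_vector_derivative pd 2 g (pt x t)) (at t)"
  using pd_line[of g "pt 0 t" x 1] pd_line[of g "pt x 0" t 2] assms by (simp_all flip: pt_line)

text \<open>Integrating first in the direction of the derivative leaves boundary terms that cancel by periodicity.\<close>

lemma cell_integral_pd:
  assumes g: "Ck_on 1 UNIV g" "periodic g"
  shows "cell_integral (pd i g) = 0"
proof -
  have d: "g differentiable (at y)" for y using g by simp
  have c: "continuous_on UNIV (pd i g)" for i using g(1) Ck_on_pd[of 0 UNIV g i] by simp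
  consider "i = 1" | "i = 2" using exhaust_2 by blast
  then show ?thesis
  proof cases
    case 1
    have "(LINT x:{-pi<..pi}|lborel. pd 1 g (pt x t)) = 0" for t
    proof (rule integral_derivative_periodic)
      show "((\<lambda>x. g (pt x t)) has_vector_derivative pd 1 g (pt x t)) (at x)" for x
        by (rule pd_pt[OF d])
      show "continuous_on UNIV (\<lambda>x. pd 1 g (pt x t))"
        by (rule continuous_on_compose2[OF c continuous_on_pt(1)]) simp
      show "g (pt pi t) = g (pt (- pi) t)" by (rule periodicD[OF g(2) wrap_pt_pi(1)])
    qed
    then show ?thesis using 1 by (simp add: cell_integral_iterated(2)[OF c])
  next
    case 2
    have "(LINT t:{-pi<..pi}|lborel. pd 2 g (pt x t)) = 0" for x
    proof (rule integral_derivative_periodic)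
      show "((\<lambda>t. g (pt x t)) has_vector_derivative pd 2 g (pt x t)) (at t)" for t
        by (rule pd_pt[OF d])
      show "continuous_on UNIV (\<lambda>t. pd 2 g (pt x t))"
        by (rule continuous_on_compose2[OF c continuous_on_pt(2)]) simp
      show "g (pt x pi) = g (pt x (- pi))" by (rule periodicD[OF g(2) wrap_pt_pi(2)])
    qed
    then show ?thesis using 2 by (simp add: cell_integral_iterated(1)[OF c])
  qed
qed

definition energy_density :: "(real^2 \<Rightarrow> complex) \<Rightarrow> (real^2 \<Rightarrow> complex) \<Rightarrow> real^2 \<Rightarrow> complex" where
  "energy_density w z y = pd 1 w y * cnj (pd 1 z y)
     + complex_of_real (weight y) * (pd 2 w y * cnj (pd 2 z y)) + w y * cnj (z y)"

lemma Ck_on_cweight: "Ck_on k UNIV (\<lambda>y. complex_of_real (weight y))"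
  by (rule smooth_on_imp_Ck[OF smooth_on_cweight])

lemma continuous_on_energy_density:
  assumes "Ck_on 1 UNIV w" "Ck_on 1 UNIV z"
  shows "continuous_on UNIV (energy_density w z)"
proof -
  have "continuous_on UNIV (pd i w)" "continuous_on UNIV (pd i z)" for i
    using assms Ck_on_pd[of 0 UNIV w i] Ck_on_pd[of 0 UNIV z i] by simp_all
  then show ?thesis
    unfolding energy_density_def[abs_def]
    by (intro continuous_intros assms[THEN Ck_on_imp_continuous_on]
        smooth_on_imp_continuous_on[OF smooth_on_weight])
qed

text \<open>The integrands differ by the divergence of the periodic field with components \<open>F 1\<close> and \<open>F 2\<close>. As the
  right-hand side is Hermitian in \<open>w\<close> and \<open>z\<close>, this identity yields both selfadjointness and coercivity.\<close>

lemma green_identity: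
  assumes w: "Ck_on 2 UNIV w" "periodic w" and z: "Ck_on 1 UNIV z" "periodic z"
  shows "cell_integral (\<lambda>y. plane_op w y * cnj (z y)) = cell_integral (energy_density w z)"
proof -
  let ?\<beta> = "\<lambda>y. complex_of_real (weight y)" and ?z = "\<lambda>y. cnj (z y)"
  have w1: "Ck_on 1 UNIV w" using w(1) Ck_on_lower[of 1 UNIV w] by (simp add: numeral_2_eq_2 del: Ck_on.simps)
  have dw: "Ck_on 1 UNIV (pd i w)" for i
    using w(1) Ck_on_pd[of 1 UNIV w i] by (simp add: numeral_2_eq_2 del: Ck_on.simps)
  have cz: "Ck_on 1 UNIV ?z" by (rule Ck_on_bounded_linear[OF bounded_linear_cnj z(1) open_UNIV])
  define F where "F i y = (if i = 1 then pd 1 w y else ?\<beta> y * pd 2 w y) * ?z y" for i :: 2 and y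
  have F: "Ck_on 1 UNIV (F i)" "periodic (F i)" for i
  proof -
    have "Ck_on 1 UNIV (\<lambda>y. if i = 1 then pd 1 w y else ?\<beta> y * pd 2 w y)"
      using dw Ck_on_mult[OF open_UNIV Ck_on_cweight dw] by (cases "i = 1") simp_all
    then show "Ck_on 1 UNIV (F i)" unfolding F_def[abs_def] by (rule Ck_on_mult[OF open_UNIV _ cz])
    have "periodic (\<lambda>y. if i = 1 then pd 1 w y else ?\<beta> y * pd 2 w y)"
      using periodic_pd[OF w(2)]
        periodic_comp2[OF periodic_comp[OF periodic_weight, of complex_of_real] periodic_pd[OF w(2)], of "(*)"]
      by (cases "i = 1") simp_all
    then show "periodic (F i)" unfolding F_def[abs_def]
      by (rule periodic_comp2[OF _ periodic_comp[OF z(2)], of _ "(*)"])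
  qed
  have dd: "f differentiable (at y)" if "Ck_on 1 UNIV f" for f :: "real^2 \<Rightarrow> complex" and y
    using that by simp
  have F1: "pd 1 (F 1) y = pd 1 w y * cnj (pd 1 z y) + pd 1 (pd 1 w) y * ?z y" for y
    unfolding F_def[abs_def] using pd_mult[OF dd[OF dw] dd[OF cz], of 1 1 y] pd_cnj[OF dd[OF z(1)]] by simp
  have F2: "pd 2 (F 2) y = ?\<beta> y * pd 2 w y * cnj (pd 2 z y) + pd 2 (\<lambda>y. ?\<beta> y * pd 2 w y) y * ?z y" for y
    unfolding F_def[abs_def]
    using pd_mult[OF dd[OF Ck_on_mult[OF open_UNIV Ck_on_cweight dw]] dd[OF cz], of 2 2 y] pd_cnj[OF dd[OF z(1)]] by simp
  have cF: "continuous_on UNIV (pd i (F i))" for i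
    using F(1)[of i] Ck_on_pd[of 0 UNIV "F i" i] by simp
  have "plane_op w y * ?z y = energy_density w z y + (- 1) * (pd 1 (F 1) y + pd 2 (F 2) y)" for y
    unfolding F1 F2 plane_op_def energy_density_def by (simp add: algebra_simps)
  then have "cell_integral (\<lambda>y. plane_op w y * ?z y)
    = cell_integral (\<lambda>y. energy_density w z y + (- 1) * (pd 1 (F 1) y + pd 2 (F 2) y))" by presburger
  also have "\<dots> = cell_integral (energy_density w z) + cell_integral (\<lambda>y. (- 1) * (pd 1 (F 1) y + pd 2 (F 2) y))"
    by (intro cell_integral_add continuous_on_energy_density[OF w1 z(1)] continuous_intros cF)
  also have "cell_integral (\<lambda>y. (- 1) * (pd 1 (F 1) y + pd 2 (F 2) y))
    = (- 1) * (cell_integral (pd 1 (F 1)) + cell_integral (pd 2 (F 2)))"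
    unfolding cell_integral_cmult cell_integral_add[OF cF cF] ..
  finally show ?thesis by (simp add: cell_integral_pd[OF F])
qed

definition jdet :: "(complex \<times> complex, 2) chart \<Rightarrow> real^2 \<Rightarrow> real" where
  "jdet C y = jac C 1 y $ 1 * jac C 2 y $ 2 - jac C 2 y $ 1 * jac C 1 y $ 2"

lemma det_jac: "det (matrix (\<lambda>v. \<Sum>i\<in>UNIV. v $ i *\<^sub>R jac C i y)) = jdet C y"
  by (simp add: det_2 matrix_def sum_2 axis_def jdet_def)

lemma jdet_nonzero:
  assumes "C \<in> torus_atlas" "wrap y \<in> cdom C"
  shows "jdet C y \<noteq> 0"
  using det_nz_iff_inj[OF has_derivative_linear[OF jac_derivative[OF assms]]]
    coord_wrap_derivative_inj[OF assms] by (simp add: det_jac)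

lemma smooth_on_density:
  assumes C: "C \<in> torus_atlas"
  shows "smooth_on (cimg C) (\<lambda>x. inverse \<bar>jdet C (unwrap 0 (param C x))\<bar>)"
proof (rule smooth_on_periodic_param[OF C])
  note o = open_wrap_cdom[OF C]
  have s: "smooth_on (wrap -` cdom C) (\<lambda>y. jdet C y)"
    unfolding jdet_def
    by (intro smooth_on_diff smooth_on_mult smooth_on_vec_nth o smooth_on_jac[OF C])
  have s': "smooth_on (wrap -` cdom C) (\<lambda>y. \<bar>jdet C y\<bar>)"
    by (rule smooth_on_compose[OF o _ s smooth_on_abs]) (use jdet_nonzero[OF C] in auto)
  show "smooth_on (wrap -` cdom C) (\<lambda>y. inverse \<bar>jdet C y\<bar>)"
    by (rule smooth_on_compose[OF o _ s' smooth_on_inverse]) (use jdet_nonzero[OF C] in auto)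
  have "jdet C y = jdet C y'" if "wrap y = wrap y'" for y y'
    using periodicD[OF periodic_jac[of C] that] by (simp add: jdet_def)
  then show "periodic (\<lambda>y. inverse \<bar>jdet C y\<bar>)" unfolding periodic_def by metis
qed

text \<open>The density in the chart \<open>C\<close> is the reciprocal of the Jacobian determinant of \<open>coord C \<circ> wrap\<close>. With this
  choice the change of variables turns the integral of the density over \<open>B\<close> into the integral of \<open>1\<close> over the part
  \<open>Y\<close> of the cell that lies above \<open>B\<close>.\<close>

lemma smooth_measure_torus: "smooth_measure torus_top torus_atlas torus_measure"
  unfolding smooth_measure_def
proof (intro conjI ballI)
  show "sets torus_measure = sigma_sets (topspace torus_top) {U. openin torus_top U}"
    by (simp add: sets_torus_measure)
  fix C assume C: "C \<in> torus_atlas"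
  note ch = torus_atlas_chart[OF C]
  define \<rho> where "\<rho> x = inverse \<bar>jdet C (unwrap 0 (param C x))\<bar>" for x
  let ?\<Phi> = "\<lambda>y. coord C (wrap y)"
  have sm: "smooth_on (cimg C) \<rho>" using smooth_on_density[OF C] by (simp add: \<rho>_def[abs_def])
  have pos: "0 < \<rho> x" if "x \<in> cimg C" for x
    using jdet_nonzero[OF C, of "unwrap 0 (param C x)"] param_in_cdom[OF that]
    by (simp add: \<rho>_def wrap_unwrap_param[OF C that])
  have vol: "emeasure torus_measure {p \<in> cdom C. coord C p \<in> B} = (\<integral>\<^sup>+x\<in>B. ennreal (\<rho> x) \<partial>lborel)"
    if B: "B \<in> sets borel" "B \<subseteq> cimg C" for B
  proof -
    let ?S = "{p \<in> cdom C. coord C p \<in> B}"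
    define Y where "Y = wrap -` ?S \<inter> cell"
    have oC: "openin torus_top (cdom C)" using ch by (simp add: is_chart_def)
    have "continuous_map (subtopology torus_top (cdom C)) (top_of_set (cimg C)) (coord C)"
      using ch by (auto simp: is_chart_def intro: homeomorphic_imp_continuous_map)
    then have cC: "continuous_on (cdom C) (coord C)"
      using torus_atlas_cdom[OF C] by (simp add: subtopology_subtopology Int_absorb1 continuous_map_in_subtopology)
    have bor: "torus \<in> sets borel" using compact_torus by (simp add: borel_compact)
    obtain O' where "open O'" "cdom C = torus \<inter> O'" using oC by (auto simp: openin_open)
    then have Cb: "cdom C \<in> sets borel" using bor by auto
    have "coord C -` B \<inter> space (restrict_space borel (cdom C)) \<in> sets (restrict_space borel (cdom C))"
      by (rule measurable_sets[OF borel_measurable_continuous_on_restrict[OF cC] B(1)])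
    moreover have "coord C -` B \<inter> space (restrict_space borel (cdom C)) = ?S"
      by (auto simp: space_restrict_space)
    ultimately have "?S \<in> sets borel" using Cb by (simp add: sets_restrict_space_iff)
    then have S: "?S \<in> sets (restrict_space borel torus)"
      using bor torus_atlas_cdom[OF C] by (auto simp: sets_restrict_space_iff)
    have Y1: "wrap -` ?S \<inter> space (restrict_space lborel cell) = Y"
      by (auto simp: Y_def space_restrict_space)
    have "Y \<in> sets (restrict_space lborel cell)"
      using measurable_sets[OF wrap_measurable S] Y1 by simp
    then have Yb: "Y \<in> sets lborel" using cell_in_borel by (auto simp: sets_restrict_space_iff)
    have "emeasure torus_measure ?S = emeasure (restrict_space lborel cell) Y"
      unfolding torus_measure_def by (subst emeasure_distr[OF wrap_measurable S]) (simp only: Y1)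
    also have "\<dots> = emeasure lborel Y"
      by (rule emeasure_restrict_space) (use cell_in_borel in \<open>auto simp: Y_def\<close>)
    finally have em: "emeasure torus_measure ?S = emeasure lborel Y" .
    have YP: "wrap y \<in> cdom C" if "y \<in> Y" for y using that by (simp add: Y_def)
    have fin: "emeasure lborel Y < \<infinity>"
    proof -
      have "emeasure lborel Y \<le> emeasure lborel (cbox (\<chi> i. - pi) (\<chi> i. pi) :: (real^2) set)"
        by (rule emeasure_mono) (use cell_subset_cbox in \<open>auto simp: Y_def\<close>)
      then show ?thesis using emeasure_lborel_cbox_finite le_less_trans by blast
    qed
    have Yl: "Y \<in> lmeasurable" using fin Yb by (auto simp: fmeasurable_def)
    have Yleb: "Y \<in> sets lebesgue" using Yl by auto
    have img: "?\<Phi> ` Y = B"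
    proof (intro equalityI subsetI)
      fix x assume x: "x \<in> B"
      then have xc: "x \<in> cimg C" using B by auto
      note w = wrap_unwrap_param[OF C xc]
      have "unwrap 0 (param C x) \<in> Y"
        using w param_in_cdom[OF xc] coord_param[OF xc] x torus_atlas_cdom[OF C]
        by (auto simp: Y_def intro!: unwrap_in_cell)
      moreover have "x = ?\<Phi> (unwrap 0 (param C x))" by (simp add: w coord_param[OF xc])
      ultimately show "x \<in> ?\<Phi> ` Y" by blast
    qed (auto simp: Y_def)
    have inj: "inj_on ?\<Phi> Y"
    proof (rule inj_onI)
      fix y y' assume y: "y \<in> Y" "y' \<in> Y" "?\<Phi> y = ?\<Phi> y'"
      then have "wrap y = wrap y'" using inj_onD[OF chart_inj[OF ch]] YP by blast
      then show "y = y'" using inj_onD[OF inj_on_wrap_cell] y by (auto simp: Y_def)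
    qed
    have one: "\<bar>jdet C y\<bar> * \<rho> (?\<Phi> y) = 1" if "y \<in> Y" for y
    proof -
      have "unwrap 0 (param C (?\<Phi> y)) = y"
        using that YP[OF that] cell_iff_unwrap by (simp add: param_coord[OF ch] Y_def)
      then show ?thesis using jdet_nonzero[OF C YP[OF that]] by (simp add: \<rho>_def)
    qed
    let ?m = "measure lebesgue Y"
    have cov: "(\<lambda>y. \<bar>jdet C y\<bar> *\<^sub>R (vec (\<rho> (?\<Phi> y)) :: real^1)) absolutely_integrable_on Y \<and>
        integral Y (\<lambda>y. \<bar>jdet C y\<bar> *\<^sub>R (vec (\<rho> (?\<Phi> y)) :: real^1)) = vec ?m
      \<longleftrightarrow> (\<lambda>x. vec (\<rho> x) :: real^1) absolutely_integrable_on B \<and> integral B (\<lambda>x. vec (\<rho> x) :: real^1) = vec ?m"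
      using has_absolute_integral_change_of_variables[OF Yleb
          has_derivative_at_withinI[OF jac_derivative[OF C YP]] inj, of "\<lambda>x. vec (\<rho> x) :: real^1" "vec ?m"]
      by (simp add: img det_jac)
    have v1: "\<bar>jdet C y\<bar> *\<^sub>R (vec (\<rho> (?\<Phi> y)) :: real^1) = vec 1" if "y \<in> Y" for y
      using one[OF that] by (simp add: vec_eq_iff)
    have "(\<lambda>y. vec 1 :: real^1) absolutely_integrable_on Y"
      using Yl by (simp add: absolutely_integrable_on_const)
    moreover have "integral Y (\<lambda>y. vec 1 :: real^1) = vec ?m"
      using lmeasure_integral[OF Yl] by (simp add: integral_on_1_eq)
    ultimately have "(\<lambda>x. vec (\<rho> x) :: real^1) absolutely_integrable_on B \<and> integral B (\<lambda>x. vec (\<rho> x) :: real^1) = vec ?m"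
      using cov set_integrable_cong[where A = Y and M = lebesgue, OF refl refl v1]
        Henstock_Kurzweil_Integration.integral_cong[where s = Y, OF v1] by simp
    then have "\<rho> absolutely_integrable_on B" "integral B \<rho> = ?m"
      by (auto simp: absolutely_integrable_on_1_iff integral_on_1_eq vec_eq_iff)
    then have "(\<rho> has_integral ?m) B"
      using set_lebesgue_integral_eq_integral(1) integrable_integral by metis
    then have hi: "((\<lambda>x. \<rho> x * indicator B x) has_integral ?m) UNIV"
      using has_integral_restrict_UNIV[of B \<rho> ?m] unfolding indicator_def by (simp add: of_bool_def if_distrib cong: if_cong)
    have "(\<lambda>x. indicator B x *\<^sub>R \<rho> x) \<in> borel_measurable borel"
      by (rule borel_measurable_continuous_on_indicator[OF _ continuous_on_subset[OF smooth_on_imp_continuous_on[OF sm] B(2)]])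
        (use B(1) in simp)
    then have "(\<lambda>x. \<rho> x * indicator B x) \<in> borel_measurable borel" by (simp add: mult.commute)
    moreover have "0 \<le> \<rho> x * indicator B x" for x
      using pos[of x] B(2) by (auto simp: indicator_def less_imp_le)
    ultimately
    have "(\<integral>\<^sup>+x. ennreal (\<rho> x * indicator B x) \<partial>lborel) = ennreal ?m"
      using nn_integral_has_integral_lborel[OF _ _ hi] by blast
    moreover have "ennreal (\<rho> x * indicator B x) = ennreal (\<rho> x) * indicator B x" for x
      by (simp add: indicator_def)
    moreover have "ennreal ?m = emeasure lborel Y"
      using fin Yb by (simp add: emeasure_eq_ennreal_measure less_top[symmetric])
    ultimately show ?thesis using em by simp
  qed
  show "\<exists>\<rho>. smooth_on (cimg C) \<rho> \<and> (\<forall>x\<in>cimg C. 0 < \<rho> x) \<and>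
        (\<forall>B\<in>sets borel. B \<subseteq> cimg C \<longrightarrow>
           emeasure torus_measure {p \<in> cdom C. coord C p \<in> B} = (\<integral>\<^sup>+x\<in>B. ennreal (\<rho> x) \<partial>lborel))"
    using sm pos vol by blast
qed


section \<open>Selfadjointness, coercivity and ellipticity\<close>

lemma torus_green:
  assumes u: "Ck_fun torus_atlas 2 u" and v: "Ck_fun torus_atlas 1 v"
  shows "(\<integral>p. torus_op u p * cnj (v p) \<partial>torus_measure)
    = cell_integral (energy_density (\<lambda>y. u (wrap y)) (\<lambda>y. v (wrap y)))"
proof -
  have w: "Ck_on 2 UNIV (\<lambda>y. u (wrap y))" "Ck_on 1 UNIV (\<lambda>y. v (wrap y))"
    using u v by (simp_all only: Ck_fun_torus)
  have "continuous_on UNIV (\<lambda>y. torus_op u (wrap y) * cnj (v (wrap y)))"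
    unfolding torus_op_wrap
    by (intro continuous_intros continuous_on_plane_op[OF w(1)] Ck_on_imp_continuous_on[OF w(2)])
  then have "(\<integral>p. torus_op u p * cnj (v p) \<partial>torus_measure)
      = cell_integral (\<lambda>y. torus_op u (wrap y) * cnj (v (wrap y)))"
    by (rule integral_torus)
  also have "\<dots> = cell_integral (\<lambda>y. plane_op (\<lambda>y. u (wrap y)) y * cnj (v (wrap y)))"
    unfolding torus_op_wrap ..
  also have "\<dots> = cell_integral (energy_density (\<lambda>y. u (wrap y)) (\<lambda>y. v (wrap y)))"
    by (rule green_identity[OF w(1) _ w(2)]) simp_all
  finally show ?thesis .
qed

lemma energy_density_cnj: "cnj (energy_density w z y) = energy_density z w y"
  by (simp add: energy_density_def mult.commute)

lemma smooth_fun_imp_Ck_fun: "smooth_fun A u \<Longrightarrow> Ck_fun A k u"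
  by (simp add: smooth_fun_def Ck_fun_def smooth_on_imp_Ck)

lemma integral_cnj_swap:
  "(\<integral>p. u p * cnj (v p) \<partial>M) = cnj (\<integral>p. v p * cnj (u p) \<partial>M)" for u v :: "'a \<Rightarrow> complex"
  by (subst Bochner_Integration.integral_cnj[symmetric]) (simp add: mult.commute)

lemma formally_selfadjoint_torus_op: "formally_selfadjoint torus_atlas torus_measure torus_op"
  unfolding formally_selfadjoint_def formal_adjoint_def
proof (intro conjI allI impI second_order_operator_torus_op)
  fix u v assume "smooth_fun torus_atlas u \<and> smooth_fun torus_atlas v"
  then have u: "Ck_fun torus_atlas k u" and v: "Ck_fun torus_atlas k v" for k
    by (auto intro: smooth_fun_imp_Ck_fun)
  have "(\<integral>p. u p * cnj (torus_op v p) \<partial>torus_measure) = cnj (\<integral>p. torus_op v p * cnj (u p) \<partial>torus_measure)"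
    by (rule integral_cnj_swap)
  also have "\<dots> = (\<integral>p. torus_op u p * cnj (v p) \<partial>torus_measure)"
    unfolding torus_green[OF u v] torus_green[OF v u] cell_integral_cnj[symmetric] energy_density_cnj ..
  finally show "(\<integral>p. torus_op u p * cnj (v p) \<partial>torus_measure) = (\<integral>p. u p * cnj (torus_op v p) \<partial>torus_measure)"
    by simp
qed

lemma Re_energy_density: "(cmod (w y))\<^sup>2 \<le> Re (energy_density w w y)"
  by (simp add: energy_density_def complex_norm_square[symmetric] weight_nonneg del: of_real_power)

lemma torus_energy_ge:
  assumes u: "Ck_fun torus_atlas 2 u"
  shows "(\<integral>p. (cmod (u p))\<^sup>2 \<partial>torus_measure) \<le> Re (\<integral>p. torus_op u p * cnj (u p) \<partial>torus_measure)"
proof -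
  let ?w = "\<lambda>y. u (wrap y)"
  have w2: "Ck_on 2 UNIV ?w" using u by (simp only: Ck_fun_torus)
  have w1: "Ck_on 1 UNIV ?w" using Ck_on_lower[of 1 UNIV ?w] w2 by (simp add: numeral_2_eq_2 del: Ck_on.simps)
  have u1: "Ck_fun torus_atlas 1 u" using w1 by (simp only: Ck_fun_torus)
  have c: "continuous_on UNIV (\<lambda>y. (cmod (?w y))\<^sup>2)"
    by (intro continuous_intros Ck_on_imp_continuous_on[OF w2])
  note ce = continuous_on_energy_density[OF w1 w1]
  have cR: "continuous_on UNIV (\<lambda>y. Re (energy_density ?w ?w y))" by (intro continuous_intros ce)
  show ?thesis
    unfolding torus_green[OF u u1] integral_torus[OF c] cell_integral_Re[OF ce]
    by (rule cell_integral_mono[OF c cR Re_energy_density])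
qed

text \<open>The zeroth-order term of the operator bounds the energy from below by the square of the \<open>L\<^sup>2\<close> norm, and
  \<open>2 Re (Lu cnj u) \<le> |Lu|\<^sup>2 + |u|\<^sup>2\<close> pointwise.\<close>

lemma torus_op_L2_bound:
  assumes u: "Ck_fun torus_atlas 2 u"
  shows "L2norm torus_measure u \<le> 1 * L2norm torus_measure (torus_op u)"
proof -
  let ?w = "\<lambda>y. u (wrap y)"
  have w2: "Ck_on 2 UNIV ?w" using u by (simp only: Ck_fun_torus)
  have cw: "continuous_on UNIV ?w" by (rule Ck_on_imp_continuous_on[OF w2])
  have cL: "continuous_on UNIV (\<lambda>y. torus_op u (wrap y))"
    unfolding torus_op_wrap by (rule continuous_on_plane_op[OF w2])
  have c1: "continuous_on UNIV (\<lambda>y. (cmod (?w y))\<^sup>2)" by (intro continuous_intros cw)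
  have c2: "continuous_on UNIV (\<lambda>y. (cmod (torus_op u (wrap y)))\<^sup>2)" by (intro continuous_intros cL)
  have c3: "continuous_on UNIV (\<lambda>y. torus_op u (wrap y) * cnj (?w y))" by (intro continuous_intros cL cw)
  have pw: "Re (torus_op u (wrap y) * cnj (?w y)) \<le> (1/2) * ((cmod (torus_op u (wrap y)))\<^sup>2 + (cmod (?w y))\<^sup>2)" for y
  proof -
    have "Re (torus_op u (wrap y) * cnj (?w y)) \<le> cmod (torus_op u (wrap y)) * cmod (?w y)"
      using complex_Re_le_cmod[of "torus_op u (wrap y) * cnj (?w y)"] by (simp add: norm_mult)
    then show ?thesis
      using sum_squares_bound[of "cmod (torus_op u (wrap y))" "cmod (?w y)"] by simp
  qed
  have "(\<integral>p. (cmod (u p))\<^sup>2 \<partial>torus_measure) \<le> cell_integral (\<lambda>y. Re (torus_op u (wrap y) * cnj (?w y)))"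
    using torus_energy_ge[OF u] unfolding integral_torus[OF c3] cell_integral_Re[OF c3] .
  also have "\<dots> \<le> cell_integral (\<lambda>y. (1/2) * ((cmod (torus_op u (wrap y)))\<^sup>2 + (cmod (?w y))\<^sup>2))"
    by (rule cell_integral_mono[OF _ _ pw]) (intro continuous_intros cL cw)+
  also have "\<dots> = (1/2) * (cell_integral (\<lambda>y. (cmod (torus_op u (wrap y)))\<^sup>2) + cell_integral (\<lambda>y. (cmod (?w y))\<^sup>2))"
    unfolding cell_integral_cmult_real cell_integral_add[OF c2 c1] ..
  finally have "(\<integral>p. (cmod (u p))\<^sup>2 \<partial>torus_measure) \<le> (\<integral>p. (cmod (torus_op u p))\<^sup>2 \<partial>torus_measure)"
    unfolding integral_torus[OF c1] integral_torus[OF c2] by simp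
  then show ?thesis by (simp add: L2norm_def)
qed

text \<open>Where \<open>Im (snd p) = sin (y $ 2)\<close> does not vanish, the first summand of the weight is positive.\<close>

lemma elliptic_set_dense:
  defines "W \<equiv> {p \<in> torus. Im (snd p) \<noteq> 0}"
  shows "openin torus_top W" "torus_top closure_of W = torus" "\<forall>p\<in>W. elliptic_at torus_atlas torus_op p"
proof -
  have "open {p :: complex \<times> complex. Im (snd p) \<noteq> 0}"
    by (intro open_Collect_neq continuous_intros)
  then show "openin torus_top W" by (auto simp: W_def openin_open)
  show "\<forall>p\<in>W. elliptic_at torus_atlas torus_op p"
  proof
    fix p assume p: "p \<in> W"
    define y where "y = unwrap 0 p"
    have py: "wrap y = p" using p by (simp add: W_def y_def wrap_unwrap)
    then have "sin (y $ 2) \<noteq> 0" using p by (auto simp: W_def wrap_def)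
    then have "0 < 4 * (sin (y $ 2))\<^sup>2" by simp
    then have "0 < weight y" unfolding weight_def flat_def by (simp add: add_pos_nonneg)
    then show "elliptic_at torus_atlas torus_op p" using elliptic_at_torus_op[of y] py by simp
  qed
  have "p \<in> closure W" if p: "p \<in> torus" for p
  proof (cases "p \<in> W")
    case True
    then show ?thesis using closure_subset by blast
  next
    case False
    define y where "y = unwrap 0 p"
    have py: "wrap y = p" using p by (simp add: y_def wrap_unwrap)
    then have s0: "sin (y $ 2) = 0" using False p by (auto simp: W_def wrap_def)
    then have c0: "cos (y $ 2) \<noteq> 0" using sin_cos_squared_add[of "y $ 2"] by auto
    let ?f = "\<lambda>s. wrap (y + s *\<^sub>R axis 2 1)"
    have "?f s \<in> W" if "s \<in> {0<..<1}" for s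
    proof -
      have "0 < sin s" by (rule sin_gt_zero) (use that pi_gt3 in auto)
      then have "sin (y $ 2 + s) \<noteq> 0" using s0 c0 by (simp add: sin_add)
      then have "Im (snd (?f s)) \<noteq> 0" by (simp add: wrap_def axis_def)
      then show ?thesis by (simp add: W_def)
    qed
    then have "?f ` {0<..<1} \<subseteq> closure W" using closure_subset by blast
    moreover have "continuous_on (closure {0<..<1}) ?f"
      by (rule continuous_on_compose2[OF continuous_on_wrap[of UNIV]]) (auto intro!: continuous_intros)
    ultimately have "?f ` closure {0<..<1} \<subseteq> closure W"
      using image_closure_subset[of "{0<..<1}" ?f "closure W"] by blast
    moreover have "(0::real) \<in> closure {0<..<1}" by simp
    ultimately have "?f 0 \<in> closure W" by blast
    then show ?thesis using py by simp
  qed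
  moreover have "torus_top closure_of W = torus \<inter> closure (torus \<inter> W)"
    by (simp add: closure_of_subtopology)
  moreover have "torus \<inter> W = W" by (auto simp: W_def)
  ultimately show "torus_top closure_of W = torus" by auto
qed


section \<open>Subunit paths\<close>

text \<open>Although \<open>K\<close> need not be convex, local Lipschitz bounds on a compact set combine to a global one.\<close>

lemma smooth_on_compact_lipschitz:
  fixes \<Phi> :: "'a::euclidean_space \<Rightarrow> 'a"
  assumes P: "open P" and \<Phi>: "smooth_on P \<Phi>" and K: "compact K" "K \<subseteq> P"
  obtains L where "L-lipschitz_on K \<Phi>"
proof -
  define F where "F = (\<lambda>(t::real, x). Blinfun (frechet_derivative \<Phi> (at x)))"
  have D: "(\<Phi> has_derivative frechet_derivative \<Phi> (at x)) (at x)" if "x \<in> P" for x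
    by (intro frechet_derivative_has_derivative smooth_on_imp_differentiable[OF \<Phi> that])
  have ap: "blinfun_apply (F (t, x)) = frechet_derivative \<Phi> (at x)" if "x \<in> P" for t x
    using has_derivative_bounded_linear[OF D[OF that]] by (simp add: F_def bounded_linear_Blinfun_apply)
  have "local_lipschitz UNIV P (\<lambda>t::real. \<Phi>)"
  proof (rule c1_implies_local_lipschitz[OF _ _ open_UNIV P])
    show "(\<Phi> has_derivative blinfun_apply (F (t, x))) (at x)" if "x \<in> P" for t x
      using D[OF that] by (simp add: ap[OF that])
    show "continuous_on (UNIV \<times> P) F"
    proof (rule continuous_on_blinfun_componentwise)
      fix i :: 'a
      have "continuous_on P (\<lambda>x. frechet_derivative \<Phi> (at x) i)"
        by (rule smooth_on_imp_continuous_on[OF smooth_on_frechet_derivative[OF \<Phi>]])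
      then have "continuous_on (UNIV \<times> P) (\<lambda>z::real \<times> 'a. frechet_derivative \<Phi> (at (snd z)) i)"
        by (rule continuous_on_compose2) (auto intro: continuous_intros)
      then show "continuous_on (UNIV \<times> P) (\<lambda>z. blinfun_apply (F z) i)"
        by (rule continuous_on_eq) (auto simp: ap)
    qed
  qed
  then have ll: "local_lipschitz {0} K (\<lambda>t::real. \<Phi>)"
    by (rule local_lipschitz_subset) (use K in auto)
  obtain L where "\<And>t. t \<in> {0::real} \<Longrightarrow> L-lipschitz_on K \<Phi>"
    by (rule local_lipschitz_compact_implies_lipschitz[OF ll K(1) compact_sing]) auto
  then show ?thesis using that by blast
qed

text \<open>For a lifted path the subunit condition only involves the diagonal symbol. It passes to every chart because
  the velocity and the symbol are pushed forward by the same Jacobian matrix. The finite set \<open>N\<close> is there for the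
  corners of the path.\<close>

lemma subunit_pathI:
  assumes R: "0 \<le> R" and lip: "M-lipschitz_on {0..R} \<eta>" and N: "finite N"
    and sub: "\<And>s. s \<in> {0..R} - N \<Longrightarrow> \<exists>e. (\<eta> has_vector_derivative e) (at s) \<and>
        (\<forall>c. (\<Sum>i\<in>UNIV. e $ i * c i)\<^sup>2 \<le> (\<Sum>i\<in>UNIV. diag_weight i (\<eta> s) * (c i)\<^sup>2))"
  shows "subunit_path torus_top torus_atlas torus_op R (\<lambda>s. wrap (\<eta> s))"
proof -
  have c\<eta>: "continuous_on {0..R} \<eta>" by (rule lipschitz_on_continuous_on[OF lip])
  have "lipschitz_path torus_top torus_atlas R (\<lambda>s. wrap (\<eta> s))"
    unfolding lipschitz_path_def
  proof (intro conjI ballI allI impI)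
    have "continuous_on {0..R} (\<lambda>s. wrap (\<eta> s))"
      by (rule continuous_on_compose2[OF continuous_on_wrap[of UNIV] c\<eta>]) auto
    then show "continuous_map (top_of_set {0..R}) torus_top (\<lambda>s. wrap (\<eta> s))"
      by (simp add: continuous_map_in_subtopology image_subset_iff)
    fix C s t assume C: "C \<in> torus_atlas"
      and st: "0 \<le> s \<and> s \<le> t \<and> t \<le> R \<and> (\<lambda>s. wrap (\<eta> s)) ` {s..t} \<subseteq> cdom C"
    have sub: "{s..t} \<subseteq> {0..R}" using st by auto
    have "compact (\<eta> ` {s..t})"
      by (intro compact_continuous_image continuous_on_subset[OF c\<eta> sub] compact_Icc)
    moreover have "\<eta> ` {s..t} \<subseteq> wrap -` cdom C" using st by auto
    ultimately obtain L where "L-lipschitz_on (\<eta> ` {s..t}) (\<lambda>y. coord C (wrap y))"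
      using smooth_on_compact_lipschitz[OF open_wrap_cdom[OF C] smooth_on_coord_wrap[OF C]] by blast
    then have "(L * M)-lipschitz_on {s..t} (\<lambda>s. coord C (wrap (\<eta> s)))"
      by (rule lipschitz_on_compose2[OF lipschitz_on_subset[OF lip sub]])
    then show "\<exists>K. K-lipschitz_on {s..t} (coord C \<circ> (\<lambda>s. wrap (\<eta> s)))"
      by (auto simp: o_def)
  qed
  moreover have "AE s in lebesgue. s \<in> {0..R} \<longrightarrow>
        (\<forall>C\<in>torus_atlas. wrap (\<eta> s) \<in> cdom C \<longrightarrow>
           (\<exists>a v. real_principal_part torus_atlas torus_op C a \<and>
              ((coord C \<circ> (\<lambda>s. wrap (\<eta> s))) has_vector_derivative v) (at s within {0..R}) \<and>
              (\<forall>\<xi>. (v \<bullet> \<xi>)\<^sup>2 \<le> \<xi> \<bullet> (a (coord C (wrap (\<eta> s))) *v \<xi>))))"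
  proof -
    have "N \<in> null_sets lebesgue" using N negligible_finite negligible_iff_null_sets by blast
    then have "AE s in lebesgue. s \<notin> N" by (rule AE_not_in)
    then show ?thesis
    proof (rule eventually_mono, intro impI ballI)
      fix s C assume s: "s \<notin> N" "s \<in> {0..R}" and C: "C \<in> torus_atlas" and y: "wrap (\<eta> s) \<in> cdom C"
      obtain e where e: "(\<eta> has_vector_derivative e) (at s)"
        "\<And>c. (\<Sum>i\<in>UNIV. e $ i * c i)\<^sup>2 \<le> (\<Sum>i\<in>UNIV. diag_weight i (\<eta> s) * (c i)\<^sup>2)"
        using sub[of s] s by auto
      let ?v = "\<Sum>i\<in>UNIV. e $ i *\<^sub>R jac C i (\<eta> s)"
      have "((\<lambda>s. coord C (wrap (\<eta> s))) has_derivative (\<lambda>h. \<Sum>i\<in>UNIV. (h *\<^sub>R e) $ i *\<^sub>R jac C i (\<eta> s))) (at s)"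
        by (rule has_derivative_compose[OF e(1)[unfolded has_vector_derivative_def] jac_derivative[OF C y]])
      then have "((coord C \<circ> (\<lambda>s. wrap (\<eta> s))) has_vector_derivative ?v) (at s)"
        by (simp add: has_vector_derivative_def o_def scaleR_sum_right)
      then have v: "((coord C \<circ> (\<lambda>s. wrap (\<eta> s))) has_vector_derivative ?v) (at s within {0..R})"
        by (rule has_vector_derivative_at_within)
      have "symb C (unwrap 0 (wrap (\<eta> s))) = symb C (\<eta> s)"
        by (rule periodic_unwrap[OF periodic_symb_real])
      then have "(?v \<bullet> \<xi>)\<^sup>2 \<le> \<xi> \<bullet> (symb C (unwrap 0 (param C (coord C (wrap (\<eta> s))))) *v \<xi>)" for \<xi>
        using e(2)[of "\<lambda>i. jac C i (\<eta> s) \<bullet> \<xi>"] y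
        by (simp add: param_coord[OF torus_atlas_chart[OF C]] symb_quadratic inner_sum_left)
      with v real_principal_part_torus_op[OF C]
      show "\<exists>a v. real_principal_part torus_atlas torus_op C a \<and>
              ((coord C \<circ> (\<lambda>s. wrap (\<eta> s))) has_vector_derivative v) (at s within {0..R}) \<and>
              (\<forall>\<xi>. (v \<bullet> \<xi>)\<^sup>2 \<le> \<xi> \<bullet> (a (coord C (wrap (\<eta> s))) *v \<xi>))"
        by blast
    qed
  qed
  ultimately show ?thesis using R by (simp add: subunit_path_def)
qed

text \<open>On the circle where the flat term is largest, the second coordinate may be traversed with speed \<open>1 / 2\<close>.\<close>

lemma weight_at_pi: "1 / 4 \<le> weight (pt pi t)"
proof -
  have "exp (1::real) \<le> 3" by (rule exp_le)
  then have "inverse 4 \<le> inverse (exp (1::real))" by (intro le_imp_inverse_le) auto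
  then have "1 / 4 \<le> flat 0 1" by (simp add: flat_def exp_minus inverse_eq_divide)
  then show ?thesis by (simp add: weight_def add_increasing)
qed

text \<open>The path moves in the first coordinate until it equals \<open>pi\<close>, then along the circle just described,
  and then again in the first coordinate. Away from that circle it only uses the first coordinate, whose coefficient
  is \<open>1\<close> everywhere. The lift of the endpoint is moved by a full period in both coordinates, so that neither coordinate
  ever has to decrease.\<close>

lemma subunit_path_exists:
  assumes p: "p \<in> torus" and q: "q \<in> torus"
  shows "\<exists>R \<gamma>. subunit_path torus_top torus_atlas torus_op R \<gamma> \<and> \<gamma> 0 = p \<and> \<gamma> R = q"
proof -
  define y0 where "y0 = unwrap 0 p"
  define y1 where "y1 = unwrap 0 q"
  have cell: "y0 \<in> cell" "y1 \<in> cell" using p q by (simp_all add: y0_def y1_def unwrap_in_cell)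
  define x0 t0 x1 t1 where "x0 = y0 $ 1" and "t0 = y0 $ 2" and "x1 = y1 $ 1 + 2 * pi" and "t1 = y1 $ 2 + 2 * pi"
  have le: "x0 \<le> pi" "pi \<le> x1" "t0 \<le> t1"
    using cell by (auto simp: cell_def x0_def x1_def t0_def t1_def forall_2)
  have w0: "wrap (pt x0 t0) = p" using wrap_unwrap[OF p, of 0] by (simp add: x0_def t0_def y0_def pt_eta)
  have "wrap (pt x1 t1) = wrap y1"
    by (simp add: wrap_def x1_def t1_def complex_eq_iff)
  then have w1: "wrap (pt x1 t1) = q" using wrap_unwrap[OF q, of 0] by (simp add: y1_def)
  \<comment> \<open>The times at which the path turns, and its end; the middle part takes twice as long as its length.\<close>
  define s1 s2 R where "s1 = pi - x0" and "s2 = s1 + 2 * (t1 - t0)" and "R = s2 + (x1 - pi)"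
  have s: "0 \<le> s1" "s1 \<le> s2" "s2 \<le> R" using le by (auto simp: s1_def s2_def R_def)
  define xc where "xc s = min (x0 + s) pi + max 0 (s - s2)" for s
  define tc where "tc s = t0 + max 0 (min ((s - s1) / 2) (t1 - t0))" for s
  define \<eta> where "\<eta> s = pt (xc s) (tc s)" for s
  have "3-lipschitz_on {0..R} \<eta>"
  proof (rule lipschitz_onI)
    fix r s
    have "\<bar>xc r - xc s\<bar> \<le> 2 * \<bar>r - s\<bar>" "\<bar>tc r - tc s\<bar> \<le> \<bar>r - s\<bar>"
      by (auto simp: xc_def tc_def min_def max_def abs_if field_simps)
    moreover have "norm (\<eta> r - \<eta> s) \<le> \<bar>xc r - xc s\<bar> + \<bar>tc r - tc s\<bar>"
      using norm_le_l1_cart[of "\<eta> r - \<eta> s"] by (simp add: sum_2 \<eta>_def)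
    ultimately show "dist (\<eta> r) (\<eta> s) \<le> 3 * dist r s" by (simp add: dist_norm)
  qed simp
  moreover have "\<exists>e. (\<eta> has_vector_derivative e) (at s) \<and>
      (\<forall>c. (\<Sum>i\<in>UNIV. e $ i * c i)\<^sup>2 \<le> (\<Sum>i\<in>UNIV. diag_weight i (\<eta> s) * (c i)\<^sup>2))"
    if sR: "s \<in> {0..R} - {0, s1, s2, R}" for s
  proof -
    have horizontal: ?thesis if S: "open S" "s \<in> S" and line: "\<And>r. r \<in> S \<Longrightarrow> \<eta> r = a + r *\<^sub>R axis 1 1" for S a
    proof (intro exI conjI allI)
      have "((\<lambda>r. a + r *\<^sub>R axis 1 1) has_vector_derivative axis 1 1) (at s)"
        by (auto intro!: derivative_eq_intros simp: has_vector_derivative_def)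
      then show "(\<eta> has_vector_derivative axis 1 1) (at s)"
        by (rule has_vector_derivative_transform_within_open[OF _ S]) (simp add: line)
      show "(\<Sum>i\<in>UNIV. (axis 1 1 :: real^2) $ i * c i)\<^sup>2 \<le> (\<Sum>i\<in>UNIV. diag_weight i (\<eta> s) * (c i)\<^sup>2)" for c
        by (simp add: sum_2 axis_def diag_weight_def weight_nonneg)
    qed
    consider "s < s1" | "s1 < s" "s < s2" | "s2 < s" using sR by force
    then show ?thesis
    proof cases
      case 1
      have "\<eta> r = pt x0 t0 + r *\<^sub>R axis 1 1" if "r \<in> {..<s1}" for r
        using that s le by (auto simp: \<eta>_def xc_def tc_def s1_def vec_eq_iff forall_2 axis_def min_def max_def)
      then show ?thesis using 1 by (intro horizontal[of "{..<s1}"]) auto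
    next
      case 3
      have "\<eta> r = pt (pi - s2) t1 + r *\<^sub>R axis 1 1" if "r \<in> {s2<..}" for r
        using that s le by (auto simp: \<eta>_def xc_def tc_def s1_def s2_def vec_eq_iff forall_2 axis_def min_def max_def field_simps)
      then show ?thesis using 3 by (intro horizontal[of "{s2<..}"]) auto
    next
      case 2
      have line: "\<eta> r = pt pi (t0 - s1 / 2) + r *\<^sub>R ((1 / 2) *\<^sub>R axis 2 1)" if "r \<in> {s1<..<s2}" for r
        using that s le by (auto simp: \<eta>_def xc_def tc_def s1_def s2_def vec_eq_iff forall_2 axis_def min_def max_def field_simps)
      have "((\<lambda>r. pt pi (t0 - s1 / 2) + r *\<^sub>R ((1 / 2) *\<^sub>R axis 2 1)) has_vector_derivative ((1 / 2) *\<^sub>R axis 2 1)) (at s)"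
        by (auto intro!: derivative_eq_intros simp: has_vector_derivative_def)
      then have d: "(\<eta> has_vector_derivative ((1 / 2) *\<^sub>R axis 2 1)) (at s)"
        by (rule has_vector_derivative_transform_within_open[of _ _ _ "{s1<..<s2}"]) (use 2 line in auto)
      have "xc s = pi" using 2 s by (auto simp: xc_def s1_def min_def max_def)
      then have "1 / 4 \<le> weight (\<eta> s)" using weight_at_pi by (simp add: \<eta>_def)
      then have "(c 2)\<^sup>2 / 4 \<le> weight (\<eta> s) * (c 2)\<^sup>2" for c :: "2 \<Rightarrow> real"
        using mult_right_mono[of "1/4" "weight (\<eta> s)" "(c 2)\<^sup>2"] by simp
      then have "(\<Sum>i\<in>UNIV. ((1 / 2) *\<^sub>R axis 2 1 :: real^2) $ i * c i)\<^sup>2 \<le> (\<Sum>i\<in>UNIV. diag_weight i (\<eta> s) * (c i)\<^sup>2)" for c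
        by (simp add: sum_2 axis_def diag_weight_def power_divide add_increasing)
      with d show ?thesis by blast
    qed
  qed
  ultimately have "subunit_path torus_top torus_atlas torus_op R (\<lambda>s. wrap (\<eta> s))"
    using s by (intro subunit_pathI[where M = 3 and N = "{0, s1, s2, R}"]) auto
  moreover have "\<eta> 0 = pt x0 t0" "\<eta> R = pt x1 t1"
    using s le by (auto simp: \<eta>_def xc_def tc_def s1_def s2_def R_def min_def max_def vec_eq_iff forall_2 field_simps)
  ultimately show ?thesis using w0 w1 by (intro exI[of _ R] exI[of _ "\<lambda>s. wrap (\<eta> s)"]) simp
qed


section \<open>Weak solutions from minimising sequences\<close>

text \<open>The Riesz representation theorem without completeness: a minimising sequence of
  \<open>Re (B u u) - 2 Re (l u)\<close> plays the role of the representing vector. It is Cauchy for \<open>B\<close> by the parallelogram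
  law, and along it the first variation \<open>B (v n) \<psi> - l \<psi>\<close> tends to zero, since otherwise a short step in the direction
  \<open>\<psi>\<close> would fall below the infimum.\<close>

lemma minimizing_sequence:
  fixes V :: "('a \<Rightarrow> complex) set" and B :: "('a \<Rightarrow> complex) \<Rightarrow> ('a \<Rightarrow> complex) \<Rightarrow> complex"
  assumes V0: "u0 \<in> V"
    and lin: "\<And>u v c. u \<in> V \<Longrightarrow> v \<in> V \<Longrightarrow> (\<lambda>x. u x + c * v x) \<in> V"
    and B_lin: "\<And>u v w c. u \<in> V \<Longrightarrow> v \<in> V \<Longrightarrow> w \<in> V \<Longrightarrow> B (\<lambda>x. u x + c * v x) w = B u w + c * B v w"
    and B_herm: "\<And>u v. u \<in> V \<Longrightarrow> v \<in> V \<Longrightarrow> B v u = cnj (B u v)"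
    and l_lin: "\<And>u v c. u \<in> V \<Longrightarrow> v \<in> V \<Longrightarrow> l (\<lambda>x. u x + c * v x) = l u + cnj c * l v"
    and B_pos: "\<And>u. u \<in> V \<Longrightarrow> 0 \<le> Re (B u u)"
    and low: "\<And>u. u \<in> V \<Longrightarrow> K \<le> Re (B u u) - 2 * Re (l u)"
  obtains v where "\<And>n. v n \<in> V"
    and "\<And>\<psi>. \<psi> \<in> V \<Longrightarrow> (\<lambda>n. B (v n) \<psi>) \<longlonglongrightarrow> l \<psi>"
    and "\<And>m n. Re (B (\<lambda>x. v m x - v n x) (\<lambda>x. v m x - v n x)) \<le> 2 * (1 / Suc m + 1 / Suc n)"
proof -
  define J where "J u = Re (B u u) - 2 * Re (l u)" for u
  have expand: "J (\<lambda>x. u x + c * v x) = J u + 2 * Re (cnj c * (B u v - l v)) + (cmod c)\<^sup>2 * Re (B v v)"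
    if u: "u \<in> V" and v: "v \<in> V" for u v c
  proof -
    let ?s = "\<lambda>x. u x + c * v x"
    have s: "?s \<in> V" using lin[OF u v] .
    have "B ?s ?s = B u ?s + c * B v ?s" by (rule B_lin[OF u v s])
    also have "B u ?s = cnj (B u u + c * B v u)" using B_herm[OF s u] B_lin[OF u v u] by simp
    also have "B v ?s = cnj (B u v + c * B v v)" using B_herm[OF s v] B_lin[OF u v v] by simp
    also have "B v u = cnj (B u v)" by (rule B_herm[OF u v])
    finally have "Re (B ?s ?s) = Re (B u u) + 2 * Re (cnj c * B u v) + (cmod c)\<^sup>2 * Re (B v v)"
      unfolding cmod_power2 by (simp add: algebra_simps power2_eq_square)
    then show ?thesis by (simp add: J_def l_lin[OF u v] algebra_simps)
  qed
  define \<mu> where "\<mu> = Inf (J ` V)"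
  have bdd: "bdd_below (J ` V)" by (rule bdd_belowI2[of V K]) (simp add: J_def low)
  have ge: "\<mu> \<le> J u" if "u \<in> V" for u unfolding \<mu>_def by (rule cInf_lower[OF imageI[OF that] bdd])
  have "\<exists>u\<in>V. J u < \<mu> + 1 / Suc n" for n
  proof -
    have "\<mu> < \<mu> + 1 / Suc n" by simp
    then show ?thesis unfolding \<mu>_def using cInf_lessD[of "J ` V"] V0 by blast
  qed
  then obtain v where v: "\<And>n. v n \<in> V" and Jv: "\<And>n. J (v n) < \<mu> + 1 / Suc n" by metis
  have conv: "(\<lambda>n. B (v n) \<psi>) \<longlonglongrightarrow> l \<psi>" if \<psi>: "\<psi> \<in> V" for \<psi>
  proof -
    define \<beta> where "\<beta> = Re (B \<psi> \<psi>)"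
    \<comment> \<open>Short enough for the quadratic term to undo at most half of the linear decrease.\<close>
    define s where "s = 1 / (\<beta> + 1)"
    have \<beta>: "0 \<le> \<beta>" using B_pos[OF \<psi>] by (simp add: \<beta>_def)
    have s: "0 < s" "s * \<beta> \<le> 1" using \<beta> by (simp_all add: s_def field_simps)
    have bound: "(cmod (B (v n) \<psi> - l \<psi>))\<^sup>2 \<le> (\<beta> + 1) * (1 / Suc n)" for n
    proof -
      define r where "r = B (v n) \<psi> - l \<psi>"
      \<comment> \<open>The step \<open>- s r \<psi>\<close> decreases \<open>J\<close> by at least \<open>s |r|\<^sup>2\<close>, but no more than \<open>1 / Suc n\<close> is left.\<close>
      have "\<mu> \<le> J (\<lambda>x. v n x + complex_of_real (- s) * r * \<psi> x)"
        by (rule ge[OF lin[OF v \<psi>]])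
      also have "\<dots> = J (v n) + 2 * Re (cnj (complex_of_real (- s) * r) * r) + (cmod (complex_of_real (- s) * r))\<^sup>2 * \<beta>"
        unfolding expand[OF v \<psi>] by (simp add: r_def \<beta>_def)
      also have "cnj (complex_of_real (- s) * r) * r = complex_of_real (- s * (cmod r)\<^sup>2)"
        using complex_norm_square[of r] by (simp add: mult_ac)
      also have "(cmod (complex_of_real (- s) * r))\<^sup>2 = s\<^sup>2 * (cmod r)\<^sup>2"
        by (simp add: norm_mult power_mult_distrib)
      finally have 1: "2 * s * (cmod r)\<^sup>2 \<le> 1 / Suc n + s\<^sup>2 * (cmod r)\<^sup>2 * \<beta>"
        using Jv[of n] by simp
      have "s\<^sup>2 * (cmod r)\<^sup>2 * \<beta> = (s * \<beta>) * (s * (cmod r)\<^sup>2)" by (simp add: power2_eq_square)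
      also have "\<dots> \<le> 1 * (s * (cmod r)\<^sup>2)" by (rule mult_right_mono[OF s(2)]) (use s in simp)
      finally have "s * (cmod r)\<^sup>2 \<le> 1 / Suc n" using 1 by simp
      then have "(\<beta> + 1) * (s * (cmod r)\<^sup>2) \<le> (\<beta> + 1) * (1 / Suc n)"
        using \<beta> by (intro mult_left_mono) auto
      moreover have "(\<beta> + 1) * (s * (cmod r)\<^sup>2) = (cmod r)\<^sup>2" using \<beta> by (simp add: s_def)
      ultimately have "(cmod r)\<^sup>2 \<le> (\<beta> + 1) * (1 / Suc n)" by (simp only:)
      then show ?thesis by (simp only: r_def)
    qed
    have lim0: "(\<lambda>n. (\<beta> + 1) * (1 / Suc n)) \<longlonglongrightarrow> 0"
      using tendsto_mult_right_zero[OF LIMSEQ_inverse_real_of_nat, of "\<beta> + 1"] by (simp add: inverse_eq_divide)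
    have "(\<lambda>n. (cmod (B (v n) \<psi> - l \<psi>))\<^sup>2) \<longlonglongrightarrow> 0"
      by (rule tendsto_sandwich[OF _ _ tendsto_const lim0]) (simp, intro always_eventually allI bound)
    then have "(\<lambda>n. sqrt ((cmod (B (v n) \<psi> - l \<psi>))\<^sup>2)) \<longlonglongrightarrow> sqrt 0" by (rule tendsto_real_sqrt)
    then have "(\<lambda>n. cmod (B (v n) \<psi> - l \<psi>)) \<longlonglongrightarrow> 0" by simp
    then have "(\<lambda>n. B (v n) \<psi> - l \<psi>) \<longlonglongrightarrow> 0" by (rule tendsto_norm_zero_cancel)
    then show ?thesis by (rule LIM_zero_cancel)
  qed
  have cauchy: "Re (B (\<lambda>x. v m x - v n x) (\<lambda>x. v m x - v n x)) \<le> 2 * (1 / Suc m + 1 / Suc n)" for m n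
  proof -
    define d where "d = (\<lambda>x. v m x - v n x)"
    have d: "d \<in> V" using lin[OF v v, of m "-1" n] by (simp add: d_def)
    have "\<mu> \<le> J (\<lambda>x. v n x + complex_of_real (1 / 2) * d x)" by (rule ge[OF lin[OF v d]])
    also have "\<dots> = J (v n) + Re (B (v n) d - l d) + Re (B d d) / 4"
      unfolding expand[OF v d] by (simp add: power_divide norm_divide)
    finally have 1: "\<mu> \<le> J (v n) + Re (B (v n) d - l d) + Re (B d d) / 4" .
    have "J (v m) = J (\<lambda>x. v n x + 1 * d x)" by (simp add: d_def)
    also have "\<dots> = J (v n) + 2 * Re (B (v n) d - l d) + Re (B d d)"
      unfolding expand[OF v d] by simp
    finally have 2: "J (v m) = J (v n) + 2 * Re (B (v n) d - l d) + Re (B d d)" .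
    define a b where "a = 1 / real (Suc m)" and "b = 1 / real (Suc n)"
    have "Re (B d d) \<le> 2 * (a + b)"
    proof -
      have arith: "D \<le> 2 * (a + b)"
        if "\<mu> \<le> p + x + D / 4" "q = p + 2 * x + D" "q < \<mu> + a" "p < \<mu> + b" for D x p q :: real
        using that by (simp add: field_simps)
      show ?thesis
        by (rule arith[OF 1 2]) (use Jv[of m] Jv[of n] in \<open>simp_all only: a_def b_def\<close>)
    qed
    then show ?thesis unfolding d_def a_def b_def .
  qed
  show ?thesis by (rule that[OF v conv cauchy])
qed

definition energy :: "(complex \<times> complex \<Rightarrow> complex) \<Rightarrow> (complex \<times> complex \<Rightarrow> complex) \<Rightarrow> complex" where
  "energy u v = cell_integral (energy_density (\<lambda>y. u (wrap y)) (\<lambda>y. v (wrap y)))"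

lemma Ck_of_smooth_fun: "smooth_fun torus_atlas u \<Longrightarrow> Ck_on k UNIV (\<lambda>y. u (wrap y))"
  unfolding smooth_fun_torus by (rule smooth_on_imp_Ck)

lemma continuous_of_smooth_fun: "smooth_fun torus_atlas u \<Longrightarrow> continuous_on UNIV (\<lambda>y. u (wrap y))"
  unfolding smooth_fun_torus by (rule smooth_on_imp_continuous_on)

lemma energy_eq: "smooth_fun torus_atlas u \<Longrightarrow> smooth_fun torus_atlas v \<Longrightarrow>
    (\<integral>p. torus_op u p * cnj (v p) \<partial>torus_measure) = energy u v"
  unfolding energy_def by (rule torus_green) (auto intro: smooth_fun_imp_Ck_fun)

lemma smooth_fun_lin: "smooth_fun torus_atlas u \<Longrightarrow> smooth_fun torus_atlas v \<Longrightarrow>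
    smooth_fun torus_atlas (\<lambda>p. u p + c * v p)"
  unfolding smooth_fun_torus by (intro smooth_on_add smooth_on_mult smooth_on_const open_UNIV)

lemma smooth_fun_mult: "smooth_fun torus_atlas u \<Longrightarrow> smooth_fun torus_atlas v \<Longrightarrow>
    smooth_fun torus_atlas (\<lambda>p. u p * v p)"
  unfolding smooth_fun_torus by (intro smooth_on_mult open_UNIV)

lemma smooth_fun_cnj: "smooth_fun torus_atlas u \<Longrightarrow> smooth_fun torus_atlas (\<lambda>p. cnj (u p))"
  unfolding smooth_fun_torus by (rule smooth_on_bounded_linear[OF bounded_linear_cnj _ open_UNIV])

lemma energy_lin:
  assumes u: "smooth_fun torus_atlas u" and v: "smooth_fun torus_atlas v" and w: "smooth_fun torus_atlas w"
  shows "energy (\<lambda>p. u p + c * v p) w = energy u w + c * energy v w"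
proof -
  let ?u = "\<lambda>y. u (wrap y)" and ?v = "\<lambda>y. v (wrap y)" and ?w = "\<lambda>y. w (wrap y)"
  have d: "?u differentiable (at y)" "?v differentiable (at y)" for y
    using u v smooth_on_imp_differentiable unfolding smooth_fun_torus by blast+
  have d': "(\<lambda>y. c * ?v y) differentiable (at y)" for y
    using d(2)[of y] by (auto simp: differentiable_def intro: has_derivative_mult_right)
  have "pd i (\<lambda>y. ?u y + c * ?v y) y = pd i ?u y + c * pd i ?v y" for i y
    unfolding pd_add[OF d(1) d'] pd_cmult[OF d(2)] ..
  then have eq: "energy_density (\<lambda>y. ?u y + c * ?v y) ?w = (\<lambda>y. energy_density ?u ?w y + c * energy_density ?v ?w y)"
    by (simp add: energy_density_def fun_eq_iff algebra_simps)
  have ce: "continuous_on UNIV (energy_density ?u ?w)" "continuous_on UNIV (energy_density ?v ?w)"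
    by (intro continuous_on_energy_density Ck_of_smooth_fun u v w)+
  then have "continuous_on UNIV (\<lambda>y. c * energy_density ?v ?w y)" by (intro continuous_intros)
  then show ?thesis
    unfolding energy_def eq by (simp add: cell_integral_add[OF ce(1)] cell_integral_cmult)
qed

lemma energy_herm: "energy v u = cnj (energy u v)"
  unfolding energy_def cell_integral_cnj[symmetric] energy_density_cnj ..

lemma energy_ge:
  assumes u: "smooth_fun torus_atlas u"
  shows "cell_integral (\<lambda>y. (cmod (u (wrap y)))\<^sup>2) \<le> Re (energy u u)"
proof -
  note ce = continuous_on_energy_density[OF Ck_of_smooth_fun[OF u] Ck_of_smooth_fun[OF u]]
  show ?thesis
    unfolding energy_def cell_integral_Re[OF ce]
    by (rule cell_integral_mono) (auto intro!: continuous_intros continuous_of_smooth_fun[OF u] ce Re_energy_density)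
qed

text \<open>The Cauchy-Schwarz inequality in additive form, from \<open>|d \<phi>| \<le> |d|\<^sup>2 / (2 \<delta>) + \<delta> |\<phi>|\<^sup>2 / 2\<close>.\<close>

lemma cell_integral_product_bound:
  fixes d \<phi> :: "real^2 \<Rightarrow> complex"
  assumes cd: "continuous_on UNIV d" and c\<phi>: "continuous_on UNIV \<phi>"
    and D: "cell_integral (\<lambda>y. (cmod (d y))\<^sup>2) \<le> \<delta>\<^sup>2" and A: "cell_integral (\<lambda>y. (cmod (\<phi> y))\<^sup>2) \<le> A" and \<delta>: "0 < \<delta>"
  shows "cmod (cell_integral (\<lambda>y. d y * \<phi> y)) \<le> \<delta> * (1 + A) / 2"
proof -
  have cd2: "continuous_on UNIV (\<lambda>y. (1 / (2 * \<delta>)) * (cmod (d y))\<^sup>2)"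
    and c\<phi>2: "continuous_on UNIV (\<lambda>y. (\<delta> / 2) * (cmod (\<phi> y))\<^sup>2)"
    by (intro continuous_intros cd c\<phi>)+
  have pw: "cmod (d y * \<phi> y) \<le> (1 / (2 * \<delta>)) * (cmod (d y))\<^sup>2 + (\<delta> / 2) * (cmod (\<phi> y))\<^sup>2" for y
  proof -
    have "0 \<le> (cmod (d y) - \<delta> * cmod (\<phi> y))\<^sup>2 / (2 * \<delta>)" using \<delta> by simp
    also have "\<dots> = (1 / (2 * \<delta>)) * (cmod (d y))\<^sup>2 + (\<delta> / 2) * (cmod (\<phi> y))\<^sup>2 - cmod (d y) * cmod (\<phi> y)"
      using \<delta> by (simp add: power2_eq_square field_simps)
    finally show ?thesis by (simp add: norm_mult)
  qed
  have "cmod (cell_integral (\<lambda>y. d y * \<phi> y)) \<le> cell_integral (\<lambda>y. cmod (d y * \<phi> y))"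
    by (intro norm_cell_integral_le continuous_intros cd c\<phi>)
  also have "\<dots> \<le> cell_integral (\<lambda>y. (1 / (2 * \<delta>)) * (cmod (d y))\<^sup>2 + (\<delta> / 2) * (cmod (\<phi> y))\<^sup>2)"
    by (rule cell_integral_mono[OF _ continuous_on_add[OF cd2 c\<phi>2] pw]) (intro continuous_intros cd c\<phi>)
  also have "\<dots> = (1 / (2 * \<delta>)) * cell_integral (\<lambda>y. (cmod (d y))\<^sup>2) + (\<delta> / 2) * cell_integral (\<lambda>y. (cmod (\<phi> y))\<^sup>2)"
    unfolding cell_integral_add[OF cd2 c\<phi>2] cell_integral_cmult_real ..
  also have "\<dots> \<le> (1 / (2 * \<delta>)) * \<delta>\<^sup>2 + (\<delta> / 2) * A"
    using \<delta> D A by (intro add_mono mult_left_mono) auto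
  also have "\<dots> = \<delta> * (1 + A) / 2" using \<delta> by (simp add: power2_eq_square field_simps)
  finally show ?thesis .
qed

text \<open>The four squares of side \<open>pi\<close> centred at the points with coordinates \<open>0\<close> or \<open>pi\<close> lie in windows, and their
  images cover the torus.\<close>

lemma uniform_null_seq:
  assumes f: "smooth_null_seq torus_atlas f" and e: "0 < e"
  shows "\<forall>\<^sub>F n in sequentially. \<forall>y. cmod (f n (wrap y)) < e"
proof -
  let ?K = "\<lambda>a b. cbox (pt (a - pi/2) (b - pi/2)) (pt (a + pi/2) (b + pi/2))"
  have ev: "\<forall>\<^sub>F n in sequentially. \<forall>x\<in>?K a b. cmod (f n (wrap x)) < e" for a b
  proof -
    let ?C = "window_chart (pt a b)"
    have K: "?K a b \<subseteq> window (pt a b)"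
    proof
      fix x assume "x \<in> ?K a b"
      then have "\<bar>x $ 1 - a\<bar> \<le> pi / 2" "\<bar>x $ 2 - b\<bar> \<le> pi / 2"
        unfolding mem_box_cart forall_2 pt_nth by linarith+
      then have "\<bar>x $ i - pt a b $ i\<bar> \<le> pi / 2" for i
        using exhaust_2[of i] by auto
      moreover have "pi / 2 < pi" using pi_gt_zero by simp
      ultimately show "x \<in> window (pt a b)"
        unfolding window_def mem_Collect_eq by (blast intro: le_less_trans)
    qed
    then have "uniform_limit (?K a b) (\<lambda>n. fold pd [] (f n \<circ> param ?C)) (\<lambda>_. 0) sequentially"
      using f window_chart_in_atlas[of "pt a b"] unfolding smooth_null_seq_def
      by (metis cimg_window_chart compact_cbox)
    from uniform_limitD[OF this e]
    show ?thesis
    proof (rule eventually_mono, intro ballI)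
      fix n x assume a: "\<forall>x\<in>?K a b. dist (fold pd [] (f n \<circ> param ?C) x) 0 < e" and x: "x \<in> ?K a b"
      have px: "param ?C x = wrap x" by (rule param_window_chart) (use K x in blast)
      have "dist (fold pd [] (f n \<circ> param ?C) x) 0 < e" using a x by blast
      then show "cmod (f n (wrap x)) < e" by (simp add: dist_norm px)
    qed
  qed
  have shift: "\<exists>c\<in>{0, pi}. \<exists>b. c - pi / 2 \<le> b \<and> b \<le> c + pi / 2 \<and> cis b = cis a" if "- pi < a" "a \<le> pi" for a
  proof -
    consider "\<bar>a\<bar> \<le> pi / 2" | "pi / 2 < a" | "a < - pi / 2" by linarith
    then show ?thesis
    proof cases
      case 1 then show ?thesis by (intro bexI[of _ 0] exI[of _ a]) auto
    next
      case 2 then show ?thesis using that by (intro bexI[of _ pi] exI[of _ a]) auto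
    next
      case 3 then show ?thesis using that
        by (intro bexI[of _ pi] exI[of _ "a + 2 * pi"]) (auto simp: complex_eq_iff)
    qed
  qed
  have "\<forall>\<^sub>F n in sequentially. \<forall>a\<in>{0, pi}. \<forall>b\<in>{0, pi}. \<forall>x\<in>?K a b.
      cmod (f n (wrap x)) < e"
    by (intro eventually_ball_finite ballI ev) auto
  then show ?thesis
  proof (rule eventually_mono, intro allI)
    fix n and y :: "real^2"
    assume a: "\<forall>a\<in>{0, pi}. \<forall>b\<in>{0, pi}. \<forall>x\<in>?K a b. cmod (f n (wrap x)) < e"
    let ?z = "unwrap 0 (wrap y)"
    have "?z \<in> cell" by (rule unwrap_in_cell) simp
    then have z1: "- pi < ?z $ i" and z2: "?z $ i \<le> pi" for i by (simp_all add: cell_def)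
    obtain a1 b1 where 1: "a1 \<in> {0, pi}" "a1 - pi / 2 \<le> b1" "b1 \<le> a1 + pi / 2" "cis b1 = cis (?z $ 1)"
      using shift[OF z1[of 1] z2[of 1]] by blast
    obtain a2 b2 where 2: "a2 \<in> {0, pi}" "a2 - pi / 2 \<le> b2" "b2 \<le> a2 + pi / 2" "cis b2 = cis (?z $ 2)"
      using shift[OF z1[of 2] z2[of 2]] by blast
    have "wrap (pt b1 b2) = wrap ?z" using 1 2 by (simp add: wrap_def)
    moreover have "wrap ?z = wrap y" by (rule wrap_unwrap) simp
    moreover have "pt b1 b2 \<in> ?K a1 a2"
      using 1 2 by (simp add: mem_box_cart forall_2)
    ultimately show "cmod (f n (wrap y)) < e" using a 1(1) 2(1) by metis
  qed
qed

text \<open>The limit of an \<open>L\<^sup>2\<close> Cauchy sequence of smooth functions is taken as a functional on test functions; the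
  \<open>L\<^sup>2\<close> bound of the sequence makes it a distribution.\<close>

lemma weak_limit_distribution:
  fixes v :: "nat \<Rightarrow> complex \<times> complex \<Rightarrow> complex"
  assumes v: "\<And>n. smooth_fun torus_atlas (v n)"
    and cauchy: "\<And>m n. cell_integral (\<lambda>y. (cmod (v m (wrap y) - v n (wrap y)))\<^sup>2) \<le> 2 * (1 / Suc m + 1 / Suc n)"
  defines "T \<equiv> \<lambda>\<phi>. lim (\<lambda>n. \<integral>p. v n p * \<phi> p \<partial>torus_measure)"
  shows "distribution torus_atlas T"
    and "\<And>\<phi>. smooth_fun torus_atlas \<phi> \<Longrightarrow> (\<lambda>n. \<integral>p. v n p * \<phi> p \<partial>torus_measure) \<longlonglongrightarrow> T \<phi>"
proof -
  let ?I = "\<lambda>n \<phi>. \<integral>p. v n p * \<phi> p \<partial>torus_measure"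
  have int: "(\<integral>p. u p * \<phi> p \<partial>torus_measure) = cell_integral (\<lambda>y. u (wrap y) * \<phi> (wrap y))"
    if "smooth_fun torus_atlas u" "smooth_fun torus_atlas \<phi>" for u \<phi>
    using integral_torus[OF continuous_of_smooth_fun[OF smooth_fun_mult[OF that]]] .
  note c = continuous_of_smooth_fun
  show lim: "(\<lambda>n. ?I n \<phi>) \<longlonglongrightarrow> T \<phi>" if \<phi>: "smooth_fun torus_atlas \<phi>" for \<phi>
  proof -
    define A where "A = cell_integral (\<lambda>y. (cmod (\<phi> (wrap y)))\<^sup>2)"
    have A: "0 \<le> A" unfolding A_def by (rule cell_integral_nonneg) simp
    have "Cauchy (\<lambda>n. ?I n \<phi>)"
    proof (rule CauchyI)
      fix e :: real assume e: "0 < e"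
      define \<delta> where "\<delta> = e / (1 + A)"
      have \<delta>: "0 < \<delta>" using e A by (simp add: \<delta>_def)
      obtain N where N: "4 / \<delta>\<^sup>2 < real N" using reals_Archimedean2 by blast
      have small: "1 / real (Suc m) \<le> \<delta>\<^sup>2 / 4" if "N \<le> m" for m
      proof -
        have "4 / \<delta>\<^sup>2 \<le> real (Suc m)" using N that by linarith
        then show ?thesis using \<delta> by (simp add: field_simps)
      qed
      show "\<exists>M. \<forall>m\<ge>M. \<forall>n\<ge>M. norm (?I m \<phi> - ?I n \<phi>) < e"
      proof (intro exI allI impI)
        fix m n assume mn: "N \<le> m" "N \<le> n"
        let ?d = "\<lambda>y. v m (wrap y) - v n (wrap y)"
        have cd: "continuous_on UNIV ?d" by (intro continuous_intros c v)
        have "cell_integral (\<lambda>y. (cmod (?d y))\<^sup>2) \<le> \<delta>\<^sup>2"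
        proof (rule order_trans[OF cauchy])
          have "2 * (1 / real (Suc m) + 1 / real (Suc n)) \<le> 2 * (\<delta>\<^sup>2 / 4 + \<delta>\<^sup>2 / 4)"
            by (intro mult_left_mono add_mono small mn) simp
          then show "2 * (1 / real (Suc m) + 1 / real (Suc n)) \<le> \<delta>\<^sup>2" by simp
        qed
        from cell_integral_product_bound[OF cd c[OF \<phi>] this order.refl \<delta>]
        have "cmod (cell_integral (\<lambda>y. ?d y * \<phi> (wrap y))) \<le> e / 2"
          using A by (simp add: \<delta>_def A_def[symmetric])
        moreover have "cell_integral (\<lambda>y. v m (wrap y) * \<phi> (wrap y))
            = cell_integral (\<lambda>y. ?d y * \<phi> (wrap y) + v n (wrap y) * \<phi> (wrap y))"
          by (simp add: algebra_simps)
        moreover have "\<dots> = cell_integral (\<lambda>y. ?d y * \<phi> (wrap y)) + cell_integral (\<lambda>y. v n (wrap y) * \<phi> (wrap y))"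
          by (intro cell_integral_add continuous_intros c v \<phi>)
        ultimately show "norm (?I m \<phi> - ?I n \<phi>) < e"
          using e unfolding int[OF v \<phi>] by simp
      qed
    qed
    then show ?thesis unfolding T_def by (simp add: Cauchy_convergent_iff convergent_LIMSEQ_iff)
  qed
  have Teq: "T \<phi> = a" if "smooth_fun torus_atlas \<phi>" "(\<lambda>n. ?I n \<phi>) \<longlonglongrightarrow> a" for \<phi> a
    using LIMSEQ_unique[OF lim[OF that(1)] that(2)] .
  define S where "S = 2 * cell_integral (\<lambda>y. (cmod (v 0 (wrap y)))\<^sup>2) + 8"
  have vS: "cell_integral (\<lambda>y. (cmod (v n (wrap y)))\<^sup>2) \<le> S" for n
  proof -
    let ?d = "\<lambda>y. v n (wrap y) - v 0 (wrap y)"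
    have pw: "(cmod (v n (wrap y)))\<^sup>2 \<le> 2 * (cmod (v 0 (wrap y)))\<^sup>2 + 2 * (cmod (?d y))\<^sup>2" for y
    proof -
      have "cmod (v n (wrap y)) \<le> cmod (v 0 (wrap y)) + cmod (?d y)"
        using norm_triangle_ineq[of "v 0 (wrap y)" "?d y"] by simp
      then have "(cmod (v n (wrap y)))\<^sup>2 \<le> (cmod (v 0 (wrap y)) + cmod (?d y))\<^sup>2" by (intro power_mono) auto
      then show ?thesis
        using sum_squares_bound[of "cmod (v 0 (wrap y))" "cmod (?d y)"] by (simp add: power2_sum)
    qed
    have c1: "continuous_on UNIV (\<lambda>y. 2 * (cmod (v 0 (wrap y)))\<^sup>2)" and c2: "continuous_on UNIV (\<lambda>y. 2 * (cmod (?d y))\<^sup>2)"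
      by (intro continuous_intros c v)+
    have "cell_integral (\<lambda>y. (cmod (v n (wrap y)))\<^sup>2) \<le> cell_integral (\<lambda>y. 2 * (cmod (v 0 (wrap y)))\<^sup>2 + 2 * (cmod (?d y))\<^sup>2)"
      by (rule cell_integral_mono[OF _ continuous_on_add[OF c1 c2] pw]) (intro continuous_intros c v)
    also have "\<dots> = 2 * cell_integral (\<lambda>y. (cmod (v 0 (wrap y)))\<^sup>2) + 2 * cell_integral (\<lambda>y. (cmod (?d y))\<^sup>2)"
      unfolding cell_integral_add[OF c1 c2] cell_integral_cmult_real ..
    also have "\<dots> \<le> S"
    proof -
      have "2 * (1 / real (Suc n) + 1 / real (Suc 0)) \<le> 4" by (simp add: field_simps)
      then have "cell_integral (\<lambda>y. (cmod (?d y))\<^sup>2) \<le> 4" using cauchy[of n 0] by (rule order_trans[rotated])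
      then show ?thesis unfolding S_def by simp
    qed
    finally show ?thesis .
  qed
  have S: "0 < 1 + S" using cell_integral_nonneg[of "\<lambda>y. (cmod (v 0 (wrap y)))\<^sup>2"] by (simp add: S_def)
  show "distribution torus_atlas T"
    unfolding distribution_def
  proof (intro conjI allI impI)
    fix f g assume "smooth_fun torus_atlas f \<and> smooth_fun torus_atlas g"
    then have f: "smooth_fun torus_atlas f" and g: "smooth_fun torus_atlas g" by auto
    have fg: "smooth_fun torus_atlas (\<lambda>p. f p + g p)" using smooth_fun_lin[OF f g, of 1] by simp
    have "(\<integral>p. v n p * (f p + g p) \<partial>torus_measure) = ?I n f + ?I n g" for n
      unfolding int[OF v fg] int[OF v f] int[OF v g] unfolding distrib_left
      by (intro cell_integral_add continuous_intros c v f g)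
    then show "T (\<lambda>p. f p + g p) = T f + T g"
      by (intro Teq[OF fg]) (simp add: tendsto_add[OF lim[OF f] lim[OF g]])
  next
    fix z f assume f: "smooth_fun torus_atlas f"
    have zf: "smooth_fun torus_atlas (\<lambda>p. z * f p)"
      using f unfolding smooth_fun_torus by (intro smooth_on_mult smooth_on_const open_UNIV)
    have "(\<integral>p. v n p * (z * f p) \<partial>torus_measure) = z * ?I n f" for n
      unfolding mult.left_commute[of _ z] by simp
    then show "T (\<lambda>p. z * f p) = z * T f"
      by (intro Teq[OF zf]) (simp add: tendsto_mult_left[OF lim[OF f]])
  next
    fix f assume f: "smooth_null_seq torus_atlas f"
    then have fs: "smooth_fun torus_atlas (f k)" for k by (simp add: smooth_null_seq_def)
    define \<Omega> where "\<Omega> = cell_integral (\<lambda>y. 1 :: real)"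
    have \<Omega>: "0 \<le> \<Omega>" unfolding \<Omega>_def by (rule cell_integral_nonneg) simp
    show "(\<lambda>k. T (f k)) \<longlonglongrightarrow> 0"
    proof (rule tendstoI)
      fix e :: real assume e: "0 < e"
      define \<delta> where "\<delta> = e / (1 + S)"
      have \<delta>: "0 < \<delta>" using e S by (simp add: \<delta>_def)
      \<comment> \<open>A uniform bound by \<open>\<epsilon>\<close> gives an \<open>L\<^sup>2\<close> bound by \<open>\<delta>\<close>, the total mass being \<open>\<Omega>\<close>.\<close>
      define \<epsilon> where "\<epsilon> = \<delta> / (1 + \<Omega>)"
      have \<epsilon>: "0 < \<epsilon>" using \<delta> \<Omega> by (simp add: \<epsilon>_def)
      have e2: "\<epsilon>\<^sup>2 * \<Omega> \<le> \<delta>\<^sup>2"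
      proof -
        have "\<epsilon>\<^sup>2 * \<Omega> \<le> \<epsilon>\<^sup>2 * (1 + \<Omega>)\<^sup>2"
          using \<Omega> by (intro mult_left_mono) (auto simp: power2_eq_square algebra_simps)
        also have "\<dots> = \<delta>\<^sup>2" using \<Omega> by (simp add: \<epsilon>_def power_divide)
        finally show ?thesis .
      qed
      show "\<forall>\<^sub>F k in sequentially. dist (T (f k)) 0 < e"
        using uniform_null_seq[OF f \<epsilon>]
      proof (rule eventually_mono)
        fix k assume k: "\<forall>y. cmod (f k (wrap y)) < \<epsilon>"
        have "(cmod (f k (wrap y)))\<^sup>2 \<le> \<epsilon>\<^sup>2 * 1" for y
          using k[rule_format, of y] by (simp add: power_mono)
        then have "cell_integral (\<lambda>y. (cmod (f k (wrap y)))\<^sup>2) \<le> cell_integral (\<lambda>y. \<epsilon>\<^sup>2 * 1)"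
          by (intro cell_integral_mono continuous_intros c fs)
        also have "\<dots> = \<epsilon>\<^sup>2 * \<Omega>" unfolding cell_integral_cmult_real \<Omega>_def ..
        finally have "cell_integral (\<lambda>y. (cmod (f k (wrap y)))\<^sup>2) \<le> \<delta>\<^sup>2" using e2 by simp
        from cell_integral_product_bound[OF c[OF fs] c[OF v] this vS \<delta>]
        have "cmod (\<integral>p. v n p * f k p \<partial>torus_measure) \<le> e / 2" for n
          unfolding int[OF v fs] using S by (simp add: \<delta>_def mult.commute)
        then have "cmod (T (f k)) \<le> e / 2"
          by (intro Lim_norm_ubound[OF sequentially_bot lim[OF fs]]) auto
        then show "dist (T (f k)) 0 < e" using e by (simp add: dist_norm)
      qed
    qed
  qed
qed

text \<open>On the plane this is \<open>sin (y $ 2)\<close>: an odd function of the second variable, positive on one of the two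
  annuli bounded by the degenerate circles.\<close>

definition rhs :: "complex \<times> complex \<Rightarrow> complex" where
  "rhs p = complex_of_real (Im (snd p))"

lemma rhs_wrap: "rhs (wrap y) = complex_of_real (sin (y $ 2))"
  by (simp add: rhs_def wrap_def)

lemma smooth_fun_rhs: "smooth_fun torus_atlas rhs"
proof -
  have "smooth_on UNIV (\<lambda>y::real^2. sin (y $ 2))"
    by (rule smooth_on_compose[OF open_UNIV open_UNIV smooth_on_bounded_linear_id[OF bounded_linear_vec_nth] smooth_on_sin_cos(1)]) auto
  then show ?thesis
    unfolding smooth_fun_torus rhs_wrap
    by (rule smooth_on_bounded_linear[OF bounded_linear_of_real _ open_UNIV])
qed

text \<open>The minimising sequence of the energy functional with source \<open>rhs\<close> converges to a distribution, and
  selfadjointness moves the operator from the test function to the sequence.\<close>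

lemma weak_solution:
  obtains T where "distribution torus_atlas T"
    "\<And>\<phi>. smooth_fun torus_atlas \<phi> \<Longrightarrow> apply_adjoint torus_op T \<phi> = (\<integral>p. rhs p * \<phi> p \<partial>torus_measure)"
proof -
  let ?l = "\<lambda>u. cell_integral (\<lambda>y. rhs (wrap y) * cnj (u (wrap y)))"
  let ?K = "- cell_integral (\<lambda>y. (cmod (rhs (wrap y)))\<^sup>2)"
  note c = continuous_of_smooth_fun
  have l_lin: "?l (\<lambda>p. u p + a * v p) = ?l u + cnj a * ?l v" if u: "smooth_fun torus_atlas u" and v: "smooth_fun torus_atlas v" for u v a
  proof -
    have "cell_integral (\<lambda>y. rhs (wrap y) * cnj (u (wrap y) + a * v (wrap y)))
        = cell_integral (\<lambda>y. rhs (wrap y) * cnj (u (wrap y)) + cnj a * (rhs (wrap y) * cnj (v (wrap y))))"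
      by (simp add: algebra_simps)
    also have "\<dots> = ?l u + cell_integral (\<lambda>y. cnj a * (rhs (wrap y) * cnj (v (wrap y))))"
      by (intro cell_integral_add continuous_intros c smooth_fun_rhs u v)
    finally show ?thesis by (simp add: cell_integral_cmult)
  qed
  have low: "?K \<le> Re (energy u u) - 2 * Re (?l u)" if u: "smooth_fun torus_atlas u" for u
  proof -
    have cf: "continuous_on UNIV (\<lambda>y. rhs (wrap y) * cnj (u (wrap y)))"
      and c1: "continuous_on UNIV (\<lambda>y. (cmod (rhs (wrap y)))\<^sup>2)" and c2: "continuous_on UNIV (\<lambda>y. (cmod (u (wrap y)))\<^sup>2)"
      by (intro continuous_intros c smooth_fun_rhs u)+
    have pw: "2 * Re (rhs (wrap y) * cnj (u (wrap y))) \<le> (cmod (rhs (wrap y)))\<^sup>2 + (cmod (u (wrap y)))\<^sup>2" for y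
    proof -
      have "Re (rhs (wrap y) * cnj (u (wrap y))) \<le> cmod (rhs (wrap y)) * cmod (u (wrap y))"
        using complex_Re_le_cmod[of "rhs (wrap y) * cnj (u (wrap y))"] by (simp add: norm_mult)
      then show ?thesis using sum_squares_bound[of "cmod (rhs (wrap y))" "cmod (u (wrap y))"] by simp
    qed
    have "2 * Re (?l u) = cell_integral (\<lambda>y. 2 * Re (rhs (wrap y) * cnj (u (wrap y))))"
      unfolding cell_integral_Re[OF cf] cell_integral_cmult_real ..
    also have "\<dots> \<le> cell_integral (\<lambda>y. (cmod (rhs (wrap y)))\<^sup>2 + (cmod (u (wrap y)))\<^sup>2)"
      by (rule cell_integral_mono[OF _ continuous_on_add[OF c1 c2] pw]) (intro continuous_intros cf)
    also have "\<dots> = - ?K + cell_integral (\<lambda>y. (cmod (u (wrap y)))\<^sup>2)"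
      unfolding cell_integral_add[OF c1 c2] by simp
    finally show ?thesis using energy_ge[OF u] by simp
  qed
  have pos: "0 \<le> Re (energy u u)" if "smooth_fun torus_atlas u" for u
    using energy_ge[OF that] cell_integral_nonneg[of "\<lambda>y. (cmod (u (wrap y)))\<^sup>2"] by simp
  have herm: "energy v u = cnj (energy u v)" if "smooth_fun torus_atlas u" "smooth_fun torus_atlas v" for u v
    by (rule energy_herm)
  obtain v where v: "\<And>n. smooth_fun torus_atlas (v n)"
    and conv: "\<And>\<psi>. smooth_fun torus_atlas \<psi> \<Longrightarrow> (\<lambda>n. energy (v n) \<psi>) \<longlonglongrightarrow> ?l \<psi>"
    and cauchy: "\<And>m n. Re (energy (\<lambda>x. v m x - v n x) (\<lambda>x. v m x - v n x)) \<le> 2 * (1 / Suc m + 1 / Suc n)"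
    by (rule minimizing_sequence[where ?u0.0 = rhs and V = "Collect (smooth_fun torus_atlas)" and B = energy and l = ?l and K = ?K,
          unfolded mem_Collect_eq])
      (rule smooth_fun_rhs smooth_fun_lin energy_lin herm l_lin pos low that; assumption)+
  have ca: "cell_integral (\<lambda>y. (cmod (v m (wrap y) - v n (wrap y)))\<^sup>2) \<le> 2 * (1 / Suc m + 1 / Suc n)" for m n
  proof -
    have "smooth_fun torus_atlas (\<lambda>p. v m p - v n p)" using smooth_fun_lin[OF v v, of m "-1" n] by simp
    from energy_ge[OF this] show ?thesis using cauchy[of m n] by simp
  qed
  define T where "T = (\<lambda>\<phi>. lim (\<lambda>n. \<integral>p. v n p * \<phi> p \<partial>torus_measure))"
  have T: "distribution torus_atlas T"
    "\<And>\<phi>. smooth_fun torus_atlas \<phi> \<Longrightarrow> (\<lambda>n. \<integral>p. v n p * \<phi> p \<partial>torus_measure) \<longlonglongrightarrow> T \<phi>"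
    unfolding T_def using weak_limit_distribution[OF v ca] by blast+
  have LT: "apply_adjoint torus_op T \<phi> = (\<integral>p. rhs p * \<phi> p \<partial>torus_measure)" if \<phi>: "smooth_fun torus_atlas \<phi>" for \<phi>
  proof -
    let ?\<psi> = "\<lambda>p. cnj (\<phi> p)"
    have \<psi>: "smooth_fun torus_atlas ?\<psi>" by (rule smooth_fun_cnj[OF \<phi>])
    have "smooth_fun torus_atlas (\<lambda>p. cnj (torus_op ?\<psi> p))"
      by (rule smooth_fun_cnj[OF smooth_fun_torus_op[OF \<psi>]])
    from T(2)[OF this]
    have "(\<lambda>n. \<integral>p. v n p * cnj (torus_op ?\<psi> p) \<partial>torus_measure) \<longlonglongrightarrow> apply_adjoint torus_op T \<phi>"
      by (simp add: apply_adjoint_def)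
    moreover have "(\<integral>p. v n p * cnj (torus_op ?\<psi> p) \<partial>torus_measure) = energy (v n) ?\<psi>" for n
      using formally_selfadjoint_torus_op v[of n] \<psi>
      unfolding formally_selfadjoint_def formal_adjoint_def energy_eq[OF v \<psi>, symmetric] by metis
    moreover have "?l ?\<psi> = (\<integral>p. rhs p * \<phi> p \<partial>torus_measure)"
      using integral_torus[OF c[OF smooth_fun_mult[OF smooth_fun_rhs \<phi>]]] by simp
    ultimately show ?thesis using conv[OF \<psi>] LIMSEQ_unique by auto
  qed
  show ?thesis by (rule that[OF T(1) LT])
qed

text \<open>If the weak solution is a smooth function \<open>g\<close>, then testing with the conjugate of the residual \<open>r\<close> shows
  that \<open>r\<close> vanishes, so the equation holds pointwise.\<close>

lemma globally_regular_imp_smooth_solution: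
  assumes "globally_regular torus_atlas torus_measure torus_op"
  obtains w where "smooth_on UNIV w" "periodic w" "\<And>y. plane_op w y = complex_of_real (sin (y $ 2))"
proof -
  obtain T where T: "distribution torus_atlas T"
    and LT: "\<And>\<phi>. smooth_fun torus_atlas \<phi> \<Longrightarrow> apply_adjoint torus_op T \<phi> = (\<integral>p. rhs p * \<phi> p \<partial>torus_measure)"
    by (rule weak_solution) (rule that; assumption)
  have adj: "formal_adjoint torus_atlas torus_measure torus_op torus_op"
    using formally_selfadjoint_torus_op by (simp add: formally_selfadjoint_def)
  have "smooth_distribution torus_atlas torus_measure (apply_adjoint torus_op T)"
    unfolding smooth_distribution_def using smooth_fun_rhs LT by blast
  then have "smooth_distribution torus_atlas torus_measure T"
    using assms adj T unfolding globally_regular_def by blast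
  then obtain g where g: "smooth_fun torus_atlas g"
    and Tg: "\<And>\<phi>. smooth_fun torus_atlas \<phi> \<Longrightarrow> T \<phi> = (\<integral>p. g p * \<phi> p \<partial>torus_measure)"
    unfolding smooth_distribution_def by blast
  define r where "r p = torus_op g p - rhs p" for p
  have Lg: "smooth_fun torus_atlas (torus_op g)" by (rule smooth_fun_torus_op[OF g])
  have r: "smooth_fun torus_atlas r"
    using smooth_fun_lin[OF Lg smooth_fun_rhs, of "-1"] by (simp add: r_def[abs_def])
  note c = continuous_of_smooth_fun and cr = smooth_fun_cnj[OF r]
  have "(\<integral>p. rhs p * cnj (r p) \<partial>torus_measure) = T (\<lambda>p. cnj (torus_op r p))"
    using LT[OF cr] by (simp add: apply_adjoint_def)
  also have "\<dots> = (\<integral>p. g p * cnj (torus_op r p) \<partial>torus_measure)"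
    by (rule Tg[OF smooth_fun_cnj[OF smooth_fun_torus_op[OF r]]])
  also have "\<dots> = (\<integral>p. torus_op g p * cnj (r p) \<partial>torus_measure)"
    using adj g r unfolding formal_adjoint_def by metis
  finally have eq: "cell_integral (\<lambda>y. rhs (wrap y) * cnj (r (wrap y))) = cell_integral (\<lambda>y. torus_op g (wrap y) * cnj (r (wrap y)))"
    unfolding integral_torus[OF c[OF smooth_fun_mult[OF smooth_fun_rhs cr]]]
      integral_torus[OF c[OF smooth_fun_mult[OF Lg cr]]] .
  have "complex_of_real (cell_integral (\<lambda>y. (cmod (r (wrap y)))\<^sup>2)) = cell_integral (\<lambda>y. r (wrap y) * cnj (r (wrap y)))"
    unfolding cell_integral_of_real[symmetric] complex_norm_square ..
  also have "\<dots> = cell_integral (\<lambda>y. torus_op g (wrap y) * cnj (r (wrap y)) + (- 1) * (rhs (wrap y) * cnj (r (wrap y))))"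
    by (simp add: r_def algebra_simps)
  also have "\<dots> = cell_integral (\<lambda>y. torus_op g (wrap y) * cnj (r (wrap y)))
      + cell_integral (\<lambda>y. (- 1) * (rhs (wrap y) * cnj (r (wrap y))))"
    by (intro cell_integral_add continuous_on_mult continuous_on_const continuous_on_cnj c Lg r smooth_fun_rhs)
  also have "\<dots> = 0" unfolding cell_integral_cmult eq by simp
  finally have zero: "cell_integral (\<lambda>y. (cmod (r (wrap y)))\<^sup>2) = 0" by simp
  have cont: "continuous_on UNIV (\<lambda>y. (cmod (r (wrap y)))\<^sup>2)" by (intro continuous_intros c r)
  have per: "periodic (\<lambda>y. (cmod (r (wrap y)))\<^sup>2)" by (rule periodic_wrap)
  have "(cmod (r (wrap y)))\<^sup>2 = 0" for y
    by (rule cell_integral_zero_imp_zero[OF cont _ per zero]) (rule zero_le_power2)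
  then have "torus_op g (wrap y) = rhs (wrap y)" for y by (simp add: r_def)
  then have "plane_op (\<lambda>y. g (wrap y)) y = complex_of_real (sin (y $ 2))" for y
    by (simp add: torus_op_wrap rhs_wrap)
  then show ?thesis
    using g unfolding smooth_fun_torus by (intro that[of "\<lambda>y. g (wrap y)"]) simp_all
qed


section \<open>Comparison with a subsolution\<close>

lemma second_derivative_test:
  fixes g :: "real \<Rightarrow> real"
  assumes r: "0 < r" and g: "\<And>x. \<bar>x - x0\<bar> < r \<Longrightarrow> (g has_real_derivative g' x) (at x)"
    and g': "(g' has_real_derivative s) (at x0)" and min: "\<And>x. \<bar>x - x0\<bar> < r \<Longrightarrow> g x0 \<le> g x"
  shows "g' x0 = 0" "0 \<le> s"
proof -
  show z: "g' x0 = 0"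
    by (rule DERIV_local_min[OF g r]) (use r min in \<open>auto simp: abs_minus_commute\<close>)
  show "0 \<le> s"
  proof (rule ccontr)
    assume "\<not> 0 \<le> s"
    then obtain d where d: "0 < d" "\<And>h. 0 < h \<Longrightarrow> h < d \<Longrightarrow> g' (x0 + h) < g' x0"
      using DERIV_neg_dec_right[OF g'] by (auto simp: not_le)
    define h where "h = min d r / 2"
    have h: "0 < h" "h < d" "h < r" using d r by (auto simp: h_def min_def)
    have "\<exists>z>x0. z < x0 + h \<and> g (x0 + h) - g x0 = (x0 + h - x0) * g' z"
      by (rule MVT2) (use h in \<open>auto intro!: g\<close>)
    then obtain z where "x0 < z" "z < x0 + h" "g (x0 + h) - g x0 = h * g' z" by auto
    moreover have "g' z < 0" using d(2)[of "z - x0"] z h calculation by simp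
    ultimately have "g (x0 + h) < g x0" using h mult_pos_neg[of h "g' z"] by simp
    moreover have "g x0 \<le> g (x0 + h)" by (rule min) (use h in auto)
    ultimately show False by simp
  qed
qed

text \<open>At a minimum the first derivatives vanish and the second ones are nonnegative. This form of the minimum
  principle tolerates the vanishing of the coefficient \<open>b\<close>.\<close>

lemma operator_at_minimum:
  fixes G :: "real \<Rightarrow> real \<Rightarrow> real"
  assumes r: "0 < r"
    and x: "\<And>x. \<bar>x - x0\<bar> < r \<Longrightarrow> ((\<lambda>x. G x t0) has_real_derivative Gx x) (at x)"
      "(Gx has_real_derivative Gxx) (at x0)" "\<And>x. \<bar>x - x0\<bar> < r \<Longrightarrow> G x0 t0 \<le> G x t0"
    and t: "\<And>t. \<bar>t - t0\<bar> < r \<Longrightarrow> ((\<lambda>t. G x0 t) has_real_derivative Gt t) (at t)"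
      "(Gt has_real_derivative Gtt) (at t0)" "\<And>t. \<bar>t - t0\<bar> < r \<Longrightarrow> G x0 t0 \<le> G x0 t"
    and b: "0 \<le> b"
  shows "- Gxx - b * Gtt - b' * Gt t0 + G x0 t0 \<le> G x0 t0"
proof -
  have "0 \<le> Gxx" by (rule second_derivative_test(2)[OF r x]) 
  moreover have "Gt t0 = 0" "0 \<le> Gtt" by (rule second_derivative_test[OF r t]; assumption)+
  moreover from this have "0 \<le> b * Gtt" using b by simp
  ultimately show ?thesis by simp
qed

lemma Re_pd_pt:
  assumes "g differentiable (at (pt x t))"
  shows "((\<lambda>x. Re (g (pt x t))) has_real_derivative Re (pd 1 g (pt x t))) (at x)"
    "((\<lambda>t. Re (g (pt x t))) has_real_derivative Re (pd 2 g (pt x t))) (at t)"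
  using pd_pt[OF assms, THEN bounded_linear.has_vector_derivative[OF bounded_linear_Re]]
  by (simp_all add: has_real_derivative_iff_has_vector_derivative)

lemma pd2_weight:
  "pd 2 (\<lambda>y. complex_of_real (weight y)) y = complex_of_real (8 * sin (y $ 2) * cos (y $ 2))"
proof -
  let ?w = "\<lambda>y. complex_of_real (weight y)"
  have "?w differentiable (at (pt (y $ 1) (y $ 2)))"
    by (rule smooth_on_imp_differentiable[OF smooth_on_cweight]) simp
  from pd_pt(2)[OF this]
  have "((\<lambda>t. ?w (pt (y $ 1) t)) has_vector_derivative pd 2 ?w y) (at (y $ 2))" by (simp add: pt_eta)
  moreover have "((\<lambda>t. ?w (pt (y $ 1) t)) has_vector_derivative complex_of_real (8 * sin (y $ 2) * cos (y $ 2))) (at (y $ 2))"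
  proof -
    have "((\<lambda>t. weight (pt (y $ 1) t)) has_real_derivative 8 * sin (y $ 2) * cos (y $ 2)) (at (y $ 2))"
      unfolding weight_def pt_nth by (auto intro!: derivative_eq_intros)
    then show ?thesis
      unfolding has_real_derivative_iff_has_vector_derivative
      by (rule bounded_linear.has_vector_derivative[OF bounded_linear_of_real])
  qed
  ultimately show ?thesis by (rule vector_derivative_unique_at)
qed

text \<open>Only the part of the solution that is odd in the second variable is examined. The weight is even, so the odd
  part solves an equation of the same form, with twice the source; in addition it vanishes on both degenerate circles.\<close>

context
  fixes w :: "real^2 \<Rightarrow> complex"
  assumes w_smooth: "smooth_on UNIV w" and w_periodic: "periodic w"
    and w_eq: "\<And>y. plane_op w y = complex_of_real (sin (y $ 2))"
begin

definition odd_part :: "real \<Rightarrow> real \<Rightarrow> real" where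
  "odd_part x t = Re (w (pt x t)) - Re (w (pt x (- t)))"

definition odd_x :: "real \<Rightarrow> real \<Rightarrow> real" where
  "odd_x x t = Re (pd 1 w (pt x t)) - Re (pd 1 w (pt x (- t)))"

definition odd_xx :: "real \<Rightarrow> real \<Rightarrow> real" where
  "odd_xx x t = Re (pd 1 (pd 1 w) (pt x t)) - Re (pd 1 (pd 1 w) (pt x (- t)))"

definition odd_t :: "real \<Rightarrow> real \<Rightarrow> real" where
  "odd_t x t = Re (pd 2 w (pt x t)) + Re (pd 2 w (pt x (- t)))"

definition odd_tt :: "real \<Rightarrow> real \<Rightarrow> real" where
  "odd_tt x t = Re (pd 2 (pd 2 w) (pt x t)) - Re (pd 2 (pd 2 w) (pt x (- t)))"

lemma w_differentiable: "w differentiable (at y)" "pd i w differentiable (at y)"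
  using smooth_on_imp_differentiable[OF w_smooth] smooth_on_imp_differentiable[OF smooth_on_pd[OF w_smooth]] by auto

lemma odd_part_derivatives:
  "((\<lambda>x. odd_part x t) has_real_derivative odd_x x t) (at x)"
  "((\<lambda>x. odd_x x t) has_real_derivative odd_xx x t) (at x)"
  "((\<lambda>t. odd_part x t) has_real_derivative odd_t x t) (at t)"
  "((\<lambda>t. odd_t x t) has_real_derivative odd_tt x t) (at t)"
proof -
  note d = Re_pd_pt[OF w_differentiable(1)] Re_pd_pt[OF w_differentiable(2)]
  have refl: "((\<lambda>t. Re (g (pt x (- t)))) has_real_derivative - Re (pd 2 g (pt x (- t)))) (at t)"
    if "\<And>y. g differentiable (at y)" for g
    using DERIV_chain2[OF Re_pd_pt(2)[OF that] DERIV_minus[OF DERIV_ident]] by simp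
  show "((\<lambda>x. odd_part x t) has_real_derivative odd_x x t) (at x)"
    unfolding odd_part_def odd_x_def by (intro DERIV_diff d)
  show "((\<lambda>x. odd_x x t) has_real_derivative odd_xx x t) (at x)"
    unfolding odd_xx_def odd_x_def by (intro DERIV_diff d)
  show "((\<lambda>t. odd_part x t) has_real_derivative odd_t x t) (at t)"
    unfolding odd_part_def odd_t_def using DERIV_diff[OF d(2) refl[OF w_differentiable(1)]] by simp
  show "((\<lambda>t. odd_t x t) has_real_derivative odd_tt x t) (at t)"
    unfolding odd_tt_def odd_t_def using DERIV_add[OF d(4) refl[OF w_differentiable(2)]] by simp
qed

lemma odd_part_equation:
  "- odd_xx x t - weight (pt x t) * odd_tt x t - 8 * sin t * cos t * odd_t x t + odd_part x t = 2 * sin t"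
proof -
  have re: "Re (plane_op w y) = - Re (pd 1 (pd 1 w) y) - weight y * Re (pd 2 (pd 2 w) y)
      - 8 * sin (y $ 2) * cos (y $ 2) * Re (pd 2 w y) + Re (w y)" for y
    unfolding plane_op_expand[OF smooth_on_imp_Ck[OF w_smooth]] pd2_weight by simp
  have eq: "- Re (pd 1 (pd 1 w) y) - weight y * Re (pd 2 (pd 2 w) y)
      - 8 * sin (y $ 2) * cos (y $ 2) * Re (pd 2 w y) + Re (w y) = sin (y $ 2)" for y
    unfolding re[symmetric] w_eq by simp
  have "weight (pt x (- t)) = weight (pt x t)" by (simp add: weight_def)
  then show ?thesis
    using eq[of "pt x t"] eq[of "pt x (- t)"]
    by (simp add: odd_part_def odd_xx_def odd_tt_def odd_t_def algebra_simps)
qed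

lemma odd_part_zero: "odd_part x 0 = 0" "odd_part x pi = 0"
  using periodicD[OF w_periodic wrap_pt_pi(2), of x] by (simp_all add: odd_part_def)

lemma odd_part_periodic: "odd_part x t = odd_part (unwrap 0 (wrap (pt x t)) $ 1) t"
proof -
  let ?x = "unwrap 0 (wrap (pt x t)) $ 1"
  have "wrap (unwrap 0 (wrap (pt x t))) = wrap (pt x t)" by (rule wrap_unwrap) simp
  then have "cis ?x = cis x" by (simp add: wrap_def)
  then have "wrap (pt x s) = wrap (pt ?x s)" for s by (simp add: wrap_def)
  then show ?thesis unfolding odd_part_def using periodicD[OF w_periodic] by metis
qed

lemma continuous_on_odd_part: "continuous_on S (\<lambda>z. odd_part (fst z) (snd z))"
proof -
  have c: "continuous_on UNIV (\<lambda>z::real \<times> real. if i = (1::2) then fst z else - snd z)"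
    "continuous_on UNIV (\<lambda>z::real \<times> real. if i = (1::2) then fst z else snd z)" for i
    by (cases "i = 1"; simp add: continuous_intros)+
  have p: "continuous_on UNIV (\<lambda>z::real \<times> real. pt (fst z) (- snd z))"
    "continuous_on UNIV (\<lambda>z::real \<times> real. pt (fst z) (snd z))"
    unfolding pt_def by (rule continuous_on_vec_lambda[OF c(1)], rule continuous_on_vec_lambda[OF c(2)])
  have "continuous_on UNIV (\<lambda>z. odd_part (fst z) (snd z))"
    unfolding odd_part_def
    by (intro continuous_intros continuous_on_compose2[OF smooth_on_imp_continuous_on[OF w_smooth] p(1)]
        continuous_on_compose2[OF smooth_on_imp_continuous_on[OF w_smooth] p(2)]) auto
  then show ?thesis by (rule continuous_on_subset) simp
qed

text \<open>The minimum principle on the annulus \<open>0 \<le> t \<le> pi\<close>: at an interior minimum the value is at least the source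
  \<open>2 sin t\<close>, which is positive, and the boundary values are \<open>0\<close>.\<close>

lemma odd_part_nonneg:
  assumes "0 \<le> t" "t \<le> pi"
  shows "0 \<le> odd_part x t"
proof -
  let ?S = "{-pi..pi} \<times> {0..pi}"
  have "compact ?S" by (intro compact_Times compact_Icc)
  moreover have "?S \<noteq> {}" by simp
  ultimately have "\<exists>z\<in>?S. \<forall>z'\<in>?S. odd_part (fst z) (snd z) \<le> odd_part (fst z') (snd z')"
    by (rule continuous_attains_inf[OF _ _ continuous_on_odd_part])
  then obtain z where z: "z \<in> ?S" and zmin: "\<forall>z'\<in>?S. odd_part (fst z) (snd z) \<le> odd_part (fst z') (snd z')"
    by (rule bexE)
  define x0 t0 where "x0 = fst z" and "t0 = snd z"
  have t0: "t0 \<in> {0..pi}" using z by (auto simp: t0_def)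
  have min: "odd_part x0 t0 \<le> odd_part x t" if "x \<in> {-pi..pi}" "t \<in> {0..pi}" for x t
    using bspec[OF zmin, of "(x, t)"] that by (simp add: x0_def t0_def)
  have min': "odd_part x0 t0 \<le> odd_part x t" if "0 \<le> t" "t \<le> pi" for x t
  proof -
    have "unwrap 0 (wrap (pt x t)) \<in> cell" by (rule unwrap_in_cell) simp
    then show ?thesis
      unfolding odd_part_periodic[of x t] using that by (intro min) (auto simp: cell_def less_imp_le)
  qed
  have "0 \<le> odd_part x0 t0"
  proof (cases "t0 = 0 \<or> t0 = pi")
    case True
    then show ?thesis using odd_part_zero by auto
  next
    case False
    then have t0': "0 < t0" "t0 < pi" using t0 by auto
    define r where "r = min t0 (pi - t0)"
    have r: "0 < r" using t0' by (simp add: r_def)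
    have "- odd_xx x0 t0 - weight (pt x0 t0) * odd_tt x0 t0 - 8 * sin t0 * cos t0 * odd_t x0 t0 + odd_part x0 t0
        \<le> odd_part x0 t0"
      by (rule operator_at_minimum[where r = r, OF r odd_part_derivatives(1) odd_part_derivatives(2) _
            odd_part_derivatives(3) odd_part_derivatives(4)])
        (use t0' in \<open>auto intro!: min' weight_nonneg simp: r_def\<close>)
    then have "2 * sin t0 \<le> odd_part x0 t0" unfolding odd_part_equation .
    moreover have "0 < sin t0" using t0' by (rule sin_gt_zero)
    ultimately show ?thesis by simp
  qed
  then show ?thesis using min'[OF assms, of x] by simp
qed

text \<open>The function \<open>v = sqrt (sin t) cos x\<close> vanishes on the boundary of the rectangle
  \<open>|x| \<le> pi / 2\<close>, \<open>0 \<le> t \<le> pi\<close>, on which the weight is \<open>4 sin\<^sup>2 t\<close>, and the operator maps it to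
  \<open>sqrt (sin t) cos x (5 sin\<^sup>2 t - 1) \<le> 5 sin t\<close>. Thus \<open>2 / 5 v\<close> is a subsolution for the source \<open>2 sin t\<close>, and the
  minimum principle applies to the difference \<open>G\<close>. On the two vertical sides the comparison rests on
  \<open>odd_part_nonneg\<close>.\<close>

lemma odd_part_lower_bound:
  assumes "0 \<le> t" "t \<le> pi"
  shows "2 / 5 * sqrt (sin t) \<le> odd_part 0 t"
proof -
  define G where "G x t = odd_part x t - 2 / 5 * (sqrt (sin t) * cos x)" for x t
  let ?S = "{-(pi/2)..pi/2} \<times> {0..pi}"
  have "compact ?S" by (intro compact_Times compact_Icc)
  moreover have "?S \<noteq> {}" by simp
  moreover have "continuous_on ?S (\<lambda>z. G (fst z) (snd z))"
    unfolding G_def by (intro continuous_intros continuous_on_odd_part)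
  ultimately have "\<exists>z\<in>?S. \<forall>z'\<in>?S. G (fst z) (snd z) \<le> G (fst z') (snd z')"
    by (rule continuous_attains_inf)
  then obtain z where z: "z \<in> ?S" and zmin: "\<forall>z'\<in>?S. G (fst z) (snd z) \<le> G (fst z') (snd z')"
    by (rule bexE)
  define x0 t0 where "x0 = fst z" and "t0 = snd z"
  have x0: "x0 \<in> {-(pi/2)..pi/2}" and t0: "t0 \<in> {0..pi}" using z by (auto simp: x0_def t0_def)
  have min: "G x0 t0 \<le> G x t" if "x \<in> {-(pi/2)..pi/2}" "t \<in> {0..pi}" for x t
    using bspec[OF zmin, of "(x, t)"] that by (simp add: x0_def t0_def)
  have "0 \<le> G x0 t0"
  proof (cases "x0 = - (pi/2) \<or> x0 = pi/2 \<or> t0 = 0 \<or> t0 = pi")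
    case True
    then have "cos x0 = 0 \<or> sin t0 = 0"
      by (elim disjE; simp only: cos_minus cos_pi_half sin_zero sin_pi simp_thms)
    then have "G x0 t0 = odd_part x0 t0" by (auto simp: G_def)
    then show ?thesis using odd_part_nonneg[of t0 x0] t0 by simp
  next
    case False
    then have i: "- (pi/2) < x0" "x0 < pi/2" "0 < t0" "t0 < pi" using x0 t0 by auto
    define r where "r = Min {t0, pi - t0, x0 + pi/2, pi/2 - x0}"
    have r: "0 < r" using i by (simp add: r_def)
    have s: "0 < sin t" if "\<bar>t - t0\<bar> < r" for t
      using that i by (intro sin_gt_zero) (auto simp: r_def)
    have s0: "0 < sin t0" using s[of t0] r by simp
    have c0: "0 < cos x0" using i by (intro cos_gt_zero_pi)
    define q where "q = sqrt (sin t0)"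
    have q: "0 < q" "q * q = sin t0" using s0 by (simp_all add: q_def)
    define Gt where "Gt t = odd_t x0 t - 2 / 5 * (cos t / (2 * sqrt (sin t)) * cos x0)" for t
    \<comment> \<open>The second derivative of \<open>sqrt (sin t)\<close> at \<open>t0\<close>, in the form in which the quotient rule gives it.\<close>
    define q2 where "q2 = (- 2 * sin t0 * q - cos t0 * cos t0 / q) / (4 * sin t0)"
    have at_min: "- (odd_xx x0 t0 + 2 / 5 * (q * cos x0)) - weight (pt x0 t0) * (odd_tt x0 t0 - 2 / 5 * (q2 * cos x0))
        - (8 * sin t0 * cos t0) * Gt t0 + G x0 t0 \<le> G x0 t0"
    proof (rule operator_at_minimum[where r = r and G = G and ?x0.0 = x0 and ?t0.0 = t0 and Gt = Gt and Gx = "\<lambda>x. odd_x x t0 + 2 / 5 * (sqrt (sin t0) * sin x)", OF r])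
      show "((\<lambda>x. G x t0) has_real_derivative odd_x x t0 + 2 / 5 * (sqrt (sin t0) * sin x)) (at x)" for x
        unfolding G_def by (auto intro!: derivative_eq_intros odd_part_derivatives)
      show "((\<lambda>x. odd_x x t0 + 2 / 5 * (sqrt (sin t0) * sin x)) has_real_derivative
          odd_xx x0 t0 + 2 / 5 * (q * cos x0)) (at x0)"
        unfolding q_def by (auto intro!: derivative_eq_intros odd_part_derivatives)
      show "((\<lambda>t. G x0 t) has_real_derivative Gt t) (at t)" if "\<bar>t - t0\<bar> < r" for t
        unfolding G_def Gt_def using s[OF that]
        by (auto intro!: derivative_eq_intros odd_part_derivatives simp: field_simps)
      have "((\<lambda>t. cos t / (2 * sqrt (sin t))) has_real_derivative q2) (at t0)"
        using s0 q by (auto intro!: derivative_eq_intros simp: q2_def q_def[symmetric] field_simps)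
      then show "(Gt has_real_derivative odd_tt x0 t0 - 2 / 5 * (q2 * cos x0)) (at t0)"
        unfolding Gt_def by (intro DERIV_diff odd_part_derivatives DERIV_cmult DERIV_cmult_right)
      show "G x0 t0 \<le> G x t0" if "\<bar>x - x0\<bar> < r" for x
        using that t0 by (intro min) (auto simp: r_def)
      show "G x0 t0 \<le> G x0 t" if "\<bar>t - t0\<bar> < r" for t
        using that x0 by (intro min) (auto simp: r_def)
    qed (rule weight_nonneg)
    \<comment> \<open>The flat term does not contribute, as \<open>cos x0\<close> is positive inside the rectangle.\<close>
    have w: "weight (pt x0 t0) = 4 * (sin t0)\<^sup>2" using c0 by (simp add: weight_def flat_def)
    have coeff: "weight (pt x0 t0) * q2 + 8 * sin t0 * cos t0 * (cos t0 / (2 * q)) = 3 * q - 5 * (sin t0)\<^sup>2 * q"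
    proof -
      have cs: "(cos t0)\<^sup>2 = 1 - (sin t0)\<^sup>2" by (rule cos_squared_eq)
      have sq: "sin t0 / q = q" using q by (simp add: field_simps)
      have "weight (pt x0 t0) * q2 = sin t0 * (- 2 * sin t0 * q - cos t0 * cos t0 / q)"
        unfolding w q2_def using s0 by (simp add: power2_eq_square field_simps)
      also have "\<dots> = - 2 * (sin t0)\<^sup>2 * q - (cos t0)\<^sup>2 * (sin t0 / q)"
        by (simp add: power2_eq_square algebra_simps)
      finally have "weight (pt x0 t0) * q2 + 8 * sin t0 * cos t0 * (cos t0 / (2 * q))
          = - 2 * (sin t0)\<^sup>2 * q + 3 * (cos t0)\<^sup>2 * (sin t0 / q)"
        by (simp add: power2_eq_square)
      then show ?thesis unfolding sq cs by (simp add: algebra_simps)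
    qed
    have "2 * sin t0 - 2 / 5 * (q * cos x0 * (5 * (sin t0)\<^sup>2 - 1))
        = 2 * sin t0 + 2 / 5 * cos x0 * ((3 * q - 5 * (sin t0)\<^sup>2 * q) - 2 * q)"
      by (simp add: algebra_simps)
    also have "\<dots> = - (odd_xx x0 t0 + 2 / 5 * (q * cos x0)) - weight (pt x0 t0) * (odd_tt x0 t0 - 2 / 5 * (q2 * cos x0))
        - (8 * sin t0 * cos t0) * (odd_t x0 t0 - 2 / 5 * (cos t0 / (2 * q) * cos x0)) + (odd_part x0 t0 - 2 / 5 * (q * cos x0))"
      unfolding odd_part_equation[of x0 t0, symmetric] coeff[symmetric]
      by (simp only: algebra_simps)
    also have "\<dots> \<le> G x0 t0" using at_min by (simp only: Gt_def G_def q_def)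
    finally have "2 * sin t0 - 2 / 5 * (q * cos x0 * (5 * (sin t0)\<^sup>2 - 1)) \<le> G x0 t0" .
    moreover have "q * cos x0 * (5 * (sin t0)\<^sup>2 - 1) \<le> 5 * sin t0"
    proof -
      have "q \<le> 1" using q_def by simp
      then have "q * cos x0 \<le> 1" using q c0 by (intro mult_le_one) auto
      then have "q * cos x0 * (sin t0)\<^sup>2 \<le> 1 * (sin t0)\<^sup>2" by (intro mult_right_mono) auto
      also have "\<dots> \<le> sin t0" using s0 mult_left_mono[of "sin t0" 1 "sin t0"] by (simp add: power2_eq_square)
      finally have "q * cos x0 * (sin t0)\<^sup>2 \<le> sin t0" .
      moreover have "0 < q * cos x0" using q c0 by simp
      moreover have "q * cos x0 * (5 * (sin t0)\<^sup>2 - 1) = 5 * (q * cos x0 * (sin t0)\<^sup>2) - q * cos x0"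
        by (simp add: algebra_simps)
      ultimately show ?thesis by linarith
    qed
    ultimately show ?thesis by simp
  qed
  also have "G x0 t0 \<le> G 0 t" using assms by (intro min) auto
  finally show ?thesis by (simp add: G_def)
qed

text \<open>Along \<open>x = 0\<close> the odd part vanishes at \<open>t = 0\<close> and is differentiable there, hence is \<open>O(t)\<close>; the lower bound
  grows like the square root of \<open>t\<close>.\<close>

lemma no_smooth_solution: False
proof -
  define D where "D t = odd_part 0 t" for t
  have "(D has_real_derivative odd_t 0 0) (at 0)"
    unfolding D_def by (rule odd_part_derivatives)
  then have "((\<lambda>t. D t / t) \<longlongrightarrow> odd_t 0 0) (at 0)"
    by (simp add: has_field_derivative_iff D_def odd_part_zero)
  then have "((\<lambda>t. D t / t) \<longlongrightarrow> odd_t 0 0) (at_right 0)"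
    by (rule tendsto_within_subset) simp
  then have "((\<lambda>t. (D t / t)\<^sup>2 * t) \<longlongrightarrow> (odd_t 0 0)\<^sup>2 * 0) (at_right 0)"
    by (intro tendsto_intros)
  moreover have "((\<lambda>t::real. sin t / t) \<longlongrightarrow> 1) (at 0)"
    using DERIV_sin[of 0] by (simp add: has_field_derivative_iff)
  then have "((\<lambda>t::real. sin t / t) \<longlongrightarrow> 1) (at_right 0)"
    by (rule tendsto_within_subset) simp
  then have "((\<lambda>t::real. 4 / 25 * (sin t / t)) \<longlongrightarrow> 4 / 25 * 1) (at_right 0)"
    by (rule tendsto_mult_left)
  moreover have "\<forall>\<^sub>F t in at_right 0. 4 / 25 * (sin t / t) \<le> (D t / t)\<^sup>2 * t"
    unfolding eventually_at_right[OF pi_gt_zero]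
  proof (intro exI[of _ pi] conjI allI impI pi_gt_zero)
    fix t :: real assume t: "0 < t" "t < pi"
    have "0 \<le> sin t" using t by (intro sin_ge_zero) auto
    then have "4 / 25 * sin t = (2 / 5 * sqrt (sin t))\<^sup>2" by (simp add: power_mult_distrib power2_eq_square)
    also have "\<dots> \<le> (D t)\<^sup>2"
      using odd_part_lower_bound[of t] t \<open>0 \<le> sin t\<close> by (intro power_mono) (auto simp: D_def)
    finally have "4 / 25 * sin t / t \<le> (D t)\<^sup>2 / t" using t by (intro divide_right_mono) auto
    then show "4 / 25 * (sin t / t) \<le> (D t / t)\<^sup>2 * t" using t by (simp add: power2_eq_square)
  qed
  ultimately have "4 / 25 * 1 \<le> (odd_t 0 0)\<^sup>2 * (0::real)"
    by (intro tendsto_le[OF trivial_limit_at_right_real])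
  then show False by simp
qed

end

theorem theorem1p1:
  shows "\<exists>(X :: (complex \<times> complex) topology) (A :: (complex \<times> complex, 2) chart set)
            (\<sigma> :: (complex \<times> complex) measure)
            (L :: (complex \<times> complex \<Rightarrow> complex) \<Rightarrow> complex \<times> complex \<Rightarrow> complex).
     smooth_manifold X A \<and> compact_space X \<and> smooth_measure X A \<sigma> \<and>
     second_order_operator A L \<and> nonneg_principal_symbol A L \<and> formally_selfadjoint A \<sigma> L \<and>
     (\<exists>W. openin X W \<and> X closure_of W = topspace X \<and> (\<forall>p\<in>W. elliptic_at A L p)) \<and>
     (\<exists>K::real. \<forall>u. Ck_fun A 2 u \<longrightarrow> L2norm \<sigma> u \<le> K * L2norm \<sigma> (L u)) \<and>
     (\<forall>p\<in>topspace X. \<forall>q\<in>topspace X. \<exists>R \<gamma>. subunit_path X A L R \<gamma> \<and> \<gamma> 0 = p \<and> \<gamma> R = q) \<and>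
     \<not> globally_regular A \<sigma> L"
proof (intro exI[of _ torus_top] exI[of _ torus_atlas] exI[of _ torus_measure] exI[of _ torus_op] conjI)
  show "smooth_manifold torus_top torus_atlas" by (rule smooth_manifold_torus)
  show "compact_space torus_top" by (simp add: compact_space_subtopology compact_torus)
  show "smooth_measure torus_top torus_atlas torus_measure" by (rule smooth_measure_torus)
  show "second_order_operator torus_atlas torus_op" by (rule second_order_operator_torus_op)
  show "nonneg_principal_symbol torus_atlas torus_op" by (rule nonneg_principal_symbol_torus_op)
  show "formally_selfadjoint torus_atlas torus_measure torus_op" by (rule formally_selfadjoint_torus_op)
  show "\<exists>W. openin torus_top W \<and> torus_top closure_of W = topspace torus_top \<and>
      (\<forall>p\<in>W. elliptic_at torus_atlas torus_op p)"
    using elliptic_set_dense by (intro exI[of _ "{p \<in> torus. Im (snd p) \<noteq> 0}"]) simp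
  show "\<exists>K::real. \<forall>u. Ck_fun torus_atlas 2 u \<longrightarrow>
      L2norm torus_measure u \<le> K * L2norm torus_measure (torus_op u)"
    using torus_op_L2_bound by blast
  show "\<forall>p\<in>topspace torus_top. \<forall>q\<in>topspace torus_top. \<exists>R \<gamma>.
      subunit_path torus_top torus_atlas torus_op R \<gamma> \<and> \<gamma> 0 = p \<and> \<gamma> R = q"
    using subunit_path_exists by simp
  show "\<not> globally_regular torus_atlas torus_measure torus_op"
  proof
    assume "globally_regular torus_atlas torus_measure torus_op"
    then obtain w where "smooth_on UNIV w" "periodic w" "\<And>y. plane_op w y = complex_of_real (sin (y $ 2))"
      by (rule globally_regular_imp_smooth_solution) (rule that; assumption)
    then show False by (rule no_smooth_solution)
  qed
qed

end
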